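(* Let $V\in C^2(\mathbb{R}^d,\mathbb{R})$ be coercive and let $e\in\mathbb{R}^d$ be a critical point of $V$ with $V(e)=0$ and $\min_{\mathbb{R}^d} V<0$. Then $$\mathcal{C}_{-\infty}=(0,c_{\mathrm{nl}}),\quad\text{or equivalently}\quad \mathcal{C}_0=[c_{\mathrm{nl}},+\infty).$$ In addition, if $c_{\mathrm{nl}}$ is larger than $c_{\mathrm{lin}}$ (in particular if $c_{\mathrm{lin}}=0$), then $$c_{\mathrm{nl}}<c_{\mathrm{qh}},$$ and in this case $c_{\mathrm{nl}}$ is the only speed $c$ in $(0,+\infty)$ for which the energy $\mathcal{E}_c[\cdot]$ has a global minimizer in $H^1_{c,e}(\mathbb{R},\mathbb{R}^d)$ which is not identically equal to $e$.
   Context: $d\ge1$ is an integer. For $u\in\mathbb{R}^d$, $u^2$ denotes $|u|^2$. Coercivity of $V$ means $\lim_{R\to+\infty}\inf_{|u|\ge R}\frac{u\cdot\nabla V(u)}{|u|^2}>0$. For $c>0$, $H^1_c(\mathbb{R},\mathbb{R}^d)$ is the set of $w\in H^1_{\mathrm{loc}}(\mathbb{R},\mathbb{R}^d)$ such that $\xi\mapsto e^{c\xi/2}w(\xi)$ and $\xi\mapsto e^{c\xi/2}w'(\xi)$ are in $L^2(\mathbb{R},\mathbb{R}^d)$; $H^1_{c,e}(\mathbb{R},\mathbb{R}^d)=\{w\in H^1_{\mathrm{loc}}: w-e\in H^1_c(\mathbb{R},\mathbb{R}^d)\}$; and for $w\in H^1_{c,e}(\mathbb{R},\mathbb{R}^d)$,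 $\mathcal{E}_c[w]=\int_{\mathbb{R}}e^{c\xi}\bigl(\tfrac12w'(\xi)^2+V(w(\xi))\bigr)\,d\xi\in\mathbb{R}\cup\{+\infty\}$. For every $c>0$ the infimum of $\mathcal{E}_c$ over $H^1_{c,e}(\mathbb{R},\mathbb{R}^d)$ is either $0$ or $-\infty$; $\mathcal{C}_{-\infty}$ (resp. $\mathcal{C}_0$) is the set of $c\in(0,+\infty)$ for which it is $-\infty$ (resp. $0$). The maximal nonlinear invasion speed is $c_{\mathrm{nl}}=\sup\mathcal{C}_{-\infty}$ (the set $\mathcal{C}_{-\infty}$ is nonempty and bounded). Let $\mu_1$ be the least eigenvalue of $D^2V(e)$; the maximal linear invasion speed is $c_{\mathrm{lin}}=2\sqrt{-\mu_1}$ if $\mu_1<0$ and $c_{\mathrm{lin}}=0$ if $\mu_1\ge0$. Let $\mu_{\mathrm{qh}}=\sup\{\mu\in\mathbb{R}:V(u)\ge\tfrac12\mu(u-e)^2\text{ for all }u\in\mathbb{R}^d\}$, which is a finite negative quantity, and let $c_{\mathrm{qh}}=2\sqrt{-\mu_{\mathrm{qh}}}$. *)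

theory Defs
  imports "HOL-Analysis.Analysis"
begin

section \<open>The potential\<close>

definition grad :: "(real^'d \<Rightarrow> real) \<Rightarrow> real^'d \<Rightarrow> real^'d" where
  "grad V u = (THE g. GDERIV V u :> g)"

definition hessian :: "(real^'d \<Rightarrow> real) \<Rightarrow> real^'d \<Rightarrow> real^'d^'d" where
  "hessian V u = jacobian (grad V) (at u)"

definition C2 :: "(real^'d \<Rightarrow> real) \<Rightarrow> bool" where
  "C2 V \<longleftrightarrow> (\<forall>u. V differentiable (at u)) \<and> (\<forall>u. grad V differentiable (at u))
     \<and> continuous_on UNIV (hessian V)"

(* The infimum may be -\<infinity> and the limit may be +\<infinity>, hence ereal. *)
definition coercive :: "(real^'d \<Rightarrow> real) \<Rightarrow> bool" where
  "coercive V \<longleftrightarrow>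
     (\<exists>l>0. ((\<lambda>R::real. INF u\<in>{u. norm u \<ge> R}. ereal ((u \<bullet> grad V u) / (norm u)\<^sup>2)) \<longlongrightarrow> l) at_top)"

section \<open>Weighted Sobolev spaces on the line\<close>

text \<open>Elements of the function spaces are represented by Borel functions; two representatives of
  the same element agree almost everywhere.\<close>

definition L1_loc :: "(real \<Rightarrow> real^'d) set" where
  "L1_loc = {f. \<forall>a b. set_integrable lborel {a..b} f}"

definition L2 :: "(real \<Rightarrow> real^'d) set" where
  "L2 = {f. f \<in> borel_measurable lborel \<and> integrable lborel (\<lambda>x. (norm (f x))\<^sup>2)}"

definition L2_loc :: "(real \<Rightarrow> real^'d) set" where
  "L2_loc = {f. f \<in> borel_measurable lborel \<and>
     (\<forall>a b. set_integrable lborel {a..b} (\<lambda>x. (norm (f x))\<^sup>2))}"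

(* Test functions of class C^1 with compact support, as is common in dimension one
   (e.g. Brezis, Functional Analysis, Sobolev Spaces and PDEs, Section 8.2);
   smooth test functions give the same notion. *)
definition test_function :: "(real \<Rightarrow> real) \<Rightarrow> bool" where
  "test_function \<phi> \<longleftrightarrow> \<phi> C1_differentiable_on UNIV \<and> compact (closure {x. \<phi> x \<noteq> 0})"

definition has_weak_deriv :: "(real \<Rightarrow> real^'d) \<Rightarrow> (real \<Rightarrow> real^'d) \<Rightarrow> bool" where
  "has_weak_deriv w g \<longleftrightarrow> w \<in> L1_loc \<and> g \<in> L1_loc \<and>
     (\<forall>\<phi>. test_function \<phi> \<longrightarrow>
        (LINT x|lborel. deriv \<phi> x *\<^sub>R w x) = - (LINT x|lborel. \<phi> x *\<^sub>R g x))"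

(* Determined almost everywhere, so the choice of representative is immaterial below. *)
definition weak_deriv :: "(real \<Rightarrow> real^'d) \<Rightarrow> real \<Rightarrow> real^'d" where
  "weak_deriv w = (SOME g. has_weak_deriv w g)"

definition H1_loc :: "(real \<Rightarrow> real^'d) set" where
  "H1_loc = {w \<in> L2_loc. \<exists>g\<in>L2_loc. has_weak_deriv w g}"

definition H1c :: "real \<Rightarrow> (real \<Rightarrow> real^'d) set" where
  "H1c c = {w \<in> H1_loc. (\<lambda>\<xi>. exp (c * \<xi> / 2) *\<^sub>R w \<xi>) \<in> L2 \<and>
     (\<lambda>\<xi>. exp (c * \<xi> / 2) *\<^sub>R weak_deriv w \<xi>) \<in> L2}"

definition H1ce :: "real \<Rightarrow> real^'d \<Rightarrow> (real \<Rightarrow> real^'d) set" where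
  "H1ce c e = {w \<in> H1_loc. (\<lambda>\<xi>. w \<xi> - e) \<in> H1c c}"

section \<open>Energy and speeds\<close>

definition energy_density :: "(real^'d \<Rightarrow> real) \<Rightarrow> real \<Rightarrow> (real \<Rightarrow> real^'d) \<Rightarrow> real \<Rightarrow> real" where
  "energy_density V c w \<xi> = exp (c * \<xi>) * ((norm (weak_deriv w \<xi>))\<^sup>2 / 2 + V (w \<xi>))"

(* Integral with values in the extended reals, as positive part minus negative part.
   For w in H1ce c e the negative part is finite because V(u) \<ge> \<mu>|u-e|^2/2 for some real \<mu>. *)
definition energy :: "(real^'d \<Rightarrow> real) \<Rightarrow> real \<Rightarrow> (real \<Rightarrow> real^'d) \<Rightarrow> ereal" where
  "energy V c w =
     enn2ereal (\<integral>\<^sup>+ \<xi>. ennreal (energy_density V c w \<xi>) \<partial>lborel)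
     - enn2ereal (\<integral>\<^sup>+ \<xi>. ennreal (- energy_density V c w \<xi>) \<partial>lborel)"

definition C_minus_inf :: "(real^'d \<Rightarrow> real) \<Rightarrow> real^'d \<Rightarrow> real set" where
  "C_minus_inf V e = {c. 0 < c \<and> (INF w\<in>H1ce c e. energy V c w) = -\<infinity>}"

definition C_zero :: "(real^'d \<Rightarrow> real) \<Rightarrow> real^'d \<Rightarrow> real set" where
  "C_zero V e = {c. 0 < c \<and> (INF w\<in>H1ce c e. energy V c w) = 0}"

definition c_nl :: "(real^'d \<Rightarrow> real) \<Rightarrow> real^'d \<Rightarrow> real" where
  "c_nl V e = Sup (C_minus_inf V e)"

definition is_eigenvalue :: "real^'d^'d \<Rightarrow> real \<Rightarrow> bool" where
  "is_eigenvalue A \<mu> \<longleftrightarrow> (\<exists>v. v \<noteq> 0 \<and> A *v v = \<mu> *\<^sub>R v)"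

definition mu1 :: "(real^'d \<Rightarrow> real) \<Rightarrow> real^'d \<Rightarrow> real" where
  "mu1 V e = (LEAST \<mu>. is_eigenvalue (hessian V e) \<mu>)"

definition c_lin :: "(real^'d \<Rightarrow> real) \<Rightarrow> real^'d \<Rightarrow> real" where
  "c_lin V e = (if mu1 V e < 0 then 2 * sqrt (- mu1 V e) else 0)"

definition mu_qh :: "(real^'d \<Rightarrow> real) \<Rightarrow> real^'d \<Rightarrow> real" where
  "mu_qh V e = Sup {\<mu>. \<forall>u. V u \<ge> \<mu> * (norm (u - e))\<^sup>2 / 2}"

definition c_qh :: "(real^'d \<Rightarrow> real) \<Rightarrow> real^'d \<Rightarrow> real" where
  "c_qh V e = 2 * sqrt (- mu_qh V e)"

definition is_global_minimizer ::
  "(real^'d \<Rightarrow> real) \<Rightarrow> real^'d \<Rightarrow> real \<Rightarrow> (real \<Rightarrow> real^'d) \<Rightarrow> bool" where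
  "is_global_minimizer V e c w \<longleftrightarrow> w \<in> H1ce c e \<and> (\<forall>v\<in>H1ce c e. energy V c w \<le> energy V c v)"

(* "Not identically equal to e" concerns the element of H1ce, not its representative w. *)
definition has_nontrivial_minimizer :: "(real^'d \<Rightarrow> real) \<Rightarrow> real^'d \<Rightarrow> real \<Rightarrow> bool" where
  "has_nontrivial_minimizer V e c \<longleftrightarrow>
     (\<exists>w. is_global_minimizer V e c w \<and> \<not> (AE \<xi> in lborel. w \<xi> = e))"

end

theory Submission
  imports Defs "HOL-Complex_Analysis.Great_Picard" "HOL-Real_Asymp.Real_Asymp"
begin

text \<open>
  Every profile in the affine space at speed \<open>c\<close> is, up to a null set, \<open>e + v\<close> where \<open>v\<close> is the
  primitive, vanishing at \<open>+\<infinity>\<close>, of a function \<open>g\<close> that is square integrable for the weight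
  \<open>exp (c x)\<close>, and \<open>g\<close> is its weak derivative (\<open>tail_in_H1ce\<close>, \<open>H1ce_tailE\<close>). The whole proof is
  carried out with \<open>g\<close> as the unknown. Hardy's inequality \<open>\<integral> exp (c x) |v|\<^sup>2 \<le> 4/c\<^sup>2 \<integral> exp (c x) |g|\<^sup>2\<close>
  (\<open>hardy\<close>) makes the kinetic part of the energy control the negative part of the potential part.

  The energy is homogeneous under translations: shifting by \<open>s\<close> multiplies it by \<open>exp (c s)\<close>. Hence the
  infimum is \<open>-\<infinity>\<close> as soon as some profile has negative energy, and \<open>0\<close> otherwise. Dilating by a
  factor \<open>l\<close> turns a profile for speed \<open>c\<close> into one for speed \<open>l c\<close>, and up to a positive factor only
  multiplies the kinetic part by \<open>l\<^sup>2\<close> (\<open>energy_affine\<close>). So the speeds at which some energy is negative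
  form a down-closed set (\<open>l < 1\<close>) that is open (\<open>l\<close> slightly above \<open>1\<close>); it is nonempty, because a
  front from the minimum of the potential to \<open>e\<close> has energy \<open>V m / c + O(1)\<close> for small \<open>c\<close>, and it is bounded by
  Hardy's inequality. This is \<open>threshold\<close>. The same dilation excludes nontrivial minimizers
  at every other speed: below the threshold the infimum is \<open>-\<infinity>\<close>, and above it a nontrivial profile of zero
  energy would be dilated into one of negative energy at the threshold
  (\<open>nontrivial_minimizer_speed\<close>).

  At the threshold speed \<open>c\<close>, if it exceeds the linear speed, a minimizer is built by the direct method
  (\<open>threshold_minimizer\<close>). Profiles of negative energy at speeds approaching \<open>c\<close> from below are dilated to the speed \<open>c\<close>
  and translated so that their last exit from a small ball around \<open>e\<close> takes place at \<open>0\<close>. To the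
  left of \<open>0\<close> the weight is integrable and the potential bounded below; to the right of \<open>0\<close>
  the potential is at least \<open>-\<kappa>/2 |v|\<^sup>2\<close> with \<open>\<kappa> < c\<^sup>2/4\<close>, because the linear speed is smaller than \<open>c\<close>. Hence the energy
  is the positive definite quadratic form \<open>\<integral> exp (c x) (|v'|\<^sup>2 - \<kappa> |v|\<^sup>2) / 2\<close>, plus the integral of a
  nonnegative function, plus a constant. The first is lower semicontinuous (\<open>weak_compactness\<close>), the
  second by Fatou's lemma, and the normalisation at \<open>0\<close> keeps the limit away from \<open>e\<close>.

  If \<open>c\<close> were at least the speed given by the quadratic hull, the potential would be at least \<open>-c\<^sup>2/8 |v|\<^sup>2\<close>
  everywhere, strictly so at the points where \<open>v\<close> is small and nonzero; the minimizer passes through such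
  points, and Hardy's inequality would give it a positive energy (\<open>threshold_less\<close>).
\<close>

section \<open>Weighted square integrable functions and their primitives\<close>

definition wL2 :: "real \<Rightarrow> (real \<Rightarrow> 'a::euclidean_space) set" where
  "wL2 c = {g \<in> borel_measurable borel. integrable lborel (\<lambda>x. exp (c * x) * (norm (g x))\<^sup>2)}"

definition wnorm2 :: "real \<Rightarrow> (real \<Rightarrow> 'a::euclidean_space) \<Rightarrow> real" where
  "wnorm2 c g = (LINT x|lborel. exp (c * x) * (norm (g x))\<^sup>2)"

text \<open>The primitive of \<open>g\<close> that vanishes at \<open>+\<infinity>\<close>, where the weights \<open>exp (c x)\<close> with \<open>c > 0\<close> grow.\<close>

definition tail :: "(real \<Rightarrow> 'a::euclidean_space) \<Rightarrow> real \<Rightarrow> 'a" where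
  "tail g x = - (LINT t:{x..}|lborel. g t)"

lemma wL2_measurable[measurable_dest]: "g \<in> wL2 c \<Longrightarrow> g \<in> borel_measurable borel"
  by (simp add: wL2_def)

lemma wL2_integrable: "g \<in> wL2 c \<Longrightarrow> integrable lborel (\<lambda>x. exp (c * x) * (norm (g x))\<^sup>2)"
  by (simp add: wL2_def)

lemma wnorm2_nonneg: "0 \<le> wnorm2 c g"
  unfolding wnorm2_def by (rule Bochner_Integration.integral_nonneg) auto

lemma nn_integral_wnorm2:
  "g \<in> wL2 c \<Longrightarrow> (\<integral>\<^sup>+x. ennreal (exp (c * x) * (norm (g x))\<^sup>2) \<partial>lborel) = ennreal (wnorm2 c g)"
  unfolding wnorm2_def by (rule nn_integral_eq_integral[OF wL2_integrable]) auto

lemma wL2_I_nn: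
  assumes [measurable]: "g \<in> borel_measurable borel"
    and "(\<integral>\<^sup>+x. ennreal (exp (c * x) * (norm (g x))\<^sup>2) \<partial>lborel) \<le> ennreal B" and "0 \<le> B"
  shows "g \<in> wL2 c" and "wnorm2 c g \<le> B"
proof -
  have i: "integrable lborel (\<lambda>x. exp (c * x) * (norm (g x))\<^sup>2)"
    using assms by (intro integrableI_bounded) (auto simp: less_top[symmetric] top_unique)
  then show *: "g \<in> wL2 c" by (simp add: wL2_def)
  show "wnorm2 c g \<le> B"
    using assms(2,3) unfolding nn_integral_wnorm2[OF *] by simp
qed

lemma norm_add_sq_le:
  fixes a b :: "'a::real_inner"
  shows "(norm (a + b))\<^sup>2 \<le> 2 * (norm a)\<^sup>2 + 2 * (norm b)\<^sup>2"
proof -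
  have "(norm (a + b))\<^sup>2 + (norm (a - b))\<^sup>2 = 2 * (norm a)\<^sup>2 + 2 * (norm b)\<^sup>2"
    by (simp add: power2_norm_eq_inner inner_add_left inner_add_right inner_diff_left inner_diff_right)
  then show ?thesis by (smt (verit) zero_le_power2)
qed

lemma wL2_zero: "(\<lambda>x. 0) \<in> wL2 c" "wnorm2 c (\<lambda>x. 0) = 0"
  by (auto simp: wL2_def wnorm2_def)

lemma wL2_scale:
  assumes "g \<in> wL2 c"
  shows "(\<lambda>x. a *\<^sub>R g x) \<in> wL2 c" and "wnorm2 c (\<lambda>x. a *\<^sub>R g x) = a\<^sup>2 * wnorm2 c g"
proof -
  have *: "exp (c * x) * (norm (a *\<^sub>R g x))\<^sup>2 = a\<^sup>2 * (exp (c * x) * (norm (g x))\<^sup>2)" for x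
    by (simp add: power_mult_distrib)
  show "(\<lambda>x. a *\<^sub>R g x) \<in> wL2 c" "wnorm2 c (\<lambda>x. a *\<^sub>R g x) = a\<^sup>2 * wnorm2 c g"
    using assms unfolding wL2_def wnorm2_def mem_Collect_eq * by auto
qed

lemma wL2_add:
  assumes "f \<in> wL2 c" "g \<in> wL2 c"
  shows "(\<lambda>x. f x + g x) \<in> wL2 c"
proof -
  note [measurable] = wL2_measurable[OF assms(1)] wL2_measurable[OF assms(2)]
  have "integrable lborel (\<lambda>x. exp (c * x) * (norm (f x + g x))\<^sup>2)"
  proof (rule Bochner_Integration.integrable_bound)
    show "integrable lborel (\<lambda>x. 2 * (exp (c * x) * (norm (f x))\<^sup>2) + 2 * (exp (c * x) * (norm (g x))\<^sup>2))"
      using assms[THEN wL2_integrable] by auto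
    have "exp (c * x) * (norm (f x + g x))\<^sup>2
        \<le> 2 * (exp (c * x) * (norm (f x))\<^sup>2) + 2 * (exp (c * x) * (norm (g x))\<^sup>2)" for x
      using mult_left_mono[OF norm_add_sq_le[of "f x" "g x"], of "exp (c * x)"]
      by (simp add: algebra_simps)
    then show "AE x in lborel. norm (exp (c * x) * (norm (f x + g x))\<^sup>2)
        \<le> norm (2 * (exp (c * x) * (norm (f x))\<^sup>2) + 2 * (exp (c * x) * (norm (g x))\<^sup>2))"
      by simp
  qed measurable
  then show ?thesis by (simp add: wL2_def)
qed

lemma wL2_diff:
  assumes "f \<in> wL2 c" "g \<in> wL2 c"
  shows "(\<lambda>x. f x - g x) \<in> wL2 c"
  using wL2_add[OF assms(1) wL2_scale(1)[OF assms(2), of "-1"]] by simp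

lemma wnorm2_parallelogram:
  assumes "f \<in> wL2 c" "g \<in> wL2 c"
  shows "wnorm2 c (\<lambda>x. f x + g x) + wnorm2 c (\<lambda>x. f x - g x) = 2 * wnorm2 c f + 2 * wnorm2 c g"
proof -
  have "wnorm2 c (\<lambda>x. f x + g x) + wnorm2 c (\<lambda>x. f x - g x) =
     (LINT x|lborel. exp (c * x) * (norm (f x + g x))\<^sup>2 + exp (c * x) * (norm (f x - g x))\<^sup>2)"
    unfolding wnorm2_def
    by (rule Bochner_Integration.integral_add[symmetric])
       (rule wL2_integrable, rule wL2_add wL2_diff, fact, fact)+
  also have "\<dots> = (LINT x|lborel. 2 * (exp (c * x) * (norm (f x))\<^sup>2) + 2 * (exp (c * x) * (norm (g x))\<^sup>2))"
  proof (rule Bochner_Integration.integral_cong[OF refl])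
    fix x
    have "(norm (f x + g x))\<^sup>2 + (norm (f x - g x))\<^sup>2 = 2 * (norm (f x))\<^sup>2 + 2 * (norm (g x))\<^sup>2"
      by (simp add: power2_norm_eq_inner inner_add_left inner_add_right inner_diff_left inner_diff_right)
    then show "exp (c * x) * (norm (f x + g x))\<^sup>2 + exp (c * x) * (norm (f x - g x))\<^sup>2 =
        2 * (exp (c * x) * (norm (f x))\<^sup>2) + 2 * (exp (c * x) * (norm (g x))\<^sup>2)"
      by algebra
  qed
  also have "\<dots> = 2 * wnorm2 c f + 2 * wnorm2 c g"
    unfolding wnorm2_def
    by (subst Bochner_Integration.integral_add) (use assms[THEN wL2_integrable] in auto)
  finally show ?thesis .
qed

text \<open>Cauchy-Schwarz for the factorisation \<open>|g| = exp (- c t / 2) * exp (c t / 2) |g|\<close>. It bounds a primitive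
  pointwise when \<open>A\<close> is a half-line, and gives its modulus of continuity when \<open>A\<close> is an interval.\<close>

lemma wL2_set_integral:
  assumes "g \<in> wL2 c" and [measurable]: "A \<in> sets borel"
    and A: "set_integrable lborel A (\<lambda>t. exp (- (c * t)))"
  shows "set_integrable lborel A g"
    and "(\<integral>\<^sup>+t\<in>A. ennreal (norm (g t)) \<partial>lborel)\<^sup>2
         \<le> ennreal ((LINT t:A|lborel. exp (- (c * t))) * wnorm2 c g)"
    and "(norm (LINT t:A|lborel. g t))\<^sup>2 \<le> (LINT t:A|lborel. exp (- (c * t))) * wnorm2 c g"
proof -
  note [measurable] = wL2_measurable[OF assms(1)]
  let ?f = "\<lambda>t. ennreal (indicator A t * exp (- (c * t / 2)))"
  let ?h = "\<lambda>t. ennreal (exp (c * t / 2) * norm (g t))"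
  have e: "(exp (y / 2))\<^sup>2 = exp y" for y :: real
    by (simp add: exp_double[symmetric])
  have "(\<integral>\<^sup>+t\<in>A. ennreal (norm (g t)) \<partial>lborel) = (\<integral>\<^sup>+t. ?f t * ?h t \<partial>lborel)"
    by (intro nn_integral_cong)
       (auto simp: ennreal_mult[symmetric] exp_minus field_simps split: split_indicator)
  then have "(\<integral>\<^sup>+t\<in>A. ennreal (norm (g t)) \<partial>lborel)\<^sup>2
      \<le> (\<integral>\<^sup>+t. ?f t ^ 2 \<partial>lborel) * (\<integral>\<^sup>+t. ?h t ^ 2 \<partial>lborel)"
    using Cauchy_Schwarz_nn_integral[of ?f lborel ?h] by simp
  also have "(\<integral>\<^sup>+t. ?f t ^ 2 \<partial>lborel) = (\<integral>\<^sup>+t. ennreal (indicator A t *\<^sub>R exp (- (c * t))) \<partial>lborel)"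
    using e[of "- (c * _)"]
    by (intro nn_integral_cong) (auto simp: ennreal_power split: split_indicator)
  also have "\<dots> = ennreal (LINT t:A|lborel. exp (- (c * t)))"
    unfolding set_lebesgue_integral_def
    by (rule nn_integral_eq_integral[OF A[unfolded set_integrable_def]]) auto
  also have "(\<integral>\<^sup>+t. ?h t ^ 2 \<partial>lborel) = ennreal (wnorm2 c g)"
    unfolding nn_integral_wnorm2[OF assms(1), symmetric]
    by (intro nn_integral_cong) (auto simp: ennreal_power power_mult_distrib e)
  finally have le: "(\<integral>\<^sup>+t\<in>A. ennreal (norm (g t)) \<partial>lborel)\<^sup>2
      \<le> ennreal (LINT t:A|lborel. exp (- (c * t))) * ennreal (wnorm2 c g)" .
  then show le': "(\<integral>\<^sup>+t\<in>A. ennreal (norm (g t)) \<partial>lborel)\<^sup>2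
         \<le> ennreal ((LINT t:A|lborel. exp (- (c * t))) * wnorm2 c g)"
    by (simp add: ennreal_mult'' wnorm2_nonneg)
  have eq: "(\<integral>\<^sup>+t\<in>A. ennreal (norm (g t)) \<partial>lborel) = (\<integral>\<^sup>+t. ennreal (norm (indicator A t *\<^sub>R g t)) \<partial>lborel)"
    by (intro nn_integral_cong) (auto split: split_indicator)
  have fin: "(\<integral>\<^sup>+t\<in>A. ennreal (norm (g t)) \<partial>lborel) < \<infinity>"
  proof (rule ccontr)
    assume "\<not> ?thesis"
    then have "(\<integral>\<^sup>+t\<in>A. ennreal (norm (g t)) \<partial>lborel) = top" by (simp add: not_less top_unique)
    then show False using le' by (auto simp: power2_eq_square top_unique)
  qed
  show si: "set_integrable lborel A g"
    unfolding set_integrable_def using fin eq by (intro integrableI_bounded) auto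
  have nn: "0 \<le> (LINT t:A|lborel. exp (- (c * t)))"
    unfolding set_lebesgue_integral_def by (rule Bochner_Integration.integral_nonneg) (auto simp: indicator_def)
  have "ennreal (norm (LINT t:A|lborel. g t)) \<le> (\<integral>\<^sup>+t\<in>A. ennreal (norm (g t)) \<partial>lborel)"
    unfolding eq unfolding set_lebesgue_integral_def
    by (rule integral_norm_bound_ennreal[OF si[unfolded set_integrable_def]])
  then have "(ennreal (norm (LINT t:A|lborel. g t)))\<^sup>2 \<le> (\<integral>\<^sup>+t\<in>A. ennreal (norm (g t)) \<partial>lborel)\<^sup>2"
    by (intro power_mono) auto
  with le' have "ennreal ((norm (LINT t:A|lborel. g t))\<^sup>2)
      \<le> ennreal ((LINT t:A|lborel. exp (- (c * t))) * wnorm2 c g)"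
    by (simp add: ennreal_power)
  then show "(norm (LINT t:A|lborel. g t))\<^sup>2 \<le> (LINT t:A|lborel. exp (- (c * t))) * wnorm2 c g"
    by (rule ennreal_le_iff[THEN iffD1, rotated]) (intro mult_nonneg_nonneg nn wnorm2_nonneg)
qed

lemma exp_half_line:
  fixes c x :: real
  assumes "0 < c"
  shows "set_integrable lborel {x..} (\<lambda>t. exp (- (c * t)))"
    and "(LINT t:{x..}|lborel. exp (- (c * t))) = exp (- (c * x)) / c"
proof -
  have "((\<lambda>t::real. exp (- c * t)) has_integral exp (- c * x) / c) {x..}"
    by (rule has_integral_exp_minus_to_infinity[OF assms])
  then have hi: "((\<lambda>t::real. exp (- (c * t))) has_integral exp (- (c * x)) / c) {x..}" by simp
  then have "set_integrable lebesgue {x..} (\<lambda>t. exp (- (c * t)))"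
    by (intro nonnegative_absolutely_integrable_1) auto
  then show i: "set_integrable lborel {x..} (\<lambda>t. exp (- (c * t)))"
    unfolding set_integrable_def by (subst (asm) integrable_completion) auto
  show "(LINT t:{x..}|lborel. exp (- (c * t))) = exp (- (c * x)) / c"
    using set_borel_integral_eq_integral(2)[OF i] hi by (simp add: integral_unique)
qed

lemma tail_diff:
  assumes "0 < c" "g \<in> wL2 c" "x \<le> y"
  shows "tail g y - tail g x = (LINT t:{x..y}|lborel. g t)"
proof -
  have i: "set_integrable lborel {z..} g" for z
    by (rule wL2_set_integral(1)[OF assms(2) _ exp_half_line(1)[OF assms(1)]]) auto
  have "(LINT t:{x..y} \<union> {y<..}|lborel. g t) = (LINT t:{x..y}|lborel. g t) + (LINT t:{y<..}|lborel. g t)"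
    using assms(3) by (intro set_integral_Un set_integrable_subset[OF i[of x]]) auto
  moreover have "{x..y} \<union> {y<..} = {x..}" using assms(3) by auto
  moreover have "(LINT t:{y<..}|lborel. g t) = (LINT t:{y..}|lborel. g t)"
    by (rule set_integral_discrete_difference[of "{y}"]) auto
  ultimately show ?thesis by (simp add: tail_def)
qed

lemma norm_tail_le:
  assumes "0 < c" "g \<in> wL2 c"
  shows "(norm (tail g x))\<^sup>2 \<le> exp (- (c * x)) / c * wnorm2 c g"
  using wL2_set_integral(3)[OF assms(2) _ exp_half_line(1)[OF assms(1)], of x]
  by (simp add: tail_def exp_half_line(2)[OF assms(1)])

lemma tail_Hoelder:
  assumes "0 < c" "g \<in> wL2 c"
  shows "(norm (tail g y - tail g x))\<^sup>2 \<le> \<bar>y - x\<bar> * exp (- (c * min x y)) * wnorm2 c g"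
proof -
  have *: "(norm (tail g y - tail g x))\<^sup>2 \<le> (y - x) * exp (- (c * x)) * wnorm2 c g"
    if "x \<le> y" for x y
  proof -
    have i: "set_integrable lborel {x..y} (\<lambda>t. exp (- (c * t)))"
      by (rule set_integrable_subset[OF exp_half_line(1)[OF assms(1), of x]]) auto
    have "(norm (tail g y - tail g x))\<^sup>2 \<le> (LINT t:{x..y}|lborel. exp (- (c * t))) * wnorm2 c g"
      unfolding tail_diff[OF assms that] by (rule wL2_set_integral(3)[OF assms(2) _ i]) auto
    moreover have "(LINT t:{x..y}|lborel. exp (- (c * t))) \<le> (LINT t:{x..y}|lborel. exp (- (c * x)))"
    proof (rule set_integral_mono[OF i])
      show "set_integrable lborel {x..y} (\<lambda>t. exp (- (c * x)))"
        unfolding set_integrable_def by (intro integrable_scaleR_left integrable_real_indicator) (auto simp: that)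
    qed (use assms(1) in auto)
    moreover have "(LINT t:{x..y}|lborel. exp (- (c * x))) = (y - x) * exp (- (c * x))"
      using that by (simp add: set_lebesgue_integral_def)
    ultimately show ?thesis
      using mult_right_mono[OF _ wnorm2_nonneg[of c g]] by (simp add: order_trans)
  qed
  show ?thesis
    using *[of x y] *[of y x] norm_minus_commute[of "tail g x" "tail g y"]
    by (cases "x \<le> y") (simp_all add: min_def)
qed

lemma continuous_tail:
  assumes "0 < c" "g \<in> wL2 c"
  shows "continuous_on UNIV (tail g)"
proof (rule continuous_at_imp_continuous_on, rule ballI)
  fix x
  have "((\<lambda>y. \<bar>y - x\<bar> * exp (- (c * min x y)) * wnorm2 c g) \<longlongrightarrow> \<bar>x - x\<bar> * exp (- (c * min x x)) * wnorm2 c g) (at x)"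
    by (intro tendsto_intros)
  then have L: "((\<lambda>y. \<bar>y - x\<bar> * exp (- (c * min x y)) * wnorm2 c g) \<longlongrightarrow> 0) (at x)"
    by simp
  have "((\<lambda>y. (norm (tail g y - tail g x))\<^sup>2) \<longlongrightarrow> 0) (at x)"
  proof (rule tendsto_sandwich[OF _ _ tendsto_const L])
    show "\<forall>\<^sub>F y in at x. (norm (tail g y - tail g x))\<^sup>2 \<le> \<bar>y - x\<bar> * exp (- (c * min x y)) * wnorm2 c g"
      by (intro always_eventually allI tail_Hoelder[OF assms])
  qed auto
  then have "((\<lambda>y. sqrt ((norm (tail g y - tail g x))\<^sup>2)) \<longlongrightarrow> sqrt 0) (at x)"
    by (rule tendsto_real_sqrt)
  then have "((\<lambda>y. norm (tail g y - tail g x)) \<longlongrightarrow> 0) (at x)" by simp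
  then show "isCont (tail g) x"
    unfolding isCont_def by (subst Lim_null) (simp add: tendsto_norm_zero_iff)
qed

lemma measurable_tail:
  assumes "0 < c" "g \<in> wL2 c"
  shows "tail g \<in> borel_measurable borel"
  using continuous_tail[OF assms] by (rule borel_measurable_continuous_onI)

lemma tail_add:
  assumes "0 < c" "f \<in> wL2 c" "g \<in> wL2 c"
  shows "tail (\<lambda>x. f x + g x) = (\<lambda>x. tail f x + tail g x)"
proof
  fix x
  have i: "set_integrable lborel {x..} h" if "h \<in> wL2 c" for h :: "real \<Rightarrow> 'a"
    by (rule wL2_set_integral(1)[OF that _ exp_half_line(1)[OF assms(1)]]) auto
  show "tail (\<lambda>x. f x + g x) x = tail f x + tail g x"
    unfolding tail_def using i[OF assms(2)] i[OF assms(3)] by simp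
qed

lemma tail_scale: "tail (\<lambda>x. a *\<^sub>R f x) = (\<lambda>x. a *\<^sub>R tail f x)"
  by (auto simp: tail_def fun_eq_iff)

lemma tail_diff_fun:
  assumes "0 < c" "f \<in> wL2 c" "g \<in> wL2 c"
  shows "tail (\<lambda>x. f x - g x) = (\<lambda>x. tail f x - tail g x)"
  using tail_add[OF assms(1,2) wL2_scale(1)[OF assms(3), of "-1"]]
  by (simp add: tail_scale[of "-1"] tail_scale[of "-1" g, simplified])

text \<open>Schur's test: with \<open>G y = exp (c y / 2) |g y|\<close>, the weighted primitive is dominated by the convolution
  \<open>\<integral> exp (- c s / 2) G (x + s) ds\<close> over \<open>s \<ge> 0\<close>, whose kernel has mass \<open>2 / c\<close>; Cauchy-Schwarz in \<open>s\<close> and Tonelli give the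
  constant \<open>(2 / c)\<^sup>2\<close>. This constant is the sharp one, which matters since the speeds are compared through
  \<open>c\<^sup>2 / 4\<close>. Working with nonnegative integrals throughout avoids any integration by parts.\<close>

lemma hardy:
  assumes c: "0 < c" and g: "g \<in> wL2 c"
  shows "tail g \<in> wL2 c" and "wnorm2 c (tail g) \<le> 4 / c\<^sup>2 * wnorm2 c g"
proof -
  note [measurable] = wL2_measurable[OF g] measurable_tail[OF c g]
  define G where "G y = ennreal (exp (c * y / 2) * norm (g y))" for y
  have [measurable]: "G \<in> borel_measurable borel" unfolding G_def by measurable
  define k where "k s = ennreal (indicator {0..} s * exp (- (c * s / 2)))" for s :: real
  have [measurable]: "k \<in> borel_measurable borel" unfolding k_def by measurable
  \<comment> \<open>the square root of the kernel, needed to apply Cauchy-Schwarz symmetrically\<close>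
  define h where "h s = ennreal (indicator {0..} s * exp (- (c * s / 4)))" for s :: real
  have [measurable]: "h \<in> borel_measurable borel" unfolding h_def by measurable
  have hk: "h s ^ 2 = k s" for s
    by (auto simp: h_def k_def ennreal_power exp_double[symmetric] split: split_indicator)
  have G2: "(\<integral>\<^sup>+x. (G (x + s))\<^sup>2 \<partial>lborel) = ennreal (wnorm2 c g)" for s
  proof -
    have "(\<integral>\<^sup>+x. (G x)\<^sup>2 \<partial>lborel) = (\<integral>\<^sup>+x. (G (x + s))\<^sup>2 \<partial>lborel)"
      by (subst nn_integral_real_affine[where c = 1 and t = s]) (auto simp: add.commute)
    moreover have "(\<integral>\<^sup>+x. (G x)\<^sup>2 \<partial>lborel) = ennreal (wnorm2 c g)"
      unfolding nn_integral_wnorm2[OF g, symmetric] G_def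
      by (intro nn_integral_cong) (auto simp: ennreal_power power_mult_distrib exp_double[symmetric])
    ultimately show ?thesis by simp
  qed
  have K: "(\<integral>\<^sup>+s. k s \<partial>lborel) = ennreal (2 / c)"
  proof -
    have "(\<integral>\<^sup>+s. k s \<partial>lborel) = (\<integral>\<^sup>+s. ennreal (indicator {0..} s *\<^sub>R exp (- (c / 2 * s))) \<partial>lborel)"
      by (intro nn_integral_cong) (auto simp: k_def)
    also have "\<dots> = ennreal (LINT t:{0..}|lborel. exp (- (c / 2 * t)))"
      unfolding set_lebesgue_integral_def
      by (rule nn_integral_eq_integral)
         (use exp_half_line(1)[of "c/2" 0] c in \<open>auto simp: set_integrable_def\<close>)
    also have "\<dots> = ennreal (2 / c)"
      using exp_half_line(2)[of "c/2" 0] c by simp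
    finally show ?thesis .
  qed
  have pt: "ennreal (exp (c * x) * (norm (tail g x))\<^sup>2) \<le> ennreal (2 / c) * (\<integral>\<^sup>+s. k s * (G (x + s))\<^sup>2 \<partial>lborel)" for x
  proof -
    have si: "set_integrable lborel {x..} g"
      by (rule wL2_set_integral(1)[OF g _ exp_half_line(1)[OF c]]) auto
    have "ennreal (norm (tail g x)) \<le> (\<integral>\<^sup>+t. ennreal (norm (indicator {x..} t *\<^sub>R g t)) \<partial>lborel)"
      unfolding tail_def set_lebesgue_integral_def norm_minus_cancel
      by (rule integral_norm_bound_ennreal[OF si[unfolded set_integrable_def]])
    also have "\<dots> = (\<integral>\<^sup>+s. ennreal (norm (indicator {x..} (x + s) *\<^sub>R g (x + s))) \<partial>lborel)"
      by (subst nn_integral_real_affine[where c = 1 and t = x]) auto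
    finally have "ennreal (exp (c * x / 2)) * ennreal (norm (tail g x))
        \<le> ennreal (exp (c * x / 2)) * (\<integral>\<^sup>+s. ennreal (norm (indicator {x..} (x + s) *\<^sub>R g (x + s))) \<partial>lborel)"
      by (intro mult_left_mono) auto
    also have "\<dots> = (\<integral>\<^sup>+s. ennreal (exp (c * x / 2)) * ennreal (norm (indicator {x..} (x + s) *\<^sub>R g (x + s))) \<partial>lborel)"
      by (rule nn_integral_cmult[symmetric]) measurable
    also have "\<dots> = (\<integral>\<^sup>+s. h s * (h s * G (x + s)) \<partial>lborel)"
    proof (rule nn_integral_cong)
      fix s
      have "exp (c * x / 2) = exp (- (c * s / 4)) * (exp (- (c * s / 4)) * exp (c * (x + s) / 2))"
        by (simp add: exp_add[symmetric] field_simps)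
      then show "ennreal (exp (c * x / 2)) * ennreal (norm (indicator {x..} (x + s) *\<^sub>R g (x + s))) = h s * (h s * G (x + s))"
        by (auto simp: h_def G_def ennreal_mult[symmetric] mult_ac split: split_indicator)
    qed
    finally have "(ennreal (exp (c * x / 2)) * ennreal (norm (tail g x)))\<^sup>2 \<le> (\<integral>\<^sup>+s. h s * (h s * G (x + s)) \<partial>lborel)\<^sup>2"
      by (intro power_mono) auto
    also have "\<dots> \<le> (\<integral>\<^sup>+s. h s ^ 2 \<partial>lborel) * (\<integral>\<^sup>+s. (h s * G (x + s))\<^sup>2 \<partial>lborel)"
      by (rule Cauchy_Schwarz_nn_integral) measurable
    also have "\<dots> = ennreal (2 / c) * (\<integral>\<^sup>+s. k s * (G (x + s))\<^sup>2 \<partial>lborel)"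
      by (simp add: hk power_mult_distrib K)
    also have "(ennreal (exp (c * x / 2)) * ennreal (norm (tail g x)))\<^sup>2 = ennreal (exp (c * x) * (norm (tail g x))\<^sup>2)"
      by (simp add: ennreal_mult[symmetric] ennreal_power power_mult_distrib exp_double[symmetric])
    finally show ?thesis .
  qed
  have "(\<integral>\<^sup>+x. ennreal (exp (c * x) * (norm (tail g x))\<^sup>2) \<partial>lborel)
      \<le> (\<integral>\<^sup>+x. ennreal (2 / c) * (\<integral>\<^sup>+s. k s * (G (x + s))\<^sup>2 \<partial>lborel) \<partial>lborel)"
    by (intro nn_integral_mono pt)
  also have "\<dots> = ennreal (2 / c) * (\<integral>\<^sup>+x. (\<integral>\<^sup>+s. k s * (G (x + s))\<^sup>2 \<partial>lborel) \<partial>lborel)"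
    by (rule nn_integral_cmult) measurable
  also have "(\<integral>\<^sup>+x. (\<integral>\<^sup>+s. k s * (G (x + s))\<^sup>2 \<partial>lborel) \<partial>lborel)
      = (\<integral>\<^sup>+s. (\<integral>\<^sup>+x. k s * (G (x + s))\<^sup>2 \<partial>lborel) \<partial>lborel)"
    by (rule lborel_pair.Fubini') measurable
  also have "\<dots> = (\<integral>\<^sup>+s. k s * ennreal (wnorm2 c g) \<partial>lborel)"
    by (subst nn_integral_cmult) (auto simp: G2)
  also have "\<dots> = ennreal (2 / c) * ennreal (wnorm2 c g)"
    by (subst nn_integral_multc) (auto simp: K)
  also have "ennreal (2 / c) * (ennreal (2 / c) * ennreal (wnorm2 c g)) = ennreal (4 / c\<^sup>2 * wnorm2 c g)"
    using c by (simp add: ennreal_mult[symmetric] wnorm2_nonneg power2_eq_square)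
  finally have fin: "(\<integral>\<^sup>+x. ennreal (exp (c * x) * (norm (tail g x))\<^sup>2) \<partial>lborel) \<le> ennreal (4 / c\<^sup>2 * wnorm2 c g)" .
  show "tail g \<in> wL2 c" "wnorm2 c (tail g) \<le> 4 / c\<^sup>2 * wnorm2 c g"
    by (rule wL2_I_nn[OF _ fin]; simp add: wnorm2_nonneg)+
qed

section \<open>Weak derivatives on the line\<close>

lemma integrable_continuous_scaleR:
  fixes g :: "real \<Rightarrow> 'a::euclidean_space" and \<eta> :: "real \<Rightarrow> real"
  assumes "continuous_on UNIV \<eta>" and z: "\<And>x. x \<notin> {a..b} \<Longrightarrow> \<eta> x = 0"
    and g: "set_integrable lborel {a..b} g"
  shows "integrable lborel (\<lambda>x. \<eta> x *\<^sub>R g x)"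
proof -
  have [measurable]: "\<eta> \<in> borel_measurable borel"
    using assms(1) by (rule borel_measurable_continuous_onI)
  have gi: "integrable lborel (\<lambda>x. indicator {a..b} x *\<^sub>R g x)"
    using g by (simp add: set_integrable_def)
  note [measurable] = borel_measurable_integrable[OF gi]
  have "compact (\<eta> ` {a..b})"
    by (rule compact_continuous_image) (auto intro: continuous_on_subset[OF assms(1)])
  then obtain B where B: "\<And>x. x \<in> {a..b} \<Longrightarrow> \<bar>\<eta> x\<bar> \<le> B"
    by (metis (no_types, lifting) bounded_iff compact_imp_bounded image_eqI real_norm_def)
  have eq: "\<eta> x *\<^sub>R g x = \<eta> x *\<^sub>R (indicator {a..b} x *\<^sub>R g x)" for x
    using z[of x] by (auto split: split_indicator)
  show ?thesis unfolding eq
  proof (rule Bochner_Integration.integrable_bound)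
    show "integrable lborel (\<lambda>x. B *\<^sub>R (indicator {a..b} x *\<^sub>R g x))"
      by (intro integrable_scaleR_right gi)
    show "AE x in lborel. norm (\<eta> x *\<^sub>R (indicator {a..b} x *\<^sub>R g x)) \<le> norm (B *\<^sub>R (indicator {a..b} x *\<^sub>R g x))"
    proof (rule AE_I2)
      fix x show "norm (\<eta> x *\<^sub>R (indicator {a..b} x *\<^sub>R g x)) \<le> norm (B *\<^sub>R (indicator {a..b} x *\<^sub>R g x))"
        using B[of x] by (auto split: split_indicator intro!: mult_right_mono)
    qed
  qed measurable
qed

lemma test_functionE:
  assumes "test_function \<phi>"
  obtains a b where "a < b" "\<And>x. x \<notin> {a<..<b} \<Longrightarrow> \<phi> x = 0" "\<And>x. x \<notin> {a<..<b} \<Longrightarrow> deriv \<phi> x = 0"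
    "\<And>x. (\<phi> has_real_derivative deriv \<phi> x) (at x)" "continuous_on UNIV \<phi>" "continuous_on UNIV (deriv \<phi>)"
proof -
  obtain D where D: "\<And>x. (\<phi> has_vector_derivative D x) (at x)" "continuous_on UNIV D"
    using assms by (auto simp: test_function_def C1_differentiable_on_def)
  have D': "(\<phi> has_real_derivative D x) (at x)" for x
    using D(1) by (simp add: has_real_derivative_iff_has_vector_derivative)
  then have dD: "deriv \<phi> = D" by (auto intro: DERIV_imp_deriv)
  have "bounded (closure {x. \<phi> x \<noteq> 0})"
    using assms by (auto simp: test_function_def compact_imp_bounded)
  then obtain B where B: "\<And>x. x \<in> closure {x. \<phi> x \<noteq> 0} \<Longrightarrow> \<bar>x\<bar> \<le> B"
    by (auto simp: bounded_iff)
  define R where "R = \<bar>B\<bar> + 1"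
  have z: "\<phi> x = 0" if "\<bar>x\<bar> > \<bar>B\<bar>" for x
    using B[of x] closure_subset[of "{x. \<phi> x \<noteq> 0}"] that by fastforce
  have z': "D x = 0" if "\<bar>x\<bar> > \<bar>B\<bar>" for x
  proof -
    have "open {y::real. \<bar>y\<bar> > \<bar>B\<bar>}" by (intro open_Collect_less continuous_intros)
    then have "((\<lambda>x. 0) has_real_derivative D x) (at x)"
      using D'[of x] that z by (elim has_field_derivative_transform_within_open[where S="{y. \<bar>y\<bar> > \<bar>B\<bar>}"]) auto
    then show ?thesis using DERIV_unique[OF _ DERIV_const] by blast
  qed
  show thesis
  proof (rule that[of "-R" R])
    show "\<phi> x = 0" "deriv \<phi> x = 0" if "x \<notin> {-R<..<R}" for x
      using that z[of x] z'[of x] by (auto simp: R_def dD)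
    show "continuous_on UNIV \<phi>"
      using D' by (auto intro!: continuous_at_imp_continuous_on DERIV_isCont)
  qed (use D D' in \<open>auto simp: R_def dD\<close>)
qed

lemma L1_loc_D: "f \<in> L1_loc \<Longrightarrow> set_integrable lborel {a..b} f"
  by (simp add: L1_loc_def)

lemma integrable_test_scaleR:
  assumes "test_function \<phi>" "g \<in> L1_loc"
  shows "integrable lborel (\<lambda>x. \<phi> x *\<^sub>R g x)" "integrable lborel (\<lambda>x. deriv \<phi> x *\<^sub>R g x)"
proof -
  obtain a b where ab: "a < b" "\<And>x. x \<notin> {a<..<b} \<Longrightarrow> \<phi> x = 0" "\<And>x. x \<notin> {a<..<b} \<Longrightarrow> deriv \<phi> x = 0"
    "continuous_on UNIV \<phi>" "continuous_on UNIV (deriv \<phi>)"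
    using test_functionE[OF assms(1)] by metis
  show "integrable lborel (\<lambda>x. \<phi> x *\<^sub>R g x)"
    by (rule integrable_continuous_scaleR[OF ab(4) ab(2) L1_loc_D[OF assms(2), of a b]]) auto
  show "integrable lborel (\<lambda>x. deriv \<phi> x *\<^sub>R g x)"
    by (rule integrable_continuous_scaleR[OF ab(5) ab(3) L1_loc_D[OF assms(2), of a b]]) auto
qed

lemma AE_zero_if_interval_integrals_zero:
  fixes u :: "real \<Rightarrow> 'a::euclidean_space"
  assumes u: "\<And>a b. set_integrable lborel {a..b} u"
    and z: "\<And>a b. a \<le> b \<Longrightarrow> (LINT t:{a..b}|lborel. u t) = 0"
  shows "AE x in lborel. u x = 0"
proof -
  have "AE x in lborel. indicator {- real n..real n} x *\<^sub>R u x = 0" for n :: nat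
  proof -
    define f where "f x = indicator {- real n..real n} x *\<^sub>R u x" for x
    have fi: "integrable lborel f"
      using u[of "- real n" "real n"] by (simp add: f_def[abs_def] set_integrable_def)
    have iv: "(LINT x:{a..b}|lborel. f x) = 0" for a b
    proof -
      have "(LINT x:{a..b}|lborel. f x) = (LINT x:{max a (- real n)..min b (real n)}|lborel. u x)"
        unfolding set_lebesgue_integral_def f_def
        by (intro Bochner_Integration.integral_cong refl) (auto split: split_indicator)
      also have "\<dots> = 0"
      proof (cases "max a (- real n) \<le> min b (real n)")
        case True then show ?thesis by (rule z)
      next
        case False
        then have "{max a (- real n)..min b (real n)} = {}" by auto
        then show ?thesis by (simp add: set_lebesgue_integral_def)
      qed
      finally show ?thesis .
    qed
    have si: "set_integrable lborel A f" if "A \<in> sets borel" for A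
      unfolding set_integrable_def using integrable_mult_indicator[of A lborel f] that fi by simp
    have all: "(LINT x:UNIV|lborel. f x) = 0"
    proof -
      have "(LINT x:UNIV|lborel. f x) = (LINT x:{- real n..real n}|lborel. f x)"
        unfolding set_lebesgue_integral_def f_def
        by (intro Bochner_Integration.integral_cong refl) (auto split: split_indicator)
      then show ?thesis using iv by simp
    qed
    have "(LINT x:A|lborel. f x) = 0" if "A \<in> sets borel" for A
      using that
    proof (induction rule: borel_set_induct)
      case empty show ?case by (simp add: set_lebesgue_integral_def)
    next
      case (interval a b) show ?case by (rule iv)
    next
      case (compl A)
      have "(LINT x:A \<union> - A|lborel. f x) = (LINT x:A|lborel. f x) + (LINT x:- A|lborel. f x)"
        using compl.hyps by (intro set_integral_Un si) auto
      then show ?case using all compl.IH by simp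
    next
      case (union F)
      have "(LINT x:(\<Union>i. F i)|lborel. f x) = (\<Sum>i. LINT x:F i|lborel. f x)"
      proof (rule lebesgue_integral_countable_add)
        show "set_integrable lborel (\<Union>i. F i) f" using union.hyps by (intro si) auto
        show "F i \<inter> F j = {}" if "i \<noteq> j" for i j
          using union.hyps(1) that by (auto simp: disjoint_family_on_def)
      qed (use union.hyps in auto)
      then show ?case using union.IH by simp
    qed
    then have "AE x in lborel. f x = 0" using fi by (intro sigma_finite_measure.density_zero[OF lborel.sigma_finite_measure_axioms]) auto
    then show ?thesis by (simp add: f_def)
  qed
  then have "AE x in lborel. \<forall>n::nat. indicator {- real n..real n} x *\<^sub>R u x = 0"
    unfolding AE_all_countable by blast
  then show ?thesis
  proof eventually_elim
    case (elim x)
    obtain n :: nat where "\<bar>x\<bar> \<le> real n" using real_arch_simple by blast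
    then show ?case using elim[rule_format, of n] by (auto simp: abs_le_iff)
  qed
qed

text \<open>Integration by parts against a test function is Fubini's theorem for \<open>\<phi>' x g t\<close> on the triangle
  \<open>a \<le> x \<le> t \<le> b\<close>.\<close>

lemma has_weak_derivI_increments:
  fixes U g :: "real \<Rightarrow> real^'d"
  assumes g: "g \<in> L1_loc" and U: "continuous_on UNIV U"
    and inc: "\<And>x y. x \<le> y \<Longrightarrow> U y - U x = (LINT t:{x..y}|lborel. g t)"
  shows "has_weak_deriv U g"
proof -
  have UL: "U \<in> L1_loc"
    unfolding L1_loc_def by (auto intro!: borel_integrable_atLeastAtMost' continuous_on_subset[OF U])
  have "(LINT x|lborel. deriv \<phi> x *\<^sub>R U x) = - (LINT x|lborel. \<phi> x *\<^sub>R g x)" if tf: "test_function \<phi>" for \<phi>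
  proof -
    obtain a b where ab: "a < b" "\<And>x. x \<notin> {a<..<b} \<Longrightarrow> \<phi> x = 0" "\<And>x. x \<notin> {a<..<b} \<Longrightarrow> deriv \<phi> x = 0"
      and D: "\<And>x. (\<phi> has_real_derivative deriv \<phi> x) (at x)"
      and C: "continuous_on UNIV \<phi>" "continuous_on UNIV (deriv \<phi>)"
      using test_functionE[OF tf] by metis
    define p where "p x = indicator {a..b} x * deriv \<phi> x" for x
    define q where "q x = indicator {a..b} x *\<^sub>R g x" for x
    have pi: "integrable lborel p"
      unfolding p_def[abs_def]
      using borel_integrable_atLeastAtMost'[OF continuous_on_subset[OF C(2)], of a b]
      by (simp add: set_integrable_def)
    have qi: "integrable lborel q"
      unfolding q_def[abs_def] using L1_loc_D[OF g, of a b] by (simp add: set_integrable_def)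
    note [measurable] = borel_measurable_integrable[OF pi] borel_measurable_integrable[OF qi]
    have FTC: "(LINT x|lborel. indicator {a..t} x *\<^sub>R deriv \<phi> x) = \<phi> t" if "a \<le> t" for t
    proof -
      have "(LINT x|lborel. indicator {a..t} x *\<^sub>R deriv \<phi> x) = \<phi> t - \<phi> a"
        using D that by (intro integral_FTC_atLeastAtMost)
          (auto intro: continuous_on_subset[OF C(2)] has_vector_derivative_at_within
             simp: has_real_derivative_iff_has_vector_derivative)
      then show ?thesis using ab(2)[of a] by simp
    qed
    define F where "F x t = (if x \<le> t then p x *\<^sub>R q t else 0)" for x t
    have Fm[measurable]: "case_prod F \<in> borel_measurable (lborel \<Otimes>\<^sub>M lborel)"
      unfolding F_def by measurable
    have Fi: "integrable (lborel \<Otimes>\<^sub>M lborel) (case_prod F)"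
    proof (rule integrableI_bounded)
      have "(\<integral>\<^sup>+ z. ennreal (norm (case_prod F z)) \<partial>(lborel \<Otimes>\<^sub>M lborel))
          \<le> (\<integral>\<^sup>+ z. (case z of (x, t) \<Rightarrow> ennreal (norm (p x)) * ennreal (norm (q t))) \<partial>(lborel \<Otimes>\<^sub>M lborel))"
        by (intro nn_integral_mono)
           (auto simp: F_def ennreal_mult[symmetric] split: split_indicator)
      also have "\<dots> = (\<integral>\<^sup>+ x. \<integral>\<^sup>+ t. ennreal (norm (p x)) * ennreal (norm (q t)) \<partial>lborel \<partial>lborel)"
      proof -
        have m: "(\<lambda>(x, t). ennreal (norm (p x)) * ennreal (norm (q t))) \<in> borel_measurable (lborel \<Otimes>\<^sub>M lborel)"
          by measurable
        show ?thesis using lborel.nn_integral_fst[OF m] by simp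
      qed
      also have "\<dots> = (\<integral>\<^sup>+ x. ennreal (norm (p x)) \<partial>lborel) * (\<integral>\<^sup>+ t. ennreal (norm (q t)) \<partial>lborel)"
        by (simp add: nn_integral_cmult nn_integral_multc)
      also have "\<dots> < \<infinity>"
        using pi qi by (simp add: integrable_iff_bounded ennreal_mult_less_top)
      finally show "(\<integral>\<^sup>+ z. ennreal (norm (case_prod F z)) \<partial>(lborel \<Otimes>\<^sub>M lborel)) < \<infinity>" .
    qed measurable
    have inner_t: "(LINT t|lborel. F x t) = p x *\<^sub>R (U b - U x)" for x
    proof (cases "x \<in> {a..b}")
      case True
      have "(LINT t|lborel. F x t) = (LINT t|lborel. p x *\<^sub>R (indicator {x..b} t *\<^sub>R g t))"
        using True by (intro Bochner_Integration.integral_cong refl) (auto simp: F_def q_def split: split_indicator)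
      also have "\<dots> = p x *\<^sub>R (LINT t:{x..b}|lborel. g t)"
        unfolding set_lebesgue_integral_def by (rule integral_scaleR_right)
      finally show ?thesis using inc[of x b] True by simp
    next
      case False
      then have "p x = 0" by (simp add: p_def)
      then show ?thesis by (simp add: F_def cong: if_cong)
    qed
    have inner_x: "(LINT x|lborel. F x t) = \<phi> t *\<^sub>R g t" for t
    proof (cases "t \<in> {a..b}")
      case True
      have "(LINT x|lborel. F x t) = (LINT x|lborel. (indicator {a..t} x *\<^sub>R deriv \<phi> x) *\<^sub>R g t)"
        using True by (intro Bochner_Integration.integral_cong refl) (auto simp: F_def q_def p_def split: split_indicator)
      also have "\<dots> = (LINT x|lborel. indicator {a..t} x *\<^sub>R deriv \<phi> x) *\<^sub>R g t"
        by (rule integral_scaleR_left)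
           (use borel_integrable_atLeastAtMost'[OF continuous_on_subset[OF C(2)], of a t] in \<open>auto simp: set_integrable_def\<close>)
      finally show ?thesis using FTC[of t] True by simp
    next
      case False
      then have "q t = 0" "\<phi> t = 0" using ab(2)[of t] by (auto simp: q_def)
      then show ?thesis by (simp add: F_def cong: if_cong)
    qed
    have "(LINT t|lborel. \<phi> t *\<^sub>R g t) = (LINT t|lborel. LINT x|lborel. F x t)"
      by (simp add: inner_x)
    also have "\<dots> = (LINT x|lborel. LINT t|lborel. F x t)"
      by (rule lborel_pair.Fubini_integral[OF Fi])
    also have "\<dots> = (LINT x|lborel. p x *\<^sub>R U b - deriv \<phi> x *\<^sub>R U x)"
    proof (intro Bochner_Integration.integral_cong refl)
      fix x show "(LINT t|lborel. F x t) = p x *\<^sub>R U b - deriv \<phi> x *\<^sub>R U x"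
        using ab(3)[of x] by (auto simp: inner_t p_def algebra_simps split: split_indicator)
    qed
    also have "\<dots> = (LINT x|lborel. p x *\<^sub>R U b) - (LINT x|lborel. deriv \<phi> x *\<^sub>R U x)"
      using pi integrable_test_scaleR(2)[OF tf UL] by (intro Bochner_Integration.integral_diff) auto
    also have "(LINT x|lborel. p x *\<^sub>R U b) = 0"
      using FTC[of b] ab(1) ab(2)[of b] pi by (simp add: p_def[abs_def])
    finally show ?thesis by simp
  qed
  then show ?thesis using UL g by (simp add: has_weak_deriv_def)
qed

text \<open>The derivatives of test functions are exactly the continuous functions of compact support and mean zero;
  this is the direction that produces test functions.\<close>

lemma test_function_primitive:
  fixes \<eta> :: "real \<Rightarrow> real"
  assumes C: "continuous_on UNIV \<eta>" and z: "\<And>x. x \<notin> {- R<..<R} \<Longrightarrow> \<eta> x = 0" and R: "0 < R"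
    and mean: "(LINT x|lborel. \<eta> x) = 0"
  obtains \<phi> where "test_function \<phi>" "deriv \<phi> = \<eta>"
proof -
  obtain F where F: "\<And>x. (F has_vector_derivative \<eta> x) (at x)"
    using einterval_antiderivative[of "-\<infinity>" "\<infinity>" \<eta>] C
    by (auto simp: continuous_on_eq_continuous_at)
  have FTC: "(LINT x|lborel. indicator {p..q} x *\<^sub>R \<eta> x) = F q - F p" if "p \<le> q" for p q
    using that F by (intro integral_FTC_atLeastAtMost)
      (auto intro: has_vector_derivative_at_within continuous_on_subset[OF C])
  define \<phi> where "\<phi> x = F x - F (- R)" for x
  have d: "(\<phi> has_vector_derivative \<eta> x) (at x)" for x
    unfolding \<phi>_def[abs_def] using has_vector_derivative_diff[OF F[of x] has_vector_derivative_const[of "F (-R)"]] by simp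
  have out: "\<phi> x = 0" if "x \<notin> {- R..R}" for x
  proof (cases "x < - R")
    case True
    then have "F (- R) - F x = (LINT y|lborel. indicator {x..- R} y *\<^sub>R \<eta> y)" by (intro FTC[symmetric]) simp
    also have "\<dots> = (LINT y|(lborel::real measure). (0::real))"
      by (intro Bochner_Integration.integral_cong refl) (use z R in \<open>auto split: split_indicator\<close>)
    finally show ?thesis by (simp add: \<phi>_def)
  next
    case False
    with that have "R < x" by auto
    then have "F x - F (- R) = (LINT y|lborel. indicator {- R..x} y *\<^sub>R \<eta> y)"
      using R by (intro FTC[symmetric]) simp
    also have "\<dots> = (LINT y|lborel. \<eta> y)"
      by (intro Bochner_Integration.integral_cong refl) (use z R \<open>R < x\<close> in \<open>auto split: split_indicator\<close>)
    finally show ?thesis by (simp add: \<phi>_def mean)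
  qed
  have "closure {x. \<phi> x \<noteq> 0} \<subseteq> {- R..R}"
  proof (rule closure_minimal)
    show "{x. \<phi> x \<noteq> 0} \<subseteq> {- R..R}" using out by blast
  qed auto
  then have "compact (closure {x. \<phi> x \<noteq> 0})"
    by (meson bounded_closed_interval bounded_subset closed_closure compact_eq_bounded_closed)
  then have "test_function \<phi>"
    unfolding test_function_def C1_differentiable_on_def using d C by auto
  moreover have "deriv \<phi> = \<eta>"
    using d by (auto simp: has_real_derivative_iff_has_vector_derivative[symmetric] intro: DERIV_imp_deriv)
  ultimately show thesis by (rule that)
qed

text \<open>The lemma of du Bois-Reymond. A fixed trapezoid normalises the mean, so that every trapezoid minus a
  multiple of the fixed one is the derivative of a test function; hence the pairing of \<open>u\<close> with any trapezoid is proportional to its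
  mass. Letting trapezoids decrease to the indicator of an interval shows that \<open>u - K\<close> has zero integral over every
  interval.\<close>

lemma const_if_orthogonal_to_derivatives:
  fixes u :: "real \<Rightarrow> real^'d"
  assumes u: "u \<in> L1_loc"
    and orth: "\<And>\<phi>. test_function \<phi> \<Longrightarrow> (LINT x|lborel. deriv \<phi> x *\<^sub>R u x) = 0"
  obtains K where "AE x in lborel. u x = K"
proof -
  define \<tau> :: "real \<Rightarrow> real \<Rightarrow> nat \<Rightarrow> real \<Rightarrow> real"
    where "\<tau> a b n x = max 0 (1 - real (Suc n) * max 0 (max (a - x) (x - b)))" for a b n x
  have C: "continuous_on UNIV (\<tau> a b n)" for a b n
    unfolding \<tau>_def[abs_def] by (intro continuous_intros)
  have [measurable]: "\<tau> a b n \<in> borel_measurable borel" for a b n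
    using C by (rule borel_measurable_continuous_onI)
  have out: "\<tau> a b n x = 0" if "x \<notin> {a - 1<..<b + 1}" for a b n x
  proof -
    have "1 \<le> max 0 (max (a - x) (x - b))" using that by auto
    then have "1 \<le> real (Suc n) * max 0 (max (a - x) (x - b))"
      using mult_mono[of 1 "real (Suc n)" 1 "max 0 (max (a - x) (x - b))"] by simp
    then show ?thesis by (simp add: \<tau>_def)
  qed
  have ins: "\<tau> a b n x = 1" if "x \<in> {a..b}" for a b n x
  proof -
    have "max 0 (max (a - x) (x - b)) = 0" using that by auto
    then show ?thesis by (simp add: \<tau>_def)
  qed
  have bd: "0 \<le> \<tau> a b n x \<and> \<tau> a b n x \<le> 1" for a b n x
    by (auto simp: \<tau>_def)
  have i1: "integrable lborel (\<tau> a b n)" for a b n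
  proof -
    have "set_integrable lborel {a-1..b+1} (\<lambda>x. 1::real)"
      by (intro borel_integrable_atLeastAtMost') auto
    from integrable_continuous_scaleR[OF C _ this, of a b n] show ?thesis
      using out[of _ a b n] by fastforce
  qed
  have iu: "integrable lborel (\<lambda>x. \<tau> a b n x *\<^sub>R u x)" for a b n
  proof (rule integrable_continuous_scaleR[OF C _ L1_loc_D[OF u]])
    show "\<tau> a b n x = 0" if "x \<notin> {a - 1..b + 1}" for x using out[of x a b n] that by auto
  qed
  have lim: "(\<lambda>n. \<tau> a b n x) \<longlonglongrightarrow> indicator {a..b} x" for a b x
  proof (cases "x \<in> {a..b}")
    case True then show ?thesis by (simp add: ins)
  next
    case False
    define r where "r = max 0 (max (a - x) (x - b))"
    have r: "r > 0" using False by (auto simp: r_def)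
    obtain N :: nat where N: "1 / r < real N" using reals_Archimedean2 by blast
    have "\<tau> a b n x = 0" if "n \<ge> N" for n
    proof -
      have "1 / r < real (Suc n)" using N that by linarith
      then have "1 < real (Suc n) * r" using r by (simp add: field_simps)
      then show ?thesis by (simp add: \<tau>_def r_def[symmetric])
    qed
    then have "(\<lambda>n. \<tau> a b n x) \<longlonglongrightarrow> 0"
      by (intro tendsto_eventually) (auto simp: eventually_sequentially)
    then show ?thesis using False by simp
  qed
  define M where "M = (LINT x|lborel. \<tau> 0 1 0 x)"
  have M: "1 \<le> M"
  proof -
    have "(LINT x|lborel. indicator {0..1::real} x) \<le> M"
      unfolding M_def by (intro integral_mono i1) (auto simp: ins bd split: split_indicator)
    then show ?thesis by simp
  qed
  define K where "K = (1 / M) *\<^sub>R (LINT x|lborel. \<tau> 0 1 0 x *\<^sub>R u x)"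
  have eq: "(LINT x|lborel. \<tau> a b n x *\<^sub>R u x) = (LINT x|lborel. \<tau> a b n x) *\<^sub>R K" for a b n
  proof -
    define m where "m = (LINT x|lborel. \<tau> a b n x) / M"
    define \<eta> where "\<eta> x = \<tau> a b n x - m * \<tau> 0 1 0 x" for x
    define R where "R = \<bar>a\<bar> + \<bar>b\<bar> + 3"
    have "(LINT x|lborel. \<eta> x) = 0"
      unfolding \<eta>_def using i1 M by (simp add: m_def M_def[symmetric])
    then obtain \<phi> where \<phi>: "test_function \<phi>" "deriv \<phi> = \<eta>"
    proof (rule test_function_primitive[rotated 3])
      show "continuous_on UNIV \<eta>" unfolding \<eta>_def[abs_def] by (intro continuous_intros C)
      show "\<eta> x = 0" if "x \<notin> {- R<..<R}" for x
      proof -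
        have "x \<notin> {a - 1<..<b + 1}" "x \<notin> {0 - 1<..<1 + 1}" using that by (auto simp: R_def)
        then show ?thesis using out by (simp add: \<eta>_def)
      qed
    qed (auto simp: R_def)
    have "0 = (LINT x|lborel. \<tau> a b n x *\<^sub>R u x - m *\<^sub>R (\<tau> 0 1 0 x *\<^sub>R u x))"
      using orth[OF \<phi>(1)] unfolding \<phi>(2) \<eta>_def by (simp add: algebra_simps)
    also have "\<dots> = (LINT x|lborel. \<tau> a b n x *\<^sub>R u x) - m *\<^sub>R (LINT x|lborel. \<tau> 0 1 0 x *\<^sub>R u x)"
      using iu by (subst Bochner_Integration.integral_diff)
        (auto simp del: scaleR_scaleR intro!: integrable_scaleR_right)
    finally show ?thesis by (simp add: K_def m_def)
  qed
  have iv: "(LINT t:{a..b}|lborel. u t) = (b - a) *\<^sub>R K" if "a \<le> b" for a b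
  proof -
    note ui = L1_loc_D[OF u, of "a - 1" "b + 1", unfolded set_integrable_def]
    have um[measurable]: "(\<lambda>x. indicator {a-1..b+1} x *\<^sub>R u x) \<in> borel_measurable borel"
      using borel_measurable_integrable[OF ui] by simp
    have "(\<lambda>n. LINT x|lborel. \<tau> a b n x *\<^sub>R u x) \<longlonglongrightarrow> (LINT x|lborel. indicator {a..b} x *\<^sub>R u x)"
    proof (rule integral_dominated_convergence[where w="\<lambda>x. norm (indicator {a-1..b+1} x *\<^sub>R u x)"])
      show "(\<lambda>x. indicator {a..b} x *\<^sub>R u x) \<in> borel_measurable lborel"
        using borel_measurable_integrable[OF L1_loc_D[OF u, of a b, unfolded set_integrable_def]] by simp
      show "(\<lambda>x. \<tau> a b n x *\<^sub>R u x) \<in> borel_measurable lborel" for n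
        using borel_measurable_integrable[OF iu] .
      show "integrable lborel (\<lambda>x. norm (indicator {a-1..b+1} x *\<^sub>R u x))"
        using ui by (rule integrable_norm)
      show "AE x in lborel. (\<lambda>n. \<tau> a b n x *\<^sub>R u x) \<longlonglongrightarrow> indicator {a..b} x *\<^sub>R u x"
        by (intro AE_I2 tendsto_intros lim)
      show "AE x in lborel. norm (\<tau> a b n x *\<^sub>R u x) \<le> norm (indicator {a-1..b+1} x *\<^sub>R u x)" for n
      proof (rule AE_I2)
        fix x
        show "norm (\<tau> a b n x *\<^sub>R u x) \<le> norm (indicator {a-1..b+1} x *\<^sub>R u x)"
          using bd[of a b n x] out[of x a b n]
          by (cases "x \<in> {a-1..b+1}") (auto intro!: mult_left_le_one_le)
      qed
    qed
    moreover have "(\<lambda>n. (LINT x|lborel. \<tau> a b n x) *\<^sub>R K) \<longlonglongrightarrow> (LINT x|lborel. indicator {a..b} x) *\<^sub>R K"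
    proof (intro tendsto_intros integral_dominated_convergence[where w="indicator {a-1..b+1}"])
      show "integrable lborel (indicator {a-1..b+1} :: real \<Rightarrow> real)"
        by (rule integrable_real_indicator) (use that in auto)
      show "AE x in lborel. (\<lambda>n. \<tau> a b n x) \<longlonglongrightarrow> indicator {a..b} x"
        by (intro AE_I2 lim)
      show "AE x in lborel. norm (\<tau> a b n x) \<le> indicator {a-1..b+1} x" for n
      proof (rule AE_I2)
        fix x show "norm (\<tau> a b n x) \<le> indicator {a-1..b+1} x"
          using bd[of a b n x] out[of x a b n] by (cases "x \<in> {a-1..b+1}") auto
      qed
    qed measurable
    ultimately have "(LINT x|lborel. indicator {a..b} x *\<^sub>R u x) = (LINT x|lborel. indicator {a..b} x) *\<^sub>R K"
      unfolding eq by (rule LIMSEQ_unique)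
    then show ?thesis using that by (simp add: set_lebesgue_integral_def)
  qed
  have ci: "set_integrable lborel {a..b} (\<lambda>x. K)" for a b :: real
    by (intro borel_integrable_atLeastAtMost') auto
  have "AE x in lborel. u x - K = 0"
  proof (rule AE_zero_if_interval_integrals_zero)
    show "set_integrable lborel {a..b} (\<lambda>x. u x - K)" for a b
      by (intro set_integral_diff L1_loc_D[OF u] ci)
    show "(LINT t:{a..b}|lborel. u t - K) = 0" if "a \<le> b" for a b
    proof -
      have "(LINT t:{a..b}|lborel. u t - K) = (b - a) *\<^sub>R K - (LINT t:{a..b}|lborel. K)"
        using iv[OF that] by (subst set_integral_diff(2)[OF L1_loc_D[OF u] ci]) simp
      also have "(LINT t:{a..b}|lborel. K) = (b - a) *\<^sub>R K"
        using that by (simp add: set_integral_const)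
      finally show ?thesis by simp
    qed
  qed
  then show thesis by (intro that[of K]) simp
qed

lemma AE_const_continuous:
  fixes U :: "real \<Rightarrow> 'a::euclidean_space"
  assumes U: "continuous_on UNIV U" and ae: "AE x in lborel. U x = K"
  shows "U x = K"
proof -
  have op: "open {x. U x \<noteq> K}"
    using U by (intro open_Collect_neq continuous_intros)
  have "{x. U x \<noteq> K} \<in> null_sets lborel"
    using ae op by (simp add: AE_iff_null_sets)
  then have "negligible {x. U x \<noteq> K}"
    by (simp add: negligible_iff_null_sets null_sets_completionI)
  with op have "{x. U x \<noteq> K} = {}" using open_not_negligible by blast
  then show ?thesis by blast
qed

lemma has_weak_deriv_diff:
  fixes w g :: "real \<Rightarrow> real^'d"
  assumes "has_weak_deriv w g" "has_weak_deriv w' g'"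
  shows "has_weak_deriv (\<lambda>x. w x - w' x) (\<lambda>x. g x - g' x)"
proof -
  have L: "w \<in> L1_loc" "w' \<in> L1_loc" "g \<in> L1_loc" "g' \<in> L1_loc"
    using assms by (auto simp: has_weak_deriv_def)
  have "(\<lambda>x. w x - w' x) \<in> L1_loc" "(\<lambda>x. g x - g' x) \<in> L1_loc"
    using L by (auto simp: L1_loc_def)
  moreover have "(LINT x|lborel. deriv \<phi> x *\<^sub>R (w x - w' x)) = - (LINT x|lborel. \<phi> x *\<^sub>R (g x - g' x))"
    if t: "test_function \<phi>" for \<phi>
    using assms t integrable_test_scaleR[OF t L(1)] integrable_test_scaleR[OF t L(2)]
      integrable_test_scaleR[OF t L(3)] integrable_test_scaleR[OF t L(4)]
    by (simp add: has_weak_deriv_def scaleR_diff_right)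
  ultimately show ?thesis by (simp add: has_weak_deriv_def)
qed

lemma has_weak_deriv_const: "has_weak_deriv (\<lambda>x. K :: real^'d) (\<lambda>x. 0)"
  by (rule has_weak_derivI_increments) (auto simp: L1_loc_def set_integrable_def)

text \<open>The difference \<open>h\<close> of two weak derivatives is a weak derivative of \<open>0\<close>, hence orthogonal to all test functions.
  Its primitive then has pairing zero with all derivatives of test functions, so it is constant.\<close>

lemma has_weak_deriv_unique:
  fixes w g g' :: "real \<Rightarrow> real^'d"
  assumes "has_weak_deriv w g" "has_weak_deriv w g'"
  shows "AE x in lborel. g x = g' x"
proof -
  define h where "h x = g x - g' x" for x
  have wh: "has_weak_deriv (\<lambda>x. 0) h"
    using has_weak_deriv_diff[OF assms] by (simp add: h_def[abs_def])
  then have hL: "h \<in> L1_loc" by (simp add: has_weak_deriv_def)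
  have hi: "h integrable_on {a..b}" and hI: "integral {a..b} h = (LINT t:{a..b}|lborel. h t)" for a b
    using set_borel_integral_eq_integral[OF L1_loc_D[OF hL]] by auto
  define U where "U x = integral {0..x} h - integral {x..0} h" for x
  have inc0: "U y - U x = integral {x..y} h" if "x \<le> y" for x y
  proof -
    have e: "integral {y..0} h = 0" if "y \<ge> 0" for y
      using that by (cases "y = 0") auto
    have e': "integral {0..y} h = 0" if "y \<le> 0" for y
      using that by (cases "y = 0") auto
    consider "0 \<le> x" | "x \<le> 0" "0 \<le> y" | "y \<le> 0" by linarith
    then show ?thesis
    proof cases
      case 1
      then show ?thesis using that Henstock_Kurzweil_Integration.integral_combine[OF 1 that hi] e[of x] e[of y]
        by (simp add: U_def algebra_simps)
    next
      case 2
      then show ?thesis using Henstock_Kurzweil_Integration.integral_combine[OF 2 hi] e'[of x] e[of y]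
        by (simp add: U_def algebra_simps)
    next
      case 3
      then show ?thesis using that Henstock_Kurzweil_Integration.integral_combine[OF that 3 hi] e'[of x] e'[of y]
        by (simp add: U_def algebra_simps)
    qed
  qed
  have cU: "continuous_on UNIV U"
  proof (rule continuous_at_imp_continuous_on, rule ballI)
    fix x
    have "continuous_on {x - 1..x + 1} (\<lambda>y. U (x - 1) + integral {x - 1..y} h)"
      by (intro continuous_intros indefinite_integral_continuous_1 hi)
    moreover have "U (x - 1) + integral {x - 1..y} h = U y" if "y \<in> {x - 1..x + 1}" for y
      using inc0[of "x - 1" y, symmetric] that by simp
    ultimately have "continuous_on {x - 1..x + 1} U" by (simp cong: continuous_on_cong_simp)
    then show "isCont U x"
      by (intro continuous_on_interior[of "{x - 1..x + 1}"]) (auto simp: interior_atLeastAtMost_real)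
  qed
  have "has_weak_deriv U h"
    using inc0 by (intro has_weak_derivI_increments[OF hL cU]) (simp add: hI)
  then have "(LINT x|lborel. deriv \<phi> x *\<^sub>R U x) = 0" if "test_function \<phi>" for \<phi>
    using wh that by (simp add: has_weak_deriv_def)
  moreover have "U \<in> L1_loc" using \<open>has_weak_deriv U h\<close> by (simp add: has_weak_deriv_def)
  ultimately obtain K where "AE x in lborel. U x = K"
    using const_if_orthogonal_to_derivatives by blast
  then have UK: "U x = K" for x by (rule AE_const_continuous[OF cU])
  have "AE x in lborel. h x = 0"
  proof (rule AE_zero_if_interval_integrals_zero[OF L1_loc_D[OF hL]])
    show "(LINT t:{a..b}|lborel. h t) = 0" if "a \<le> b" for a b
      using inc0[OF that] by (simp add: hI UK)
  qed
  then show ?thesis by (simp add: h_def)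
qed

lemma has_weak_deriv_weak_deriv: "has_weak_deriv w g \<Longrightarrow> has_weak_deriv w (weak_deriv w)"
  unfolding weak_deriv_def by (rule someI[where P="has_weak_deriv w"])

lemma weak_deriv_AE_eq: "has_weak_deriv w g \<Longrightarrow> AE x in lborel. weak_deriv w x = g x"
  by (rule has_weak_deriv_unique[OF has_weak_deriv_weak_deriv])

lemma L1_loc_measurable:
  fixes f :: "real \<Rightarrow> real^'d"
  assumes "f \<in> L1_loc" shows "f \<in> borel_measurable borel"
proof (rule borel_measurable_LIMSEQ_metric)
  show "(\<lambda>x. indicator {- real n..real n} x *\<^sub>R f x) \<in> borel_measurable borel" for n
    using borel_measurable_integrable[OF L1_loc_D[OF assms, unfolded set_integrable_def]] by simp
  fix x
  obtain N :: nat where N: "\<bar>x\<bar> \<le> real N" using real_arch_simple by blast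
  have "indicator {- real n..real n} x *\<^sub>R f x = f x" if "n \<ge> N" for n
  proof -
    have "\<bar>x\<bar> \<le> real n" using N that by linarith
    then show ?thesis by (auto simp: indicator_def)
  qed
  then show "(\<lambda>n. indicator {- real n..real n} x *\<^sub>R f x) \<longlonglongrightarrow> f x"
    by (intro tendsto_eventually) (auto simp: eventually_sequentially)
qed

lemma wL2_L1_loc:
  fixes g :: "real \<Rightarrow> real^'d"
  assumes "0 < c" "g \<in> wL2 c" shows "g \<in> L1_loc"
  unfolding L1_loc_def
proof (intro CollectI allI)
  fix a b
  have "set_integrable lborel {a..} g"
    by (rule wL2_set_integral(1)[OF assms(2) _ exp_half_line(1)[OF assms(1)]]) auto
  then show "set_integrable lborel {a..b} g" by (rule set_integrable_subset) auto
qed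

lemma has_weak_deriv_tail:
  fixes g :: "real \<Rightarrow> real^'d"
  assumes "0 < c" "g \<in> wL2 c" shows "has_weak_deriv (\<lambda>x. e + tail g x) g"
  using assms by (intro has_weak_derivI_increments wL2_L1_loc[of c])
    (auto intro!: continuous_intros continuous_tail simp: tail_diff)

lemma wL2_iff_L2:
  fixes g :: "real \<Rightarrow> real^'d"
  shows "(\<lambda>x. exp (c * x / 2) *\<^sub>R g x) \<in> L2 \<longleftrightarrow> g \<in> wL2 c"
proof -
  have "(\<lambda>x. exp (c * x / 2) *\<^sub>R g x) \<in> borel_measurable borel \<longleftrightarrow> g \<in> borel_measurable borel"
  proof
    assume m: "(\<lambda>x. exp (c * x / 2) *\<^sub>R g x) \<in> borel_measurable borel"
    have "(\<lambda>x. exp (- (c * x / 2)) *\<^sub>R (exp (c * x / 2) *\<^sub>R g x)) \<in> borel_measurable borel"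
      by (rule borel_measurable_scaleR[OF _ m]) measurable
    moreover have "(\<lambda>x. exp (- (c * x / 2)) *\<^sub>R (exp (c * x / 2) *\<^sub>R g x)) = g"
      by (simp add: fun_eq_iff mult_exp_exp)
    ultimately show "g \<in> borel_measurable borel" by metis
  qed measurable
  moreover have "(norm (exp (c * x / 2) *\<^sub>R g x))\<^sup>2 = exp (c * x) * (norm (g x))\<^sup>2" for x
    by (simp add: power_mult_distrib exp_double[symmetric])
  ultimately show ?thesis by (simp add: L2_def wL2_def)
qed

lemma tail_in_H1ce:
  fixes g :: "real \<Rightarrow> real^'d"
  assumes c: "0 < c" and g: "g \<in> wL2 c" shows "(\<lambda>x. e + tail g x) \<in> H1ce c e"
proof -
  note [measurable] = wL2_measurable[OF g]
  have "g \<in> L2_loc"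
  proof -
    have "set_integrable lborel {a..b} (\<lambda>x. (norm (g x))\<^sup>2)" for a b
      unfolding set_integrable_def
    proof (rule Bochner_Integration.integrable_bound)
      show "integrable lborel (\<lambda>x. exp (- (c * a)) * (exp (c * x) * (norm (g x))\<^sup>2))"
        using wL2_integrable[OF g] by simp
      have "1 \<le> exp (- (c * a)) * exp (c * x)" if "a \<le> x" for x
        using c that by (simp add: exp_add[symmetric])
      then have "indicator {a..b} x *\<^sub>R (norm (g x))\<^sup>2 \<le> exp (- (c * a)) * (exp (c * x) * (norm (g x))\<^sup>2)" for x
        using mult_right_mono[of 1 "exp (- (c * a)) * exp (c * x)" "(norm (g x))\<^sup>2"]
        by (simp add: mult.assoc split: split_indicator)
      then show "AE x in lborel. norm (indicator {a..b} x *\<^sub>R (norm (g x))\<^sup>2)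
          \<le> norm (exp (- (c * a)) * (exp (c * x) * (norm (g x))\<^sup>2))"
        by (auto simp: abs_mult)
    qed measurable
    then show ?thesis by (auto simp: L2_loc_def)
  qed
  have H: "(\<lambda>x. k + tail g x) \<in> H1_loc" for k
  proof -
    have C: "continuous_on UNIV (\<lambda>x. k + tail g x)"
      by (intro continuous_intros continuous_tail[OF c g])
    then have "(\<lambda>x. k + tail g x) \<in> L2_loc"
      unfolding L2_loc_def
      by (auto intro!: borel_integrable_atLeastAtMost' continuous_intros borel_measurable_continuous_onI
          intro: continuous_on_subset[OF continuous_tail[OF c g]])
    then show ?thesis using \<open>g \<in> L2_loc\<close> has_weak_deriv_tail[OF c g] by (auto simp: H1_loc_def)
  qed
  have wd: "has_weak_deriv (tail g) g" using has_weak_deriv_tail[OF c g, of 0] by simp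
  have m[measurable]: "weak_deriv (tail g) \<in> borel_measurable borel"
    using has_weak_deriv_weak_deriv[OF wd] by (auto simp: has_weak_deriv_def intro: L1_loc_measurable)
  have "integrable lborel (\<lambda>x. exp (c * x) * (norm (weak_deriv (tail g) x))\<^sup>2)"
    using wL2_integrable[OF g] weak_deriv_AE_eq[OF wd]
    by (subst integrable_cong_AE[where g="\<lambda>x. exp (c * x) * (norm (g x))\<^sup>2"]) (auto elim: AE_mp)
  then have "weak_deriv (tail g) \<in> wL2 c" using m by (simp add: wL2_def)
  then show ?thesis
    using H[of e] H[of 0] hardy(1)[OF c g] by (simp add: H1ce_def H1c_def wL2_iff_L2)
qed

text \<open>The difference between \<open>w - e\<close> and the primitive of its weak derivative is a constant, and the only
  constant in the weighted space is \<open>0\<close>.\<close>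

lemma H1ce_tailE:
  fixes w :: "real \<Rightarrow> real^'d"
  assumes c: "0 < c" and w: "w \<in> H1ce c e"
  obtains g where "g \<in> wL2 c" "AE x in lborel. w x = e + tail g x" "AE x in lborel. weak_deriv w x = g x"
proof -
  define v where "v x = w x - e" for x
  define g where "g = weak_deriv v"
  have v: "v \<in> H1c c" using w by (simp add: H1ce_def v_def[abs_def])
  then obtain g0 where "has_weak_deriv v g0" by (auto simp: H1c_def H1_loc_def)
  then have vg: "has_weak_deriv v g" unfolding g_def by (rule has_weak_deriv_weak_deriv)
  have gL: "g \<in> wL2 c" and vL: "v \<in> wL2 c"
    using v by (simp_all add: H1c_def wL2_iff_L2 g_def)
  have "has_weak_deriv (\<lambda>x. v x - (0 + tail g x)) (\<lambda>x. g x - g x)"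
    by (intro has_weak_deriv_diff vg has_weak_deriv_tail[OF c gL])
  then obtain K where K: "AE x in lborel. v x - tail g x = K"
    using const_if_orthogonal_to_derivatives[of "\<lambda>x. v x - tail g x"] by (auto simp: has_weak_deriv_def)
  have "K = 0"
  proof (rule ccontr)
    assume "K \<noteq> 0"
    have d: "(\<lambda>x. v x - tail g x) \<in> wL2 c" by (intro wL2_diff vL hardy[OF c gL])
    note [measurable] = wL2_measurable[OF d]
    have "integrable lborel (\<lambda>x. exp (c * x) * (norm K)\<^sup>2)"
      using wL2_integrable[OF d] K
      by (subst integrable_cong_AE[where g="\<lambda>x. exp (c * x) * (norm (v x - tail g x))\<^sup>2"]) (auto elim: AE_mp)
    then have expi: "integrable lborel (\<lambda>x. exp (c * x))" using \<open>K \<noteq> 0\<close> by simp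
    have "real n \<le> (LINT x|lborel. exp (c * x))" for n :: nat
    proof -
      have "(LINT x|lborel. indicator {0..real n} x) \<le> (LINT x|lborel. exp (c * x))"
        by (rule integral_mono) (use expi c in \<open>auto split: split_indicator\<close>)
      then show ?thesis by simp
    qed
    then show False by (meson not_less reals_Archimedean2)
  qed
  have "has_weak_deriv w g"
  proof -
    have "has_weak_deriv (\<lambda>x. v x - (- e)) (\<lambda>x. g x - 0)"
      by (intro has_weak_deriv_diff vg has_weak_deriv_const)
    then show ?thesis by (simp add: v_def)
  qed
  show thesis
  proof (rule that[OF gL])
    show "AE x in lborel. w x = e + tail g x"
      using K \<open>K = 0\<close> by (auto simp: v_def algebra_simps)
    show "AE x in lborel. weak_deriv w x = g x"
      by (rule weak_deriv_AE_eq) fact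
  qed
qed

section \<open>Energy, scaling and the threshold speed\<close>

definition neg_energy_at :: "(real^'d \<Rightarrow> real) \<Rightarrow> real^'d \<Rightarrow> real \<Rightarrow> bool" where
  "neg_energy_at V e c \<longleftrightarrow> (\<exists>g\<in>wL2 c. integrable lborel (\<lambda>x. exp (c * x) * V (e + tail g x)) \<and>
     wnorm2 c g / 2 + (LINT x|lborel. exp (c * x) * V (e + tail g x)) < 0)"

lemma tail_affine:
  assumes "0 < l"
  shows "tail (\<lambda>x. l *\<^sub>R g (t + l * x)) x = tail g (t + l * x)"
proof -
  have "(LINT y|lborel. indicator {t + l * x..} y *\<^sub>R g y)
      = \<bar>l\<bar> *\<^sub>R (LINT s|lborel. indicator {t + l * x..} (t + l * s) *\<^sub>R g (t + l * s))"
    using assms by (intro lborel_integral_real_affine) simp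
  also have "\<dots> = (LINT s|lborel. l *\<^sub>R (indicator {t + l * x..} (t + l * s) *\<^sub>R g (t + l * s)))"
    using assms by (simp del: scaleR_scaleR)
  also have "\<dots> = (LINT s|lborel. indicator {x..} s *\<^sub>R (l *\<^sub>R g (t + l * s)))"
    using assms by (intro Bochner_Integration.integral_cong) (auto split: split_indicator)
  finally have H: "(LINT y|lborel. indicator {t + l * x..} y *\<^sub>R g y)
      = (LINT s|lborel. indicator {x..} s *\<^sub>R (l *\<^sub>R g (t + l * s)))" .
  show ?thesis unfolding tail_def set_lebesgue_integral_def by (simp only: H)
qed

lemma integral_exp_affine:
  fixes f :: "real \<Rightarrow> real"
  assumes "0 < l"
  shows "(LINT x|lborel. exp (l * c * x) * f (t + l * x)) = exp (- (c * t)) / l * (LINT y|lborel. exp (c * y) * f y)"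
    and "integrable lborel (\<lambda>x. exp (l * c * x) * f (t + l * x)) \<longleftrightarrow> integrable lborel (\<lambda>y. exp (c * y) * f y)"
proof -
  have eq: "exp (c * (t + l * x)) * f (t + l * x) = exp (c * t) * (exp (l * c * x) * f (t + l * x))" for x
    by (simp add: exp_add[symmetric] algebra_simps mult_exp_exp)
  have "(LINT y|lborel. exp (c * y) * f y) = \<bar>l\<bar> *\<^sub>R (LINT x|lborel. exp (c * (t + l * x)) * f (t + l * x))"
    using assms by (intro lborel_integral_real_affine) simp
  then show "(LINT x|lborel. exp (l * c * x) * f (t + l * x)) = exp (- (c * t)) / l * (LINT y|lborel. exp (c * y) * f y)"
    using assms unfolding eq by (simp add: exp_minus field_simps)
  have "integrable lborel (\<lambda>x. exp (c * (t + l * x)) * f (t + l * x)) \<longleftrightarrow> integrable lborel (\<lambda>y. exp (c * y) * f y)"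
    using assms by (intro lborel_integrable_real_affine_iff) simp
  then show "integrable lborel (\<lambda>x. exp (l * c * x) * f (t + l * x)) \<longleftrightarrow> integrable lborel (\<lambda>y. exp (c * y) * f y)"
    unfolding eq by simp
qed

lemma wL2_affine:
  fixes g :: "real \<Rightarrow> 'a::euclidean_space"
  assumes "0 < l" "g \<in> wL2 c"
  shows "(\<lambda>x. l *\<^sub>R g (t + l * x)) \<in> wL2 (l * c)"
    and "wnorm2 (l * c) (\<lambda>x. l *\<^sub>R g (t + l * x)) = l * exp (- (c * t)) * wnorm2 c g"
proof -
  note [measurable] = wL2_measurable[OF assms(2)]
  have eq: "exp (l * c * x) * (norm (l *\<^sub>R g (t + l * x)))\<^sup>2 = l\<^sup>2 * (exp (l * c * x) * (norm (g (t + l * x)))\<^sup>2)" for x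
    by (simp add: power_mult_distrib)
  show "(\<lambda>x. l *\<^sub>R g (t + l * x)) \<in> wL2 (l * c)"
    using integral_exp_affine(2)[OF assms(1), of c "\<lambda>y. (norm (g y))\<^sup>2" t] assms
    unfolding wL2_def mem_Collect_eq eq by auto
  show "wnorm2 (l * c) (\<lambda>x. l *\<^sub>R g (t + l * x)) = l * exp (- (c * t)) * wnorm2 c g"
    using integral_exp_affine(1)[OF assms(1), of c "\<lambda>y. (norm (g y))\<^sup>2" t] assms(1)
    unfolding wnorm2_def eq by (simp add: power2_eq_square)
qed

text \<open>A dilation by \<open>l\<close> changes the speed from \<open>c\<close> to \<open>l * c\<close> and, apart from a positive factor, affects only
  the kinetic term. The factor \<open>exp (- (c * t))\<close> is the effect of the translation.\<close>

lemma energy_affine: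
  fixes V :: "real^'d \<Rightarrow> real" and t :: real
  assumes l: "0 < l" and g: "g \<in> wL2 c" and i: "integrable lborel (\<lambda>x. exp (c * x) * V (e + tail g x))"
  defines "h \<equiv> (\<lambda>x. l *\<^sub>R g (t + l * x))"
  shows "integrable lborel (\<lambda>x. exp (l * c * x) * V (e + tail h x))"
    and "wnorm2 (l * c) h / 2 + (LINT x|lborel. exp (l * c * x) * V (e + tail h x))
      = exp (- (c * t)) / l * (l\<^sup>2 * wnorm2 c g / 2 + (LINT x|lborel. exp (c * x) * V (e + tail g x)))"
proof -
  note A = integral_exp_affine[OF l, of c "\<lambda>y. V (e + tail g y)" t]
  show "integrable lborel (\<lambda>x. exp (l * c * x) * V (e + tail h x))"
    unfolding h_def tail_affine[OF l] using A(2) i by simp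
  show "wnorm2 (l * c) h / 2 + (LINT x|lborel. exp (l * c * x) * V (e + tail h x))
      = exp (- (c * t)) / l * (l\<^sup>2 * wnorm2 c g / 2 + (LINT x|lborel. exp (c * x) * V (e + tail g x)))"
    unfolding h_def tail_affine[OF l] A(1) wL2_affine(2)[OF l g]
    using l by (simp add: field_simps power2_eq_square)
qed

lemma exp_left_half_line:
  fixes c :: real
  assumes "0 < c"
  shows "integrable lborel (\<lambda>x. indicator {..0} x * exp (c * x))"
    and "(LINT x|lborel. indicator {..0} x * exp (c * x)) = 1 / c"
proof -
  define f where "f x = indicator {0..} x * exp (- (c * x))" for x :: real
  have f: "f (0 + (-1) * x) = indicator {..0} x * exp (c * x)" for x
    by (auto simp: f_def split: split_indicator)
  have "integrable lborel f" "(LINT x|lborel. f x) = 1 / c"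
    using exp_half_line[OF assms, of 0] by (simp_all add: f_def[abs_def] set_integrable_def set_lebesgue_integral_def)
  moreover have "(LINT x|lborel. f x) = \<bar>-1\<bar> *\<^sub>R (LINT x|lborel. f (0 + (-1) * x))"
    by (rule lborel_integral_real_affine) simp
  moreover have "integrable lborel (\<lambda>x. f (0 + (-1) * x)) \<longleftrightarrow> integrable lborel f"
    by (rule lborel_integrable_real_affine_iff) simp
  ultimately show "integrable lborel (\<lambda>x. indicator {..0} x * exp (c * x))"
    "(LINT x|lborel. indicator {..0} x * exp (c * x)) = 1 / c"
    unfolding f by simp_all
qed

text \<open>What the variational argument uses of the potential; \<open>m\<close> is a global minimum point. The quadratic lower bound makes the negative part
  of every energy finite.\<close>

locale potential =
  fixes V :: "real^'d \<Rightarrow> real" and e m :: "real^'d"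
  assumes continuous: "continuous_on UNIV V"
    and zero: "V e = 0"
    and minimal: "\<And>u. V m \<le> V u"
    and negative: "V m < 0"
    and quadratic_bound: "\<exists>\<mu>. \<forall>u. \<mu> * (norm (u - e))\<^sup>2 / 2 \<le> V u"
begin

lemma measurable_potential[measurable]: "V \<in> borel_measurable borel"
  using continuous by (rule borel_measurable_continuous_onI)

text \<open>By the quadratic lower bound and Hardy's inequality the negative part of the density is integrable. Hence the
  energy is either \<open>\<infinity>\<close> or an ordinary Lebesgue integral, according to the integrability of the potential term.\<close>

lemma energy_tail:
  assumes c: "0 < c" and g: "g \<in> wL2 c"
    and w: "AE x in lborel. w x = e + tail g x" "AE x in lborel. weak_deriv w x = g x"
  shows "energy V c w = (if integrable lborel (\<lambda>x. exp (c * x) * V (e + tail g x))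
     then ereal (wnorm2 c g / 2 + (LINT x|lborel. exp (c * x) * V (e + tail g x))) else \<infinity>)"
proof -
  note [measurable] = wL2_measurable[OF g] measurable_tail[OF c g]
  define k where "k x = exp (c * x) * (norm (g x))\<^sup>2 / 2" for x
  define p where "p x = exp (c * x) * V (e + tail g x)" for x
  define d where "d x = k x + p x" for x
  have [measurable]: "k \<in> borel_measurable borel" "p \<in> borel_measurable borel" "d \<in> borel_measurable borel"
    unfolding k_def[abs_def] p_def[abs_def] d_def[abs_def] by measurable
  have ki: "integrable lborel k" and kI: "(LINT x|lborel. k x) = wnorm2 c g / 2"
    using wL2_integrable[OF g] by (simp_all add: k_def[abs_def] wnorm2_def)
  have ae: "AE x in lborel. energy_density V c w x = d x"
    using w by eventually_elim (simp add: energy_density_def d_def k_def p_def algebra_simps)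
  have E: "energy V c w = enn2ereal (\<integral>\<^sup>+ x. ennreal (d x) \<partial>lborel) - enn2ereal (\<integral>\<^sup>+ x. ennreal (- d x) \<partial>lborel)"
    unfolding energy_def
    by (intro arg_cong2[where f=minus] arg_cong[where f=enn2ereal] nn_integral_cong_AE)
       (use ae in \<open>auto elim: eventually_mono\<close>)
  obtain \<mu> where \<mu>: "\<And>u. \<mu> * (norm (u - e))\<^sup>2 / 2 \<le> V u" using quadratic_bound by blast
  have low: "- d x \<le> \<bar>\<mu>\<bar> * (exp (c * x) * (norm (tail g x))\<^sup>2)" for x
  proof -
    have "- V (e + tail g x) \<le> - (\<mu> * (norm (tail g x))\<^sup>2 / 2)" using \<mu>[of "e + tail g x"] by simp
    also have "\<dots> \<le> \<bar>\<mu>\<bar> * (norm (tail g x))\<^sup>2"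
      by (smt (verit) field_sum_of_halves mult_minus_left mult_right_mono zero_le_power2)
    finally have "exp (c * x) * - V (e + tail g x) \<le> exp (c * x) * (\<bar>\<mu>\<bar> * (norm (tail g x))\<^sup>2)"
      by (intro mult_left_mono) auto
    moreover have "0 \<le> k x" by (simp add: k_def)
    ultimately show ?thesis by (simp add: d_def p_def algebra_simps)
  qed
  have "(\<integral>\<^sup>+ x. ennreal (- d x) \<partial>lborel) \<le> (\<integral>\<^sup>+ x. ennreal (\<bar>\<mu>\<bar> * (exp (c * x) * (norm (tail g x))\<^sup>2)) \<partial>lborel)"
    by (intro nn_integral_mono ennreal_leI low)
  also have "\<dots> = ennreal \<bar>\<mu>\<bar> * ennreal (wnorm2 c (tail g))"
    unfolding nn_integral_wnorm2[OF hardy(1)[OF c g], symmetric]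
    by (subst nn_integral_cmult[symmetric]) (auto simp: ennreal_mult)
  also have "\<dots> < \<infinity>" by (simp add: ennreal_mult_less_top)
  finally have nfin: "(\<integral>\<^sup>+ x. ennreal (- d x) \<partial>lborel) < \<infinity>" .
  have dp: "integrable lborel d \<longleftrightarrow> integrable lborel p"
  proof
    assume "integrable lborel d"
    then have "integrable lborel (\<lambda>x. d x - k x)" using ki by simp
    then show "integrable lborel p" by (simp add: d_def)
  next
    assume "integrable lborel p"
    then show "integrable lborel d" unfolding d_def using ki by simp
  qed
  show ?thesis
  proof (cases "integrable lborel p")
    case True
    then have di: "integrable lborel d" by (simp add: dp)
    have pfin: "(\<integral>\<^sup>+ x. ennreal (d x) \<partial>lborel) < \<infinity>"
      using di by (simp add: real_integrable_def less_top)
    have "(LINT x|lborel. d x) = enn2real (\<integral>\<^sup>+ x. ennreal (d x) \<partial>lborel) - enn2real (\<integral>\<^sup>+ x. ennreal (- d x) \<partial>lborel)"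
      by (rule real_lebesgue_integral_def[OF di])
    then have "energy V c w = ereal (LINT x|lborel. d x)"
      using pfin nfin unfolding E
      by (cases "\<integral>\<^sup>+ x. ennreal (d x) \<partial>lborel"; cases "\<integral>\<^sup>+ x. ennreal (- d x) \<partial>lborel") auto
    also have "(LINT x|lborel. d x) = wnorm2 c g / 2 + (LINT x|lborel. p x)"
      unfolding d_def using ki True by (simp add: kI)
    finally show ?thesis using True by (simp add: p_def[abs_def])
  next
    case False
    then have "\<not> integrable lborel d" by (simp add: dp)
    then have "(\<integral>\<^sup>+ x. ennreal (d x) \<partial>lborel) = \<infinity>"
      using nfin by (auto simp: real_integrable_def top_unique not_less)
    then have "energy V c w = \<infinity>"
      using nfin unfolding E by (cases "\<integral>\<^sup>+ x. ennreal (- d x) \<partial>lborel") auto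
    then show ?thesis using False by (simp add: p_def[abs_def])
  qed
qed

lemma energy_of_tail:
  assumes c: "0 < c" and g: "g \<in> wL2 c"
  shows "energy V c (\<lambda>x. e + tail g x) = (if integrable lborel (\<lambda>x. exp (c * x) * V (e + tail g x))
     then ereal (wnorm2 c g / 2 + (LINT x|lborel. exp (c * x) * V (e + tail g x))) else \<infinity>)"
  by (rule energy_tail[OF c g _ weak_deriv_AE_eq[OF has_weak_deriv_tail[OF c g]]]) simp

lemma tail_zero: "tail (\<lambda>x. 0) x = 0"
  by (simp add: tail_def)

lemma rest_energy:
  assumes "0 < c" shows "(\<lambda>x. e) \<in> H1ce c e" "energy V c (\<lambda>x. e) = 0"
  using tail_in_H1ce[OF assms wL2_zero(1), of e] energy_of_tail[OF assms wL2_zero(1)]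
  by (simp_all add: tail_zero zero wL2_zero(2) zero_ereal_def)

lemma energy_nonneg:
  assumes c: "0 < c" and n: "\<not> neg_energy_at V e c" and w: "w \<in> H1ce c e"
  shows "0 \<le> energy V c w"
proof -
  obtain g where g: "g \<in> wL2 c" "AE x in lborel. w x = e + tail g x" "AE x in lborel. weak_deriv w x = g x"
    using H1ce_tailE[OF c w] .
  show ?thesis
    using n g(1) unfolding energy_tail[OF c g] neg_energy_at_def
    by (auto simp: not_less zero_ereal_def[symmetric])
qed

lemma INF_energy_zero:
  assumes c: "0 < c" and n: "\<not> neg_energy_at V e c"
  shows "(INF w\<in>H1ce c e. energy V c w) = 0"
proof (rule antisym)
  show "(INF w\<in>H1ce c e. energy V c w) \<le> 0"
    using INF_lower[OF rest_energy(1)[OF c], of "energy V c"] rest_energy(2)[OF c] by simp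
  show "0 \<le> (INF w\<in>H1ce c e. energy V c w)"
    by (intro INF_greatest energy_nonneg[OF c n])
qed

text \<open>Translating a profile of negative energy to the right makes its energy tend to \<open>-\<infinity>\<close>.\<close>

lemma INF_energy_minus_inf:
  assumes c: "0 < c" and n: "neg_energy_at V e c"
  shows "(INF w\<in>H1ce c e. energy V c w) = -\<infinity>"
proof -
  obtain g where g: "g \<in> wL2 c" and i: "integrable lborel (\<lambda>x. exp (c * x) * V (e + tail g x))"
    and neg: "wnorm2 c g / 2 + (LINT x|lborel. exp (c * x) * V (e + tail g x)) < 0" (is "?E < 0")
    using n by (auto simp: neg_energy_at_def)
  have "(INF w\<in>H1ce c e. energy V c w) \<le> ereal r" for r
  proof -
    define t where "t = - ln (max 1 (r / ?E)) / c"
    have ct: "exp (- (c * t)) = max 1 (r / ?E)"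
      using c by (simp add: t_def)
    define h where "h = (\<lambda>x. 1 *\<^sub>R g (t + 1 * x))"
    have h: "h \<in> wL2 c" using wL2_affine(1)[of 1 g c t] g by (simp add: h_def)
    have "energy V c (\<lambda>x. e + tail h x) = ereal (exp (- (c * t)) * ?E)"
      using energy_affine[OF zero_less_one g i, of t] unfolding energy_of_tail[OF c h]
      by (simp add: h_def)
    moreover have "exp (- (c * t)) * ?E \<le> r"
      unfolding ct using neg
      by (smt (verit) divide_minus_left minus_divide_right mult_minus_right nonzero_divide_eq_eq pos_less_divide_eq)
    ultimately have "energy V c (\<lambda>x. e + tail h x) \<le> ereal r" by simp
    then show ?thesis using INF_lower2[OF tail_in_H1ce[OF c h]] by blast
  qed
  then show ?thesis by (simp add: ereal_bot)
qed

lemma C_minus_inf_iff: "c \<in> C_minus_inf V e \<longleftrightarrow> 0 < c \<and> neg_energy_at V e c"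
  using INF_energy_zero[of c] INF_energy_minus_inf[of c]
  by (cases "neg_energy_at V e c") (auto simp: C_minus_inf_def)

lemma C_zero_iff: "c \<in> C_zero V e \<longleftrightarrow> 0 < c \<and> \<not> neg_energy_at V e c"
  using INF_energy_zero[of c] INF_energy_minus_inf[of c]
  by (cases "neg_energy_at V e c") (auto simp: C_zero_def)

lemma neg_energy_at_scale:
  assumes "0 < l" "g \<in> wL2 c" "integrable lborel (\<lambda>x. exp (c * x) * V (e + tail g x))"
    and "l\<^sup>2 * wnorm2 c g / 2 + (LINT x|lborel. exp (c * x) * V (e + tail g x)) < 0"
  shows "neg_energy_at V e (l * c)"
  unfolding neg_energy_at_def
  using energy_affine[OF assms(1-3), of 0] wL2_affine(1)[OF assms(1,2), of 0] assms(1,4)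
  by (intro bexI[of _ "\<lambda>x. l *\<^sub>R g (0 + l * x)"]) (auto simp: divide_neg_pos)

lemma neg_energy_at_mono:
  assumes "neg_energy_at V e c" "0 < c'" "c' \<le> c"
  shows "neg_energy_at V e c'"
proof -
  obtain g where g: "g \<in> wL2 c" and i: "integrable lborel (\<lambda>x. exp (c * x) * V (e + tail g x))"
    and neg: "wnorm2 c g / 2 + (LINT x|lborel. exp (c * x) * V (e + tail g x)) < 0"
    using assms(1) by (auto simp: neg_energy_at_def)
  define l where "l = c' / c"
  have l: "0 < l" "l \<le> 1" "l * c = c'" using assms by (auto simp: l_def)
  have "l\<^sup>2 * wnorm2 c g \<le> 1 * wnorm2 c g"
    using l by (intro mult_right_mono wnorm2_nonneg) (auto simp: power_le_one)
  then show ?thesis using neg_energy_at_scale[OF l(1) g i] neg l(3) by simp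
qed

lemma neg_energy_at_open:
  assumes "neg_energy_at V e c" "0 < c"
  shows "\<exists>c'>c. neg_energy_at V e c'"
proof -
  obtain g where g: "g \<in> wL2 c" and i: "integrable lborel (\<lambda>x. exp (c * x) * V (e + tail g x))"
    and neg: "wnorm2 c g / 2 + (LINT x|lborel. exp (c * x) * V (e + tail g x)) < 0"
    using assms(1) by (auto simp: neg_energy_at_def)
  have "((\<lambda>l. l\<^sup>2 * wnorm2 c g / 2 + (LINT x|lborel. exp (c * x) * V (e + tail g x))) \<longlongrightarrow>
      1\<^sup>2 * wnorm2 c g / 2 + (LINT x|lborel. exp (c * x) * V (e + tail g x))) (at_right 1)"
    by (intro tendsto_intros) simp
  then have "\<forall>\<^sub>F l in at_right 1. l\<^sup>2 * wnorm2 c g / 2 + (LINT x|lborel. exp (c * x) * V (e + tail g x)) < 0"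
    using neg by (intro order_tendstoD(2)) auto
  then obtain l where "l > 1" "l\<^sup>2 * wnorm2 c g / 2 + (LINT x|lborel. exp (c * x) * V (e + tail g x)) < 0"
    unfolding eventually_at_right_field by (metis dense)
  then show ?thesis using neg_energy_at_scale[OF _ g i, of l] assms(2) by (intro exI[of _ "l * c"]) auto
qed

lemma energy_ge_quadratic:
  assumes c: "0 < c" and g: "g \<in> wL2 c" and i: "integrable lborel (\<lambda>x. exp (c * x) * V (e + tail g x))"
    and \<mu>: "\<And>u. \<mu> * (norm (u - e))\<^sup>2 / 2 \<le> V u"
  shows "\<mu> / 2 * wnorm2 c (tail g) \<le> (LINT x|lborel. exp (c * x) * V (e + tail g x))"
proof -
  have "\<mu> / 2 * wnorm2 c (tail g) = (LINT x|lborel. \<mu> / 2 * (exp (c * x) * (norm (tail g x))\<^sup>2))"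
    by (simp add: wnorm2_def)
  also have "\<dots> \<le> (LINT x|lborel. exp (c * x) * V (e + tail g x))"
  proof (rule integral_mono[OF _ i])
    show "integrable lborel (\<lambda>x. \<mu> / 2 * (exp (c * x) * (norm (tail g x))\<^sup>2))"
      using wL2_integrable[OF hardy(1)[OF c g]] by simp
    show "\<mu> / 2 * (exp (c * x) * (norm (tail g x))\<^sup>2) \<le> exp (c * x) * V (e + tail g x)" for x
      using mult_left_mono[OF \<mu>[of "e + tail g x"], of "exp (c * x)"] by (simp add: algebra_simps)
  qed
  finally show ?thesis .
qed

text \<open>If \<open>V u \<ge> \<mu> |u - e|\<^sup>2 / 2\<close> and \<open>c\<^sup>2 / 4 + \<mu> \<ge> 0\<close>, then Hardy's inequality makes every energy nonnegative.\<close>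

lemma neg_energy_at_bound:
  assumes c: "0 < c" and n: "neg_energy_at V e c" and \<mu>: "\<And>u. \<mu> * (norm (u - e))\<^sup>2 / 2 \<le> V u"
  shows "c < 2 * sqrt (- \<mu>)"
proof -
  obtain g where g: "g \<in> wL2 c" and i: "integrable lborel (\<lambda>x. exp (c * x) * V (e + tail g x))"
    and neg: "wnorm2 c g / 2 + (LINT x|lborel. exp (c * x) * V (e + tail g x)) < 0"
    using n by (auto simp: neg_energy_at_def)
  have neg': "wnorm2 c g + \<mu> * wnorm2 c (tail g) < 0"
    using energy_ge_quadratic[OF c g i \<mu>] neg by simp
  have "c\<^sup>2 / 4 * wnorm2 c (tail g) \<le> wnorm2 c g"
    using hardy(2)[OF c g] c by (simp add: field_simps)
  with neg' have "(c\<^sup>2 / 4 + \<mu>) * wnorm2 c (tail g) < 0" by (simp add: algebra_simps)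
  then have "c\<^sup>2 / 4 + \<mu> < 0" by (simp add: mult_less_0_iff not_less[symmetric] wnorm2_nonneg)
       (smt (verit) wnorm2_nonneg)
  then have "(c / 2)\<^sup>2 < - \<mu>" by (simp add: power_divide)
  then have "c / 2 < sqrt (- \<mu>)" by (rule real_less_rsqrt)
  then show ?thesis by simp
qed

text \<open>The trial profile is \<open>m\<close> on the negative half-line, \<open>e\<close> beyond \<open>1\<close>, and affine in between. The half-line contributes
  \<open>V m / c\<close>, which for small \<open>c\<close> outweighs the bounded contribution of \<open>{0..1}\<close>.\<close>

lemma ex_neg_energy_at: "\<exists>c>0. neg_energy_at V e c"
proof -
  define g :: "real \<Rightarrow> real^'d" where "g x = indicator {0..1} x *\<^sub>R (e - m)" for x
  have tl: "tail g x = - (measure lborel ({x..} \<inter> {0..1}) *\<^sub>R (e - m))" for x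
  proof -
    have "(LINT t:{x..}|lborel. g t) = (LINT t|lborel. indicator ({x..} \<inter> {0..1}) t *\<^sub>R (e - m))"
      unfolding set_lebesgue_integral_def g_def
      by (intro Bochner_Integration.integral_cong) (auto split: split_indicator)
    also have "\<dots> = measure lborel ({x..} \<inter> {0..1}) *\<^sub>R (e - m)"
    proof -
      have "{x..} \<inter> {0..1} = {max x 0..1}" by auto
      then show ?thesis by simp
    qed
    finally show ?thesis by (simp add: tail_def)
  qed
  have t0: "e + tail g x = m" if "x \<le> 0" for x
  proof -
    have "{x..} \<inter> {0..1} = {0..1}" using that by auto
    then show ?thesis by (simp add: tl)
  qed
  have t1: "e + tail g x = e" if "x > 1" for x
  proof -
    have "{x..} \<inter> {0..1} = {}" using that by auto
    then show ?thesis by (simp add: tl)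
  qed
  have tn: "norm (tail g x) \<le> norm (e - m)" for x
  proof -
    have "{x..} \<inter> {0..1} = {max x 0..1}" by auto
    then have "measure lborel ({x..} \<inter> {0..1}) \<le> 1" by (simp add: measure_def)
       (auto simp: emeasure_lborel_Icc_eq max_def)
    then show ?thesis unfolding tl by (simp add: mult_left_le_one_le)
  qed
  have "compact (V ` cball e (norm (e - m)))"
    by (intro compact_continuous_image continuous_on_subset[OF continuous]) auto
  then obtain B0 where B0: "\<And>u. u \<in> cball e (norm (e - m)) \<Longrightarrow> V u \<le> B0"
    by (meson bounded_imp_bdd_above bdd_above.E compact_imp_bounded image_eqI)
  define B where "B = max 0 B0"
  have B: "V (e + tail g x) \<le> B" for x
    using B0[of "e + tail g x"] tn[of x] by (simp add: dist_norm B_def)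
  \<comment> \<open>the contribution of {0..1} is at most exp 1 * (|e - m|^2 / 2 + B) when c is at most 1\<close>
  define c where "c = min 1 (- V m / (2 * exp 1 * ((norm (e - m))\<^sup>2 / 2 + B) + 1))"
  have D: "0 \<le> exp (1::real) * ((norm (e - m))\<^sup>2 / 2 + B)" by (simp add: B_def)
  have "0 < - V m / (2 * exp 1 * ((norm (e - m))\<^sup>2 / 2 + B) + 1)"
    using negative D by (intro divide_pos_pos) (simp_all add: mult.assoc)
  then have c: "0 < c" "c \<le> 1" by (simp_all add: c_def)
  have small: "exp 1 * ((norm (e - m))\<^sup>2 / 2 + B) + V m / c < 0"
  proof -
    have "c \<le> - V m / (2 * exp 1 * ((norm (e - m))\<^sup>2 / 2 + B) + 1)" by (simp add: c_def)
    moreover have "0 < 2 * exp 1 * ((norm (e - m))\<^sup>2 / 2 + B) + 1" using D by (simp add: mult.assoc)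
    ultimately have "c * (2 * (exp 1 * ((norm (e - m))\<^sup>2 / 2 + B)) + 1) \<le> - V m"
      by (simp only: pos_le_divide_eq mult.assoc)
    moreover have "0 \<le> c * (exp 1 * ((norm (e - m))\<^sup>2 / 2 + B))" using c D by simp
    ultimately have "c * (exp 1 * ((norm (e - m))\<^sup>2 / 2 + B)) + V m < 0" using c(1) by (simp add: algebra_simps)
    then show ?thesis using c by (simp add: field_simps)
  qed
  have i01: "integrable lborel (\<lambda>x::real. indicator {0..1} x * K)" for K :: real
    by (intro integrable_mult_left integrable_real_indicator) auto
  have exp1: "exp (c * x) \<le> exp 1" if "x \<in> {0..1}" for x
    using that c mult_mono[of c 1 x 1] by auto
  have gb: "exp (c * x) * (norm (g x))\<^sup>2 \<le> indicator {0..1} x * (exp 1 * (norm (e - m))\<^sup>2)" for x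
    using exp1[of x] by (auto simp: g_def split: split_indicator intro!: mult_right_mono)
  have [measurable]: "g \<in> borel_measurable borel" unfolding g_def[abs_def] by measurable
  have gi: "integrable lborel (\<lambda>x. exp (c * x) * (norm (g x))\<^sup>2)"
  proof (rule Bochner_Integration.integrable_bound[OF i01[of "exp 1 * (norm (e - m))\<^sup>2"]])
    show "AE x in lborel. norm (exp (c * x) * (norm (g x))\<^sup>2) \<le> norm (indicator {0..1} x * (exp 1 * (norm (e - m))\<^sup>2))"
      using gb by auto
  qed measurable
  have g: "g \<in> wL2 c" using gi by (simp add: wL2_def)
  have "wnorm2 c g \<le> (LINT x|lborel. indicator {0..1::real} x * (exp 1 * (norm (e - m))\<^sup>2))"
    unfolding wnorm2_def by (intro integral_mono gi i01 gb)
  then have N: "wnorm2 c g \<le> exp 1 * (norm (e - m))\<^sup>2" by simp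
  note [measurable] = measurable_tail[OF c(1) g]
  define p where "p x = exp (c * x) * V (e + tail g x)" for x
  define b where "b x = indicator {..0} x * exp (c * x) * V m + indicator {0..1} x * (exp 1 * B)" for x
  have bi: "integrable lborel b" and bI: "(LINT x|lborel. b x) = V m / c + exp 1 * B"
    using exp_left_half_line[OF c(1)] i01[of "exp 1 * B"] by (simp_all add: b_def[abs_def])
  have pb: "p x \<le> b x" if nz: "x \<noteq> 0" for x
  proof -
    consider "x < 0" | "x \<in> {0<..1}" | "x > 1" using nz by force
    then show ?thesis
    proof cases
      case 2
      have "exp (c * x) * V (e + tail g x) \<le> exp (c * x) * B" by (intro mult_left_mono B) auto
      also have "\<dots> \<le> exp 1 * B" using exp1[of x] 2 by (intro mult_right_mono) (auto simp: B_def)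
      finally show ?thesis using 2 by (simp add: p_def b_def)
    qed (auto simp: p_def b_def t0 t1 zero)
  qed
  have pl: "indicator {..0} x * exp (c * x) * V m + indicator {0..1} x * (exp 1 * V m) \<le> p x" for x
  proof -
    consider "x \<le> 0" | "x \<in> {0<..1}" | "x > 1" by (metis greaterThanAtMost_iff not_less)
    then show ?thesis
    proof cases
      case 1 then show ?thesis using negative by (auto simp: p_def t0 indicator_def mult_le_0_iff)
    next
      case 2
      have "exp 1 * V m \<le> exp (c * x) * V m" using exp1[of x] 2 negative by (intro mult_right_mono_neg) auto
      also have "\<dots> \<le> exp (c * x) * V (e + tail g x)" by (intro mult_left_mono minimal) auto
      finally show ?thesis using 2 by (simp add: p_def)
    qed (auto simp: p_def t1 zero)
  qed
  have pi: "integrable lborel p"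
  proof (rule Bochner_Integration.integrable_bound)
    show "integrable lborel (\<lambda>x. \<bar>b x\<bar> + \<bar>indicator {..0} x * exp (c * x) * V m + indicator {0..1} x * (exp 1 * V m)\<bar>)"
      using exp_left_half_line[OF c(1)] i01[of "exp 1 * V m"] bi by simp
    show "p \<in> borel_measurable lborel" unfolding p_def[abs_def] by measurable
    have "AE x in lborel. x \<noteq> (0::real)" by (rule AE_lborel_singleton)
    then show "AE x in lborel. norm (p x)
        \<le> norm (\<bar>b x\<bar> + \<bar>indicator {..0} x * exp (c * x) * V m + indicator {0..1} x * (exp 1 * V m)\<bar>)"
    proof eventually_elim
      case (elim x) show ?case using pb[OF elim] pl[of x] unfolding real_norm_def by linarith
    qed
  qed
  have "AE x in lborel. p x \<le> b x" using AE_lborel_singleton[of 0] pb by (auto elim: eventually_mono)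
  then have "(LINT x|lborel. p x) \<le> V m / c + exp 1 * B"
    unfolding bI[symmetric] by (intro integral_mono_AE pi bi)
  then have "wnorm2 c g / 2 + (LINT x|lborel. p x) < 0"
    using N small by (simp add: algebra_simps)
  then have "neg_energy_at V e c"
    using g pi unfolding neg_energy_at_def p_def[abs_def] by blast
  then show ?thesis using c by blast
qed

lemma threshold:
  shows "0 < c_nl V e" "C_minus_inf V e = {0<..<c_nl V e}" "C_zero V e = {c_nl V e..}"
    "\<And>c. 0 < c \<Longrightarrow> neg_energy_at V e c \<longleftrightarrow> c < c_nl V e"
proof -
  let ?S = "C_minus_inf V e"
  obtain \<mu> where \<mu>: "\<And>u. \<mu> * (norm (u - e))\<^sup>2 / 2 \<le> V u" using quadratic_bound by blast
  have bdd: "bdd_above ?S"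
    using neg_energy_at_bound[OF _ _ \<mu>] by (intro bdd_aboveI[of _ "2 * sqrt (- \<mu>)"]) (auto simp: C_minus_inf_iff less_imp_le)
  obtain c0 where c0: "0 < c0" "neg_energy_at V e c0" using ex_neg_energy_at by blast
  then have "c0 \<in> ?S" by (simp add: C_minus_inf_iff)
  then show pos: "0 < c_nl V e"
    unfolding c_nl_def using c0(1) cSup_upper[OF _ bdd] by (meson less_le_trans)
  show iff: "neg_energy_at V e c \<longleftrightarrow> c < c_nl V e" if c: "0 < c" for c
  proof
    assume "neg_energy_at V e c"
    then obtain c' where "c < c'" "neg_energy_at V e c'" using neg_energy_at_open c by blast
    then show "c < c_nl V e"
      unfolding c_nl_def using c cSup_upper[OF _ bdd, of c'] by (auto simp: C_minus_inf_iff)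
  next
    assume "c < c_nl V e"
    then obtain c' where "c' \<in> ?S" "c < c'"
      unfolding c_nl_def using less_cSup_iff[OF _ bdd, of c] \<open>c0 \<in> ?S\<close> by blast
    then show "neg_energy_at V e c"
      using neg_energy_at_mono[of c' c] c by (auto simp: C_minus_inf_iff)
  qed
  show "?S = {0<..<c_nl V e}" using iff by (auto simp: C_minus_inf_iff)
  show "C_zero V e = {c_nl V e..}"
    using iff pos by (auto simp: C_zero_iff not_less intro: less_le_trans)
qed

lemma nontrivial_minimizer_iff:
  assumes c: "0 < c"
  shows "has_nontrivial_minimizer V e c \<longleftrightarrow> \<not> neg_energy_at V e c \<and>
    (\<exists>g\<in>wL2 c. integrable lborel (\<lambda>x. exp (c * x) * V (e + tail g x)) \<and>
       wnorm2 c g / 2 + (LINT x|lborel. exp (c * x) * V (e + tail g x)) \<le> 0 \<and> (\<exists>x. tail g x \<noteq> 0))"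
    (is "?L \<longleftrightarrow> ?N \<and> ?R")
proof
  assume ?L
  then obtain w where w: "w \<in> H1ce c e" and min: "\<And>v. v \<in> H1ce c e \<Longrightarrow> energy V c w \<le> energy V c v"
    and nt: "\<not> (AE x in lborel. w x = e)"
    by (auto simp: has_nontrivial_minimizer_def is_global_minimizer_def)
  obtain g where g: "g \<in> wL2 c" "AE x in lborel. w x = e + tail g x" "AE x in lborel. weak_deriv w x = g x"
    using H1ce_tailE[OF c w] .
  have "energy V c w \<le> 0" using min[OF rest_energy(1)[OF c]] rest_energy(2)[OF c] by simp
  then have "integrable lborel (\<lambda>x. exp (c * x) * V (e + tail g x))"
    "wnorm2 c g / 2 + (LINT x|lborel. exp (c * x) * V (e + tail g x)) \<le> 0"
    unfolding energy_tail[OF c g] by (auto split: if_splits simp: zero_ereal_def)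
  moreover have "\<exists>x. tail g x \<noteq> 0" using nt g(2) by (metis (mono_tags, lifting) add.right_neutral eventually_mono)
  moreover have ?N
  proof
    assume "neg_energy_at V e c"
    moreover have "energy V c w \<le> (INF v\<in>H1ce c e. energy V c v)" using min by (intro INF_greatest) auto
    ultimately have "energy V c w = -\<infinity>" using INF_energy_minus_inf[OF c] by simp
    then show False unfolding energy_tail[OF c g] by (auto split: if_splits)
  qed
  ultimately show "?N \<and> ?R" using g(1) by blast
next
  assume "?N \<and> ?R"
  then obtain g x0 where n: ?N and g: "g \<in> wL2 c" and "integrable lborel (\<lambda>x. exp (c * x) * V (e + tail g x))"
    "wnorm2 c g / 2 + (LINT x|lborel. exp (c * x) * V (e + tail g x)) \<le> 0" and x0: "tail g x0 \<noteq> 0"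
    by blast
  then have "energy V c (\<lambda>x. e + tail g x) \<le> 0" unfolding energy_of_tail[OF c g] by (simp add: zero_ereal_def)
  then have "is_global_minimizer V e c (\<lambda>x. e + tail g x)"
    unfolding is_global_minimizer_def
    using tail_in_H1ce[OF c g] energy_nonneg[OF c n] order_trans by blast
  moreover have "\<not> (AE x in lborel. e + tail g x = e)"
  proof
    assume "AE x in lborel. e + tail g x = e"
    then have "AE x in lborel. tail g x = 0" by simp
    then show False using AE_const_continuous[OF continuous_tail[OF c g]] x0 by blast
  qed
  ultimately show ?L unfolding has_nontrivial_minimizer_def by blast
qed

text \<open>Above the threshold a minimizer has energy zero. Dilating it to the threshold speed strictly decreases the
  kinetic term, which is positive for a nontrivial profile, and so makes the energy negative there, although no profile
  has negative energy at the threshold speed.\<close>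

lemma nontrivial_minimizer_speed:
  assumes c: "0 < c" and h: "has_nontrivial_minimizer V e c"
  shows "c = c_nl V e"
proof (rule antisym)
  obtain g x0 where n: "\<not> neg_energy_at V e c" and g: "g \<in> wL2 c"
    and i: "integrable lborel (\<lambda>x. exp (c * x) * V (e + tail g x))"
    and E: "wnorm2 c g / 2 + (LINT x|lborel. exp (c * x) * V (e + tail g x)) \<le> 0" and x0: "tail g x0 \<noteq> 0"
    using h unfolding nontrivial_minimizer_iff[OF c] by blast
  show "c_nl V e \<le> c" using n threshold(4)[OF c] by simp
  have N: "0 < wnorm2 c g"
  proof (rule ccontr)
    assume "\<not> ?thesis"
    then have "wnorm2 c g = 0" using wnorm2_nonneg[of c g] by simp
    then show False using norm_tail_le[OF c g, of x0] x0 by simp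
  qed
  show "c \<le> c_nl V e"
  proof (rule ccontr)
    assume lt: "\<not> ?thesis"
    define l where "l = c_nl V e / c"
    have l: "0 < l" "l < 1" "l * c = c_nl V e" using lt c threshold(1) by (auto simp: l_def)
    have "l\<^sup>2 * wnorm2 c g < 1 * wnorm2 c g"
      using l N by (intro mult_strict_right_mono) (auto simp: power_less_one_iff abs_square_less_1)
    then have "neg_energy_at V e (c_nl V e)"
      using neg_energy_at_scale[OF l(1) g i] E l(3) by simp
    then show False using threshold(4)[OF threshold(1)] by simp
  qed
qed

end

section \<open>Completeness and weak compactness\<close>

text \<open>Multiplication by \<open>sqrt (q x) exp (c x / 2)\<close> with \<open>q\<close> positive and integrable maps the weighted space
  continuously into the integrable functions, where a Cauchy sequence has an almost everywhere convergent
  subsequence. Fatou's lemma then identifies its limit as the limit in the weighted norm.\<close>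

lemma wL2_complete:
  fixes h :: "nat \<Rightarrow> real \<Rightarrow> 'a::euclidean_space"
  assumes h: "\<And>n. h n \<in> wL2 c"
    and cau: "\<And>\<epsilon>. 0 < \<epsilon> \<Longrightarrow> \<exists>M. \<forall>m\<ge>M. \<forall>n\<ge>M. wnorm2 c (\<lambda>x. h m x - h n x) < \<epsilon>"
  obtains f where "f \<in> wL2 c" "(\<lambda>n. wnorm2 c (\<lambda>x. h n x - f x)) \<longlonglongrightarrow> 0"
proof -
  have hm[measurable]: "h n \<in> borel_measurable borel" for n using wL2_measurable[OF h] .
  define q where "q x = indicator {0..} x * exp (- (1 * x)) + indicator {..0} x * exp (1 * x)" for x :: real
  have qi: "integrable lborel q"
    using exp_half_line(1)[of 1 0] exp_left_half_line(1)[of 1]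
    by (simp add: q_def[abs_def] set_integrable_def)
  have q: "0 < q x" for x by (auto simp: q_def split: split_indicator)
  have [measurable]: "q \<in> borel_measurable borel" using borel_measurable_integrable[OF qi] by simp
  define k where "k x = sqrt (q x) * exp (c * x / 2)" for x
  have k: "0 < k x" for x using q[of x] by (simp add: k_def)
  have [measurable]: "k \<in> borel_measurable borel" unfolding k_def[abs_def] by measurable
  have kb: "k x * y \<le> \<eta> / 2 * q x + 1 / (2 * \<eta>) * (exp (c * x) * y\<^sup>2)" if "0 < \<eta>" for x y \<eta>
  proof -
    have "(sqrt (q x))\<^sup>2 = q x" using q[of x] by simp
    moreover have "(exp (c * x / 2))\<^sup>2 = exp (c * x)" by (simp add: exp_double[symmetric])
    moreover have "2 * (\<eta> * sqrt (q x)) * (exp (c * x / 2) * y) \<le> (\<eta> * sqrt (q x))\<^sup>2 + (exp (c * x / 2) * y)\<^sup>2"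
      using sum_squares_bound by blast
    ultimately have "2 * \<eta> * (k x * y) \<le> \<eta>\<^sup>2 * q x + exp (c * x) * y\<^sup>2"
      by (simp add: k_def power_mult_distrib mult_ac)
    then show ?thesis using that by (simp add: field_simps power2_eq_square)
  qed
  define s where "s n x = k x *\<^sub>R h n x" for n x
  have ksi: "integrable lborel (\<lambda>x. k x *\<^sub>R f x)" if f: "f \<in> wL2 c" for f :: "real \<Rightarrow> 'a"
  proof (rule Bochner_Integration.integrable_bound)
    note [measurable] = wL2_measurable[OF f]
    show "integrable lborel (\<lambda>x. 1 / 2 * q x + 1 / (2 * 1) * (exp (c * x) * (norm (f x))\<^sup>2))"
      using qi wL2_integrable[OF f] by simp
    show "(\<lambda>x. k x *\<^sub>R f x) \<in> borel_measurable lborel" by measurable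
    show "AE x in lborel. norm (k x *\<^sub>R f x) \<le> norm (1 / 2 * q x + 1 / (2 * 1) * (exp (c * x) * (norm (f x))\<^sup>2))"
    proof (rule AE_I2)
      fix x
      have n: "norm (k x *\<^sub>R f x) = k x * norm (f x)" using k[of x] by simp
      show "norm (k x *\<^sub>R f x) \<le> norm (1 / 2 * q x + 1 / (2 * 1) * (exp (c * x) * (norm (f x))\<^sup>2))"
        unfolding n real_norm_def using kb[of 1 x "norm (f x)"] by linarith
    qed
  qed
  have "\<exists>M. \<forall>i\<ge>M. \<forall>j\<ge>M. LINT x|lborel. norm (s i x - s j x) < \<epsilon>" if \<epsilon>0: "0 < \<epsilon>" for \<epsilon>
  proof -
    define Z where "Z = (LINT x|lborel. q x)"
    have Z: "0 \<le> Z" unfolding Z_def using q by (intro integral_nonneg_AE) (auto intro: less_imp_le)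
    define \<eta> where "\<eta> = \<epsilon> / (Z + 1)"
    have \<eta>: "0 < \<eta>" using Z that by (simp add: \<eta>_def)
    have "\<eta> * Z \<le> \<epsilon>" using Z that by (simp add: \<eta>_def field_simps)
    obtain M where M: "\<And>m n. m \<ge> M \<Longrightarrow> n \<ge> M \<Longrightarrow> wnorm2 c (\<lambda>x. h m x - h n x) < \<eta> * \<epsilon>"
      using cau[of "\<eta> * \<epsilon>"] \<eta> \<epsilon>0 by auto
    have "LINT x|lborel. norm (s i x - s j x) < \<epsilon>" if "i \<ge> M" "j \<ge> M" for i j
    proof -
      have d: "(\<lambda>x. h i x - h j x) \<in> wL2 c" by (intro wL2_diff h)
      have "(LINT x|lborel. norm (s i x - s j x))
          \<le> (LINT x|lborel. \<eta> / 2 * q x + 1 / (2 * \<eta>) * (exp (c * x) * (norm (h i x - h j x))\<^sup>2))"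
      proof (rule integral_mono)
        show "integrable lborel (\<lambda>x. norm (s i x - s j x))"
          using integrable_norm[OF ksi[OF d]] by (simp add: s_def scaleR_diff_right)
        show "integrable lborel (\<lambda>x. \<eta> / 2 * q x + 1 / (2 * \<eta>) * (exp (c * x) * (norm (h i x - h j x))\<^sup>2))"
          using qi wL2_integrable[OF d] by simp
        show "norm (s i x - s j x) \<le> \<eta> / 2 * q x + 1 / (2 * \<eta>) * (exp (c * x) * (norm (h i x - h j x))\<^sup>2)" for x
        proof -
          have "norm (s i x - s j x) = k x * norm (h i x - h j x)"
            using k[of x] by (simp add: s_def scaleR_diff_right[symmetric])
          then show ?thesis using kb[OF \<eta>] by simp
        qed
      qed
      also have "\<dots> = \<eta> / 2 * Z + 1 / (2 * \<eta>) * wnorm2 c (\<lambda>x. h i x - h j x)"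
        using qi wL2_integrable[OF d] by (simp add: Z_def wnorm2_def)
      also have "\<dots> < \<eta> / 2 * Z + 1 / (2 * \<eta>) * (\<eta> * \<epsilon>)"
        using M[OF that] \<eta> by (intro add_strict_left_mono mult_strict_left_mono) auto
      also have "\<dots> \<le> \<epsilon>" using \<open>\<eta> * Z \<le> \<epsilon>\<close> \<eta> by simp
      finally show ?thesis .
    qed
    then show ?thesis by blast
  qed
  then obtain r where r: "strict_mono r" "AE x in lborel. Cauchy (\<lambda>i. s (r i) x)"
    using cauchy_L1_AE_cauchy_subseq[of lborel s] ksi[OF h] unfolding s_def[abs_def] by blast
  define f where "f x = lim (\<lambda>i. h (r i) x)" for x
  have [measurable]: "f \<in> borel_measurable borel"
    unfolding f_def[abs_def] by (intro borel_measurable_lim_metric) measurable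
  have lim: "AE x in lborel. (\<lambda>i. h (r i) x) \<longlonglongrightarrow> f x"
    using r(2)
  proof eventually_elim
    case (elim x)
    then have "convergent (\<lambda>i. s (r i) x)" by (simp add: Cauchy_convergent_iff)
    then obtain L where "(\<lambda>i. s (r i) x) \<longlonglongrightarrow> L" by (auto simp: convergent_def)
    then have "(\<lambda>i. (1 / k x) *\<^sub>R s (r i) x) \<longlonglongrightarrow> (1 / k x) *\<^sub>R L" by (intro tendsto_intros)
    then have "(\<lambda>i. h (r i) x) \<longlonglongrightarrow> (1 / k x) *\<^sub>R L"
      using k[of x] by (simp add: s_def)
    then show ?case unfolding f_def by (simp add: limI)
  qed
  have bound: "(\<integral>\<^sup>+x. ennreal (exp (c * x) * (norm (h n x - f x))\<^sup>2) \<partial>lborel) \<le> ennreal \<epsilon>"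
    if n: "n \<ge> M" and \<epsilon>: "0 < \<epsilon>" and M: "\<And>m n. m \<ge> M \<Longrightarrow> n \<ge> M \<Longrightarrow> wnorm2 c (\<lambda>x. h m x - h n x) < \<epsilon>" for n M \<epsilon>
  proof -
    have "(\<integral>\<^sup>+x. ennreal (exp (c * x) * (norm (h n x - f x))\<^sup>2) \<partial>lborel)
        = (\<integral>\<^sup>+x. liminf (\<lambda>i. ennreal (exp (c * x) * (norm (h n x - h (r i) x))\<^sup>2)) \<partial>lborel)"
    proof (rule nn_integral_cong_AE)
      show "AE x in lborel. ennreal (exp (c * x) * (norm (h n x - f x))\<^sup>2)
          = liminf (\<lambda>i. ennreal (exp (c * x) * (norm (h n x - h (r i) x))\<^sup>2))"
        using lim
      proof eventually_elim
        case (elim x)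
        have "(\<lambda>i. ennreal (exp (c * x) * (norm (h n x - h (r i) x))\<^sup>2)) \<longlonglongrightarrow> ennreal (exp (c * x) * (norm (h n x - f x))\<^sup>2)"
          by (intro tendsto_ennrealI tendsto_intros elim)
        from lim_imp_Liminf[OF trivial_limit_sequentially this] show ?case by (rule sym)
      qed
    qed
    also have "\<dots> \<le> liminf (\<lambda>i. \<integral>\<^sup>+x. ennreal (exp (c * x) * (norm (h n x - h (r i) x))\<^sup>2) \<partial>lborel)"
      by (rule nn_integral_liminf) measurable
    also have "\<dots> \<le> ennreal \<epsilon>"
    proof (rule Liminf_le)
      show "\<forall>\<^sub>F i in sequentially. (\<integral>\<^sup>+x. ennreal (exp (c * x) * (norm (h n x - h (r i) x))\<^sup>2) \<partial>lborel) \<le> ennreal \<epsilon>"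
        unfolding eventually_sequentially
      proof (intro exI allI impI)
        fix i assume "M \<le> i"
        then have "M \<le> r i" using seq_suble[OF r(1), of i] by simp
        then show "(\<integral>\<^sup>+x. ennreal (exp (c * x) * (norm (h n x - h (r i) x))\<^sup>2) \<partial>lborel) \<le> ennreal \<epsilon>"
          using M[OF n] unfolding nn_integral_wnorm2[OF wL2_diff[OF h h]] by (intro ennreal_leI) (simp add: less_imp_le)
      qed
    qed simp
    finally show ?thesis .
  qed
  have key: "\<exists>M. \<forall>n\<ge>M. (\<lambda>x. h n x - f x) \<in> wL2 c \<and> wnorm2 c (\<lambda>x. h n x - f x) \<le> \<epsilon>" if \<epsilon>0: "0 < \<epsilon>" for \<epsilon>
  proof -
    obtain M where M: "\<And>m n. m \<ge> M \<Longrightarrow> n \<ge> M \<Longrightarrow> wnorm2 c (\<lambda>x. h m x - h n x) < \<epsilon>"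
      using cau[OF \<epsilon>0] by auto
    have "(\<lambda>x. h n x - f x) \<in> wL2 c \<and> wnorm2 c (\<lambda>x. h n x - f x) \<le> \<epsilon>" if "n \<ge> M" for n
      using wL2_I_nn[OF _ bound[OF that \<epsilon>0 M]] \<epsilon>0 by auto
    then show ?thesis by blast
  qed
  show thesis
  proof (rule that[of f])
    obtain M where "(\<lambda>x. h M x - f x) \<in> wL2 c" using key[of 1] by auto
    then have "(\<lambda>x. h M x - (h M x - f x)) \<in> wL2 c" by (rule wL2_diff[OF h])
    then show "f \<in> wL2 c" by simp
    show "(\<lambda>n. wnorm2 c (\<lambda>x. h n x - f x)) \<longlonglongrightarrow> 0"
    proof (rule LIMSEQ_I)
      fix \<epsilon> :: real assume "0 < \<epsilon>"
      then obtain M where "\<And>n. n \<ge> M \<Longrightarrow> wnorm2 c (\<lambda>x. h n x - f x) \<le> \<epsilon> / 2" using key[of "\<epsilon> / 2"] by auto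
      then show "\<exists>M. \<forall>n\<ge>M. norm (wnorm2 c (\<lambda>x. h n x - f x) - 0) < \<epsilon>"
        using \<open>0 < \<epsilon>\<close> by (intro exI[of _ M]) (fastforce simp: wnorm2_nonneg)
    qed
  qed
qed

text \<open>A substitute for the triangle inequality: the pointwise inequality
  \<open>2 |a - b| |b| \<le> t |b|\<^sup>2 + |a - b|\<^sup>2 / t\<close> can be integrated directly.\<close>

lemma wnorm2_diff_bound:
  assumes f: "f \<in> wL2 c" and g: "g \<in> wL2 c" and t: "0 < t"
  shows "\<bar>wnorm2 c f - wnorm2 c g\<bar> \<le> t * wnorm2 c g + (1 + 1 / t) * wnorm2 c (\<lambda>x. f x - g x)"
proof -
  have pt: "\<bar>(norm a)\<^sup>2 - (norm b)\<^sup>2\<bar> \<le> t * (norm b)\<^sup>2 + (1 + 1 / t) * (norm (a - b))\<^sup>2" for a b :: 'a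
  proof -
    have eq: "(norm a)\<^sup>2 - (norm b)\<^sup>2 = (norm (a - b))\<^sup>2 + 2 * ((a - b) \<bullet> b)"
      by (simp add: power2_norm_eq_inner inner_diff_left inner_diff_right inner_commute)
    have "\<bar>(a - b) \<bullet> b\<bar> \<le> norm (a - b) * norm b" by (rule Cauchy_Schwarz_ineq2)
    moreover have "2 * (norm (a - b) * norm b) \<le> t * (norm b)\<^sup>2 + 1 / t * (norm (a - b))\<^sup>2"
    proof -
      have "2 * (t * norm b) * norm (a - b) \<le> (t * norm b)\<^sup>2 + (norm (a - b))\<^sup>2" by (rule sum_squares_bound)
      then show ?thesis using t by (simp add: field_simps power2_eq_square)
    qed
    moreover have "(1 + 1 / t) * (norm (a - b))\<^sup>2 = (norm (a - b))\<^sup>2 + 1 / t * (norm (a - b))\<^sup>2"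
      by (simp add: distrib_right)
    moreover have "0 \<le> (norm (a - b))\<^sup>2" by simp
    ultimately show ?thesis unfolding eq by linarith
  qed
  note i = wL2_integrable[OF f] wL2_integrable[OF g] wL2_integrable[OF wL2_diff[OF f g]]
  have "\<bar>wnorm2 c f - wnorm2 c g\<bar> = \<bar>LINT x|lborel. exp (c * x) * (norm (f x))\<^sup>2 - exp (c * x) * (norm (g x))\<^sup>2\<bar>"
    using i by (simp add: wnorm2_def)
  also have "\<dots> \<le> (LINT x|lborel. \<bar>exp (c * x) * (norm (f x))\<^sup>2 - exp (c * x) * (norm (g x))\<^sup>2\<bar>)"
    by (rule integral_abs_bound)
  also have "\<dots> \<le> (LINT x|lborel. t * (exp (c * x) * (norm (g x))\<^sup>2) + (1 + 1 / t) * (exp (c * x) * (norm (f x - g x))\<^sup>2))"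
  proof (rule integral_mono)
    show "\<bar>exp (c * x) * (norm (f x))\<^sup>2 - exp (c * x) * (norm (g x))\<^sup>2\<bar>
      \<le> t * (exp (c * x) * (norm (g x))\<^sup>2) + (1 + 1 / t) * (exp (c * x) * (norm (f x - g x))\<^sup>2)" for x
    proof -
      have "\<bar>exp (c * x) * (norm (f x))\<^sup>2 - exp (c * x) * (norm (g x))\<^sup>2\<bar> = exp (c * x) * \<bar>(norm (f x))\<^sup>2 - (norm (g x))\<^sup>2\<bar>"
        by (simp add: abs_mult right_diff_distrib[symmetric])
      also have "\<dots> \<le> exp (c * x) * (t * (norm (g x))\<^sup>2 + (1 + 1 / t) * (norm (f x - g x))\<^sup>2)"
        by (intro mult_left_mono pt) auto
      finally show ?thesis by (simp only: distrib_left mult.left_commute)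
    qed
  qed (use i in auto)
  also have "\<dots> = t * wnorm2 c g + (1 + 1 / t) * wnorm2 c (\<lambda>x. f x - g x)"
    using i by (subst Bochner_Integration.integral_add) (auto simp: wnorm2_def)
  finally show ?thesis .
qed

lemma wnorm2_tendsto:
  assumes h: "\<And>n. h n \<in> wL2 c" and f: "f \<in> wL2 c"
    and lim: "(\<lambda>n. wnorm2 c (\<lambda>x. h n x - f x)) \<longlonglongrightarrow> 0"
  shows "(\<lambda>n. wnorm2 c (h n)) \<longlonglongrightarrow> wnorm2 c f"
proof (rule LIMSEQ_I)
  fix \<epsilon> :: real assume \<epsilon>: "0 < \<epsilon>"
  define t where "t = \<epsilon> / (2 * (wnorm2 c f + 1))"
  have p: "0 < wnorm2 c f + 1" using wnorm2_nonneg[of c f] by simp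
  then have t: "0 < t" using \<epsilon> by (simp add: t_def)
  have tf: "t * wnorm2 c f \<le> \<epsilon> / 2" using p \<epsilon> wnorm2_nonneg[of c f] by (simp add: t_def field_simps)
  have "(\<lambda>n. (1 + 1 / t) * wnorm2 c (\<lambda>x. h n x - f x)) \<longlonglongrightarrow> (1 + 1 / t) * 0"
    by (intro tendsto_intros lim)
  then have "\<forall>\<^sub>F n in sequentially. (1 + 1 / t) * wnorm2 c (\<lambda>x. h n x - f x) < \<epsilon> / 2"
    using \<epsilon> by (intro order_tendstoD(2)) auto
  then obtain M where M: "\<And>n. n \<ge> M \<Longrightarrow> (1 + 1 / t) * wnorm2 c (\<lambda>x. h n x - f x) < \<epsilon> / 2"
    by (auto simp: eventually_sequentially)
  show "\<exists>M. \<forall>n\<ge>M. norm (wnorm2 c (h n) - wnorm2 c f) < \<epsilon>"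
    using M wnorm2_diff_bound[OF h f t] tf by (intro exI[of _ M]) (smt (verit) field_sum_of_halves real_norm_def)
qed

lemma tail_tendsto:
  assumes c: "0 < c" and h: "\<And>n. h n \<in> wL2 c" and f: "f \<in> wL2 c"
    and lim: "(\<lambda>n. wnorm2 c (\<lambda>x. h n x - f x)) \<longlonglongrightarrow> 0"
  shows "(\<lambda>n. tail (h n) x) \<longlonglongrightarrow> tail f x"
proof -
  have "(\<lambda>n. exp (- (c * x)) / c * wnorm2 c (\<lambda>x. h n x - f x)) \<longlonglongrightarrow> exp (- (c * x)) / c * 0"
    by (intro tendsto_intros lim)
  then have L: "(\<lambda>n. exp (- (c * x)) / c * wnorm2 c (\<lambda>x. h n x - f x)) \<longlonglongrightarrow> 0" by simp
  have "(\<lambda>n. (norm (tail (h n) x - tail f x))\<^sup>2) \<longlonglongrightarrow> 0"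
  proof (rule tendsto_sandwich[OF _ _ tendsto_const L])
    show "\<forall>\<^sub>F n in sequentially. (norm (tail (h n) x - tail f x))\<^sup>2 \<le> exp (- (c * x)) / c * wnorm2 c (\<lambda>x. h n x - f x)"
      using norm_tail_le[OF c wL2_diff[OF h f]] by (simp add: tail_diff_fun[OF c h f])
  qed simp
  then have "(\<lambda>n. sqrt ((norm (tail (h n) x - tail f x))\<^sup>2)) \<longlonglongrightarrow> sqrt 0" by (rule tendsto_real_sqrt)
  then have "(\<lambda>n. norm (tail (h n) x - tail f x)) \<longlonglongrightarrow> 0" by simp
  then show ?thesis by (subst Lim_null) (simp add: tendsto_norm_zero_iff)
qed

text \<open>Half of \<open>\<integral> exp (c x) (|v'|\<^sup>2 - \<kappa> |v|\<^sup>2)\<close> for \<open>v = tail f\<close>; by Hardy's inequality it is equivalent to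
  \<open>wnorm2 c f\<close> when \<open>0 \<le> \<kappa> < c\<^sup>2 / 4\<close>.\<close>

definition quad_form :: "real \<Rightarrow> real \<Rightarrow> (real \<Rightarrow> 'a::euclidean_space) \<Rightarrow> real" where
  "quad_form c \<kappa> f = (wnorm2 c f - \<kappa> * wnorm2 c (tail f)) / 2"

lemma quad_form_coercive:
  assumes "0 < c" "0 \<le> \<kappa>" "f \<in> wL2 c"
  shows "(1 - 4 * \<kappa> / c\<^sup>2) * wnorm2 c f \<le> 2 * quad_form c \<kappa> f"
proof -
  have "(1 - 4 * \<kappa> / c\<^sup>2) * wnorm2 c f = wnorm2 c f - \<kappa> * (4 / c\<^sup>2 * wnorm2 c f)"
    by (simp add: left_diff_distrib)
  then show ?thesis
    using mult_left_mono[OF hardy(2)[OF assms(1,3)] assms(2)] by (simp add: quad_form_def)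
qed

lemma quad_form_parallelogram:
  assumes c: "0 < c" and f: "f \<in> wL2 c" and g: "g \<in> wL2 c"
  shows "quad_form c \<kappa> (\<lambda>x. f x + g x) + quad_form c \<kappa> (\<lambda>x. f x - g x) = 2 * quad_form c \<kappa> f + 2 * quad_form c \<kappa> g"
proof -
  have 1: "wnorm2 c (\<lambda>x. f x + g x) + wnorm2 c (\<lambda>x. f x - g x) = 2 * wnorm2 c f + 2 * wnorm2 c g"
    by (rule wnorm2_parallelogram[OF f g])
  have 2: "wnorm2 c (\<lambda>x. tail f x + tail g x) + wnorm2 c (\<lambda>x. tail f x - tail g x) = 2 * wnorm2 c (tail f) + 2 * wnorm2 c (tail g)"
    by (rule wnorm2_parallelogram[OF hardy(1)[OF c f] hardy(1)[OF c g]])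
  have "\<kappa> * wnorm2 c (\<lambda>x. tail f x + tail g x) + \<kappa> * wnorm2 c (\<lambda>x. tail f x - tail g x)
      = 2 * (\<kappa> * wnorm2 c (tail f)) + 2 * (\<kappa> * wnorm2 c (tail g))"
    unfolding distrib_left[symmetric] 2 by (simp add: algebra_simps)
  then show ?thesis using 1 unfolding quad_form_def tail_add[OF c f g] tail_diff_fun[OF c f g]
    by argo
qed

lemma quad_form_scale:
  assumes "0 < c" "f \<in> wL2 c"
  shows "quad_form c \<kappa> (\<lambda>x. a *\<^sub>R f x) = a\<^sup>2 * quad_form c \<kappa> f"
  unfolding quad_form_def tail_scale wL2_scale(2)[OF assms(2)] wL2_scale(2)[OF hardy(1)[OF assms]]
  by (simp add: algebra_simps)

lemma quad_form_tendsto: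
  assumes c: "0 < c" and h: "\<And>n. h n \<in> wL2 c" and f: "f \<in> wL2 c"
    and lim: "(\<lambda>n. wnorm2 c (\<lambda>x. h n x - f x)) \<longlonglongrightarrow> 0"
  shows "(\<lambda>n. quad_form c \<kappa> (h n)) \<longlonglongrightarrow> quad_form c \<kappa> f"
proof -
  have "(\<lambda>n. 4 / c\<^sup>2 * wnorm2 c (\<lambda>x. h n x - f x)) \<longlonglongrightarrow> 4 / c\<^sup>2 * 0"
    by (intro tendsto_intros lim)
  then have L: "(\<lambda>n. 4 / c\<^sup>2 * wnorm2 c (\<lambda>x. h n x - f x)) \<longlonglongrightarrow> 0" by simp
  have "(\<lambda>n. wnorm2 c (\<lambda>x. tail (h n) x - tail f x)) \<longlonglongrightarrow> 0"
  proof (rule tendsto_sandwich[OF _ _ tendsto_const L])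
    show "\<forall>\<^sub>F n in sequentially. wnorm2 c (\<lambda>x. tail (h n) x - tail f x) \<le> 4 / c\<^sup>2 * wnorm2 c (\<lambda>x. h n x - f x)"
      using hardy(2)[OF c wL2_diff[OF h f]] by (simp add: tail_diff_fun[OF c h f])
  qed (simp add: wnorm2_nonneg)
  then have "(\<lambda>n. wnorm2 c (tail (h n))) \<longlonglongrightarrow> wnorm2 c (tail f)"
    by (rule wnorm2_tendsto[OF hardy(1)[OF c h] hardy(1)[OF c f]])
  then show ?thesis unfolding quad_form_def
    by (intro tendsto_intros wnorm2_tendsto[OF h f lim]) auto
qed

text \<open>A limit is obtained without duality, by the projection argument for convex sets. The set \<open>A n\<close> consists of all functions whose
  primitives are, on \<open>S\<close>, as close to \<open>v\<close> as those of \<open>G k\<close> for all \<open>k \<ge> n\<close>; it is convex, contains \<open>G k\<close> for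
  \<open>k \<ge> n\<close>, and shrinks with \<open>n\<close>. By the parallelogram law, near-minimizers \<open>h n\<close> of the quadratic form on
  \<open>A n\<close> form a Cauchy sequence. Their limit has primitive \<open>v\<close> on \<open>S\<close>, and since the infimum over \<open>A n\<close> is at most the value at \<open>G k\<close>,
  lower semicontinuity comes for free.\<close>

lemma weak_limit:
  fixes G :: "nat \<Rightarrow> real \<Rightarrow> 'a::euclidean_space"
  assumes c: "0 < c" and \<kappa>: "0 \<le> \<kappa>" "\<kappa> < c\<^sup>2 / 4" and G: "\<And>n. G n \<in> wL2 c"
    and v: "\<And>y. y \<in> S \<Longrightarrow> (\<lambda>n. tail (G n) y) \<longlonglongrightarrow> v y"
    and l: "(\<lambda>n. quad_form c \<kappa> (G n)) \<longlonglongrightarrow> l"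
  obtains f where "f \<in> wL2 c" "\<And>y. y \<in> S \<Longrightarrow> tail f y = v y" "quad_form c \<kappa> f \<le> l"
proof -
  let ?Q = "quad_form c \<kappa> :: (real \<Rightarrow> 'a) \<Rightarrow> real"
  define \<alpha> where "\<alpha> = 1 - 4 * \<kappa> / c\<^sup>2"
  have \<alpha>: "0 < \<alpha>" using \<kappa> c by (simp add: \<alpha>_def field_simps)
  have coe: "\<alpha> * wnorm2 c f \<le> 2 * ?Q f" if "f \<in> wL2 c" for f
    unfolding \<alpha>_def by (rule quad_form_coercive[OF c \<kappa>(1) that])
  have Q0: "0 \<le> ?Q f" if "f \<in> wL2 c" for f
    using coe[OF that] mult_nonneg_nonneg[OF less_imp_le[OF \<alpha>] wnorm2_nonneg[of c f]] by linarith
  define A where "A n = {f \<in> wL2 c. \<forall>y\<in>S. \<forall>\<rho>. (\<forall>k\<ge>n. norm (tail (G k) y - v y) \<le> \<rho>) \<longrightarrow> norm (tail f y - v y) \<le> \<rho>}" for n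
  have GA: "G k \<in> A n" if "n \<le> k" for n k using that G by (auto simp: A_def)
  have Asub: "f \<in> A n" if "f \<in> A m" "n \<le> m" for f n m using that by (auto simp: A_def)
  have Amid: "(\<lambda>x. (1/2) *\<^sub>R (f x + g x)) \<in> A n" if fg: "f \<in> A n" "g \<in> A n" for f g n
  proof -
    have fL: "f \<in> wL2 c" and gL: "g \<in> wL2 c" using fg by (auto simp: A_def)
    have "norm (tail (\<lambda>x. (1/2) *\<^sub>R (f x + g x)) y - v y) \<le> \<rho>"
      if y: "y \<in> S" and \<rho>: "\<forall>k\<ge>n. norm (tail (G k) y - v y) \<le> \<rho>" for y \<rho>
    proof -
      have "tail (\<lambda>x. (1/2) *\<^sub>R (f x + g x)) y - v y = (1/2) *\<^sub>R ((tail f y - v y) + (tail g y - v y))"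
        unfolding tail_scale tail_add[OF c fL gL] by (simp add: algebra_simps) (simp add: scaleR_2[symmetric])
      also have "norm \<dots> \<le> (1/2) * (norm (tail f y - v y) + norm (tail g y - v y))"
        by (simp add: norm_triangle_ineq)
      also have "\<dots> \<le> \<rho>" using fg y \<rho> by (auto simp: A_def dest!: bspec[OF _ y] spec[of _ \<rho>])
      finally show ?thesis .
    qed
    then show ?thesis using wL2_scale(1)[OF wL2_add[OF fL gL], of "1/2"] by (auto simp: A_def)
  qed
  define d where "d n = Inf (?Q ` A n)" for n
  have bdd: "bdd_below (?Q ` A n)" for n
    using Q0 by (intro bdd_belowI[of _ 0]) (auto simp: A_def)
  have d_le: "d n \<le> ?Q f" if "f \<in> A n" for f n
    unfolding d_def by (rule cInf_lower[OF imageI[OF that] bdd])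
  have "\<exists>f\<in>A n. ?Q f < d n + 1 / real (Suc n)" for n
    using cInf_lessD[of "?Q ` A n" "d n + 1 / real (Suc n)"] GA[of n n] unfolding d_def by auto
  then obtain h where hA: "\<And>n. h n \<in> A n" and hQ: "\<And>n. ?Q (h n) < d n + 1 / real (Suc n)"
    by metis
  have hL: "h n \<in> wL2 c" for n using hA[of n] by (simp add: A_def)
  have dmono: "d n \<le> d m" if "n \<le> m" for n m
    unfolding d_def by (rule cInf_superset_mono) (use GA[of m m] bdd Asub that in \<open>auto\<close>)
  have d_l: "d n \<le> l" for n
  proof (rule LIMSEQ_le_const[OF l])
    show "\<exists>N. \<forall>k\<ge>N. d n \<le> ?Q (G k)" using d_le GA by blast
  qed
  obtain D where D: "d \<longlonglongrightarrow> D"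
  proof -
    have "incseq d" using dmono by (simp add: incseq_def)
    then show ?thesis using incseq_convergent[of d l] d_l that by blast
  qed
  have QD: "?Q (\<lambda>x. h n x - h m x) \<le> 2 * (d m - d n) + 4 / real (Suc n)" if nm: "n \<le> m" for n m
  proof -
    have sum: "(\<lambda>x. h n x + h m x) \<in> wL2 c" by (intro wL2_add hL)
    have "d n \<le> ?Q (\<lambda>x. (1/2) *\<^sub>R (h n x + h m x))"
      by (intro d_le Amid hA Asub[OF hA nm])
    also have "\<dots> = 1/4 * ?Q (\<lambda>x. h n x + h m x)"
      unfolding quad_form_scale[OF c sum] by (simp add: power2_eq_square)
    finally have "4 * d n \<le> ?Q (\<lambda>x. h n x + h m x)" by simp
    moreover have "1 / real (Suc m) \<le> 1 / real (Suc n)" using nm by (simp add: frac_le)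
    moreover note quad_form_parallelogram[OF c hL hL, of \<kappa> n m] hQ[of n] hQ[of m]
    ultimately have "?Q (\<lambda>x. h n x - h m x) \<le> 2 * (d m - d n) + 4 * (1 / real (Suc n))" by argo
    then show ?thesis by simp
  qed
  have N: "wnorm2 c (\<lambda>x. h n x - h m x) \<le> 2 / \<alpha> * (2 * (D - d n) + 4 / real (Suc n))" if nm: "n \<le> m" for n m
  proof -
    have "d m \<le> D" using D dmono by (intro LIMSEQ_le_const[OF D]) blast
    then have "\<alpha> * wnorm2 c (\<lambda>x. h n x - h m x) \<le> 2 * (2 * (D - d n) + 4 / real (Suc n))"
      using coe[OF wL2_diff[OF hL hL], of n m] QD[OF nm] by argo
    then have "wnorm2 c (\<lambda>x. h n x - h m x) \<le> 2 * (2 * (D - d n) + 4 / real (Suc n)) / \<alpha>"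
      using \<alpha> by (simp only: pos_le_divide_eq mult.commute)
    then show ?thesis by simp
  qed
  have bl: "(\<lambda>n. 2 / \<alpha> * (2 * (D - d n) + 4 / real (Suc n))) \<longlonglongrightarrow> 2 / \<alpha> * (2 * (D - D) + 0)"
    by (intro tendsto_intros D LIMSEQ_Suc lim_const_over_n)
  have sym: "wnorm2 c (\<lambda>x. h m x - h n x) = wnorm2 c (\<lambda>x. h n x - h m x)" for m n
    by (simp add: wnorm2_def norm_minus_commute)
  obtain f where f: "f \<in> wL2 c" and lim: "(\<lambda>n. wnorm2 c (\<lambda>x. h n x - f x)) \<longlonglongrightarrow> 0"
  proof (rule wL2_complete[OF hL])
    fix \<epsilon> :: real assume "0 < \<epsilon>"
    then have "\<forall>\<^sub>F n in sequentially. 2 / \<alpha> * (2 * (D - d n) + 4 / real (Suc n)) < \<epsilon>"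
      using bl by (intro order_tendstoD(2)[OF bl]) auto
    then obtain M where M: "\<And>n. n \<ge> M \<Longrightarrow> 2 / \<alpha> * (2 * (D - d n) + 4 / real (Suc n)) < \<epsilon>"
      by (auto simp: eventually_sequentially)
    have "wnorm2 c (\<lambda>x. h m x - h n x) < \<epsilon>" if "m \<ge> M" "n \<ge> M" for m n
      using N[of m n] N[of n m] M[OF that(1)] M[OF that(2)] sym[of m n] by (cases "m \<le> n") auto
    then show "\<exists>M. \<forall>m\<ge>M. \<forall>n\<ge>M. wnorm2 c (\<lambda>x. h m x - h n x) < \<epsilon>" by blast
  qed blast
  show thesis
  proof (rule that[OF f])
    fix y assume y: "y \<in> S"
    have "(\<lambda>n. tail (h n) y) \<longlonglongrightarrow> v y"
    proof (rule LIMSEQ_I)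
      fix r :: real assume "0 < r"
      then obtain M where M: "\<And>n. n \<ge> M \<Longrightarrow> norm (tail (G n) y - v y) < r / 2"
        using LIMSEQ_D[OF v[OF y], of "r / 2"] by auto
      have "norm (tail (h n) y - v y) \<le> r / 2" if "n \<ge> M" for n
        using hA[of n] y M that by (auto simp: A_def dest!: bspec[OF _ y] spec[of _ "r / 2"]) (meson le_trans less_imp_le)
      then show "\<exists>no. \<forall>n\<ge>no. norm (tail (h n) y - v y) < r" using \<open>0 < r\<close> by (intro exI[of _ M]) fastforce
    qed
    then show "tail f y = v y" using tail_tendsto[OF c hL f lim] LIMSEQ_unique by blast
  next
    have "(\<lambda>n. ?Q (h n)) \<longlonglongrightarrow> ?Q f" by (rule quad_form_tendsto[OF c hL f lim])
    moreover have "(\<lambda>n. d n + 1 / real (Suc n)) \<longlonglongrightarrow> D + 0"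
      by (intro tendsto_intros D LIMSEQ_Suc lim_const_over_n)
    ultimately have "?Q f \<le> D + 0"
      by (rule LIMSEQ_le) (use hQ in \<open>auto intro: less_imp_le\<close>)
    moreover have "D \<le> l" using d_l by (intro LIMSEQ_le_const2[OF D]) auto
    ultimately show "?Q f \<le> l" by simp
  qed
qed

text \<open>A diagonal subsequence converges at all rational points; the uniform Hoelder bound on primitives extends the convergence to
  all points.\<close>

lemma weak_compactness:
  fixes g :: "nat \<Rightarrow> real \<Rightarrow> 'a::euclidean_space"
  assumes c: "0 < c" and \<kappa>: "0 \<le> \<kappa>" "\<kappa> < c\<^sup>2 / 4" and g: "\<And>n. g n \<in> wL2 c" and B: "\<And>n. wnorm2 c (g n) \<le> B"
  obtains r f l where "strict_mono (r :: nat \<Rightarrow> nat)" "f \<in> wL2 c"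
    "\<And>x. (\<lambda>n. tail (g (r n)) x) \<longlonglongrightarrow> tail f x" "(\<lambda>n. quad_form c \<kappa> (g (r n))) \<longlonglongrightarrow> l" "quad_form c \<kappa> f \<le> l"
proof -
  have "norm (exp (c * x / 2) *\<^sub>R tail (g n) x) \<le> sqrt (B / c)" for n x
  proof -
    have "(norm (exp (c * x / 2) *\<^sub>R tail (g n) x))\<^sup>2 = exp (c * x) * (norm (tail (g n) x))\<^sup>2"
      by (simp add: power_mult_distrib exp_double[symmetric])
    also have "\<dots> \<le> exp (c * x) * (exp (- (c * x)) / c * wnorm2 c (g n))"
      by (intro mult_left_mono norm_tail_le[OF c g]) auto
    also have "\<dots> = wnorm2 c (g n) / c" by (simp add: exp_minus field_simps)
    also have "\<dots> \<le> B / c" using B c by (simp add: divide_right_mono)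
    finally show ?thesis by (rule real_le_rsqrt)
  qed
  then obtain k where k: "strict_mono (k :: nat \<Rightarrow> nat)"
    "\<And>x. x \<in> \<rat> \<Longrightarrow> \<exists>l. (\<lambda>n. exp (c * x / 2) *\<^sub>R tail (g (k n)) x) \<longlonglongrightarrow> l"
    using function_convergent_subsequence[of "\<rat>" "\<lambda>n x. exp (c * x / 2) *\<^sub>R tail (g n) x"] countable_rat by metis
  have "\<exists>l. (\<lambda>n. tail (g (k n)) x) \<longlonglongrightarrow> l" if xQ: "x \<in> \<rat>" for x
  proof -
    obtain l where "(\<lambda>n. exp (c * x / 2) *\<^sub>R tail (g (k n)) x) \<longlonglongrightarrow> l" using k(2)[OF xQ] by blast
    then have "(\<lambda>n. exp (- (c * x / 2)) *\<^sub>R (exp (c * x / 2) *\<^sub>R tail (g (k n)) x)) \<longlonglongrightarrow> exp (- (c * x / 2)) *\<^sub>R l"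
      by (intro tendsto_intros)
    then show ?thesis by (auto simp: mult_exp_exp)
  qed
  then obtain v where v: "\<And>x. x \<in> \<rat> \<Longrightarrow> (\<lambda>n. tail (g (k n)) x) \<longlonglongrightarrow> v x" by metis
  have "bounded (range (\<lambda>n. quad_form c \<kappa> (g (k n))))"
  proof -
    have "\<bar>quad_form c \<kappa> f\<bar> \<le> B" if "f \<in> wL2 c" "wnorm2 c f \<le> B" for f :: "real \<Rightarrow> 'a"
    proof -
      have "0 \<le> 1 - 4 * \<kappa> / c\<^sup>2" using \<kappa> c by (simp add: field_simps)
      then have "0 \<le> quad_form c \<kappa> f"
        using quad_form_coercive[OF c \<kappa>(1) that(1)] wnorm2_nonneg[of c f] by (smt (verit) mult_nonneg_nonneg)
      moreover have "0 \<le> \<kappa> * wnorm2 c (tail f)" by (intro mult_nonneg_nonneg wnorm2_nonneg \<kappa>(1))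
      then have "2 * quad_form c \<kappa> f \<le> B" using that(2) by (simp add: quad_form_def)
      ultimately show ?thesis by simp
    qed
    then show ?thesis using g B by (intro boundedI[of _ B]) auto
  qed
  then obtain l r where r: "strict_mono (r :: nat \<Rightarrow> nat)" and "((\<lambda>n. quad_form c \<kappa> (g (k n))) \<circ> r) \<longlonglongrightarrow> l"
    using bounded_imp_convergent_subsequence by blast
  then have l: "(\<lambda>n. quad_form c \<kappa> (g (k (r n)))) \<longlonglongrightarrow> l" by (simp add: o_def)
  have vr: "(\<lambda>n. tail (g (k (r n))) x) \<longlonglongrightarrow> v x" if "x \<in> \<rat>" for x
    using LIMSEQ_subseq_LIMSEQ[OF v[OF that] r] by (simp add: o_def)
  obtain f where f: "f \<in> wL2 c" "\<And>y. y \<in> \<rat> \<Longrightarrow> tail f y = v y" "quad_form c \<kappa> f \<le> l"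
    using weak_limit[of c \<kappa> "\<lambda>n. g (k (r n))" \<rat> v l] c \<kappa> g vr l by blast
  have "(\<lambda>n. tail (g (k (r n))) x) \<longlonglongrightarrow> tail f x" for x
  proof (rule LIMSEQ_I)
    fix \<epsilon> :: real assume \<epsilon>: "0 < \<epsilon>"
    define C where "C = exp (- (c * x)) * (B + wnorm2 c f) + 1"
    have B0: "0 \<le> B" using B[of 0] wnorm2_nonneg[of c "g 0"] by linarith
    have C: "0 < C" unfolding C_def by (intro add_nonneg_pos mult_nonneg_nonneg add_nonneg_nonneg B0 wnorm2_nonneg) auto
    have "x < x + (\<epsilon> / 3)\<^sup>2 / C" using \<epsilon> C by simp
    then obtain y where y: "y \<in> \<rat>" "x < y" "y < x + (\<epsilon> / 3)\<^sup>2 / C" using Rats_dense_in_real by blast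
    have H: "norm (tail h y - tail h x) < \<epsilon> / 3" if "h \<in> wL2 c" "wnorm2 c h \<le> B + wnorm2 c f" for h :: "real \<Rightarrow> 'a"
    proof -
      have "(norm (tail h y - tail h x))\<^sup>2 \<le> (y - x) * exp (- (c * x)) * wnorm2 c h"
        using tail_Hoelder[OF c that(1), of y x] y(2) by (simp add: min_def)
      also have "\<dots> \<le> (y - x) * (exp (- (c * x)) * (B + wnorm2 c f))"
        using y(2) that(2) by (simp add: mult.assoc mult_left_mono)
      also have "\<dots> \<le> (y - x) * C" using y(2) by (intro mult_left_mono) (auto simp: C_def)
      also have "\<dots> < (\<epsilon> / 3)\<^sup>2" using y(3) C by (simp add: field_simps)
      finally show ?thesis using \<epsilon> by (intro power2_less_imp_less[of _ "\<epsilon> / 3"]) auto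
    qed
    obtain M where M: "\<And>n. n \<ge> M \<Longrightarrow> norm (tail (g (k (r n))) y - tail f y) < \<epsilon> / 3"
      using LIMSEQ_D[OF vr[OF y(1)], of "\<epsilon> / 3"] \<epsilon> f(2)[OF y(1)] by auto
    have "norm (tail (g (k (r n))) x - tail f x) < \<epsilon>" if "n \<ge> M" for n
    proof -
      have 1: "norm (tail (g (k (r n))) y - tail (g (k (r n))) x) < \<epsilon> / 3"
        using B[of "k (r n)"] wnorm2_nonneg[of c f] by (intro H g) linarith
      have 2: "norm (tail f y - tail f x) < \<epsilon> / 3" using B0 by (intro H f) linarith
      have eq: "tail (g (k (r n))) x - tail f x =
          (tail (g (k (r n))) y - tail f y) - (tail (g (k (r n))) y - tail (g (k (r n))) x) + (tail f y - tail f x)"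
        by simp
      have "norm (tail (g (k (r n))) x - tail f x) \<le>
          norm (tail (g (k (r n))) y - tail f y) + norm (tail (g (k (r n))) y - tail (g (k (r n))) x) + norm (tail f y - tail f x)"
        unfolding eq using norm_triangle_ineq[of "(tail (g (k (r n))) y - tail f y) - (tail (g (k (r n))) y - tail (g (k (r n))) x)" "tail f y - tail f x"]
          norm_triangle_ineq4[of "tail (g (k (r n))) y - tail f y" "tail (g (k (r n))) y - tail (g (k (r n))) x"]
        by argo
      then show ?thesis using 1 2 M[OF that] by linarith
    qed
    then show "\<exists>no. \<forall>n\<ge>no. norm (tail (g (k (r n))) x - tail f x) < \<epsilon>" by blast
  qed
  then show thesis
    using that[of "k \<circ> r" f l] strict_mono_o[OF k(1) r] f l by (simp add: o_def)
qed

section \<open>The minimizer at the threshold speed\<close>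

lemma tail_tendsto_zero:
  assumes c: "0 < c" and g: "g \<in> wL2 c"
  shows "((\<lambda>x. norm (tail g x)) \<longlongrightarrow> 0) at_top"
proof -
  have "((\<lambda>x. exp (- (c * x))) \<longlongrightarrow> 0) at_top" using c by real_asymp
  then have "((\<lambda>x. exp (- (c * x)) / c * wnorm2 c g) \<longlongrightarrow> 0 / c * wnorm2 c g) at_top"
    by (intro tendsto_intros) (use c in auto)
  then have L: "((\<lambda>x. exp (- (c * x)) / c * wnorm2 c g) \<longlongrightarrow> 0) at_top" by simp
  have "((\<lambda>x. (norm (tail g x))\<^sup>2) \<longlongrightarrow> 0) at_top"
    by (rule tendsto_sandwich[OF _ _ tendsto_const L];
        intro always_eventually allI norm_tail_le[OF c g] zero_le_power2)
  then have "((\<lambda>x. sqrt ((norm (tail g x))\<^sup>2)) \<longlongrightarrow> sqrt 0) at_top" by (rule tendsto_real_sqrt)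
  then show ?thesis by simp
qed

context potential
begin

text \<open>A profile that stays in the ball of radius \<open>\<delta>\<close>, where \<open>V u \<ge> - \<kappa> |u - e|\<^sup>2 / 2\<close>, has nonnegative energy by Hardy's
  inequality, even with the kinetic term multiplied by \<open>l\<^sup>2\<close>. So a profile of negative energy leaves the
  ball, and since it tends to \<open>e\<close> there is a last time \<open>t\<close> at which it is not inside; translating by \<open>t\<close> only multiplies
  the energy by a positive factor.\<close>

lemma last_exit:
  assumes c: "0 < c" and g: "g \<in> wL2 c" and i: "integrable lborel (\<lambda>x. exp (c * x) * V (e + tail g x))"
    and neg: "l\<^sup>2 * wnorm2 c g / 2 + (LINT x|lborel. exp (c * x) * V (e + tail g x)) < 0"
    and \<kappa>: "0 \<le> \<kappa>" "4 * \<kappa> / c\<^sup>2 \<le> l\<^sup>2" and \<delta>: "0 < \<delta>"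
    and near: "\<And>u. norm (u - e) \<le> \<delta> \<Longrightarrow> - \<kappa> * (norm (u - e))\<^sup>2 / 2 \<le> V u"
  obtains h where "h \<in> wL2 c" "integrable lborel (\<lambda>x. exp (c * x) * V (e + tail h x))"
    "l\<^sup>2 * wnorm2 c h / 2 + (LINT x|lborel. exp (c * x) * V (e + tail h x)) < 0"
    "\<delta> \<le> norm (tail h 0)" "\<And>x. 0 < x \<Longrightarrow> norm (tail h x) \<le> \<delta>"
proof -
  define S where "S = {x. \<delta> \<le> norm (tail g x)}"
  have ne: "S \<noteq> {}"
  proof
    assume "S = {}"
    then have le: "norm (tail g x) \<le> \<delta>" for x unfolding S_def by (metis (no_types, lifting) empty_iff linear mem_Collect_eq)
    have "- \<kappa> / 2 * wnorm2 c (tail g) = (LINT x|lborel. - \<kappa> / 2 * (exp (c * x) * (norm (tail g x))\<^sup>2))"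
      by (simp add: wnorm2_def)
    also have "\<dots> \<le> (LINT x|lborel. exp (c * x) * V (e + tail g x))"
    proof (rule integral_mono[OF _ i])
      show "integrable lborel (\<lambda>x. - \<kappa> / 2 * (exp (c * x) * (norm (tail g x))\<^sup>2))"
        using wL2_integrable[OF hardy(1)[OF c g]] by (intro integrable_mult_right) simp
      show "- \<kappa> / 2 * (exp (c * x) * (norm (tail g x))\<^sup>2) \<le> exp (c * x) * V (e + tail g x)" for x
        using mult_left_mono[OF near[of "e + tail g x"], of "exp (c * x)"] le[of x] by (simp add: algebra_simps)
    qed
    finally have 1: "- \<kappa> / 2 * wnorm2 c (tail g) \<le> (LINT x|lborel. exp (c * x) * V (e + tail g x))" .
    have "\<kappa> * wnorm2 c (tail g) \<le> \<kappa> * (4 / c\<^sup>2 * wnorm2 c g)"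
      by (intro mult_left_mono hardy(2)[OF c g] \<kappa>(1))
    also have "\<dots> = (4 * \<kappa> / c\<^sup>2) * wnorm2 c g" by simp
    also have "\<dots> \<le> l\<^sup>2 * wnorm2 c g" by (intro mult_right_mono \<kappa>(2) wnorm2_nonneg)
    finally show False using 1 neg by simp
  qed
  have bdd: "bdd_above S"
  proof -
    have "\<forall>\<^sub>F x in at_top. norm (tail g x) < \<delta>"
      using order_tendstoD(2)[OF tail_tendsto_zero[OF c g] \<delta>] .
    then obtain X where "\<And>x. x \<ge> X \<Longrightarrow> norm (tail g x) < \<delta>" by (auto simp: eventually_at_top_linorder)
    then show ?thesis unfolding S_def by (intro bdd_aboveI[of _ X]) (auto, meson le_cases not_less)
  qed
  have cl: "closed S" unfolding S_def
    by (intro closed_Collect_le continuous_intros continuous_tail[OF c g])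
  define t where "t = Sup S"
  have tS: "t \<in> S" unfolding t_def by (rule closed_contains_Sup[OF ne bdd cl])
  have after: "norm (tail g x) \<le> \<delta>" if "t < x" for x
  proof -
    have "x \<notin> S" using cSup_upper[OF _ bdd, of x] that unfolding t_def by auto
    then show ?thesis by (simp add: S_def)
  qed
  define h where "h = (\<lambda>x. 1 *\<^sub>R g (t + 1 * x))"
  have th: "tail h x = tail g (t + 1 * x)" for x unfolding h_def by (rule tail_affine) simp
  show thesis
  proof (rule that[of h])
    show "h \<in> wL2 c" using wL2_affine(1)[OF zero_less_one g, of t] by (simp add: h_def)
    show "integrable lborel (\<lambda>x. exp (c * x) * V (e + tail h x))"
      using energy_affine(1)[OF zero_less_one g i, of t] by (simp add: h_def)
    have N: "wnorm2 c h = exp (- (c * t)) * wnorm2 c g"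
      using wL2_affine(2)[OF zero_less_one g, of t] by (simp add: h_def)
    have P: "(LINT x|lborel. exp (c * x) * V (e + tail h x)) = exp (- (c * t)) * (LINT x|lborel. exp (c * x) * V (e + tail g x))"
      using integral_exp_affine(1)[OF zero_less_one, of c "\<lambda>y. V (e + tail g y)" t] by (simp add: th)
    have "l\<^sup>2 * wnorm2 c h / 2 + (LINT x|lborel. exp (c * x) * V (e + tail h x))
        = exp (- (c * t)) * (l\<^sup>2 * wnorm2 c g / 2 + (LINT x|lborel. exp (c * x) * V (e + tail g x)))"
      unfolding N P by (simp add: algebra_simps)
    also have "\<dots> < 0" using neg by (simp add: mult_less_0_iff)
    finally show "l\<^sup>2 * wnorm2 c h / 2 + (LINT x|lborel. exp (c * x) * V (e + tail h x)) < 0" .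
    show "\<delta> \<le> norm (tail h 0)" using tS by (simp add: th S_def)
    show "norm (tail h x) \<le> \<delta>" if "0 < x" for x using after[of "t + x"] that by (simp add: th)
  qed
qed

text \<open>Below the threshold some energy is negative. Dilating such a profile from speed \<open>l * c\<close> to speed \<open>c\<close> leaves a
  negative energy at speed \<open>c\<close>, except that the kinetic term carries the factor \<open>l\<^sup>2\<close>.\<close>

lemma slower_profile:
  assumes c: "c = c_nl V e" and l: "0 < l" "l < 1"
  obtains g where "g \<in> wL2 c" "integrable lborel (\<lambda>x. exp (c * x) * V (e + tail g x))"
    "l\<^sup>2 * wnorm2 c g / 2 + (LINT x|lborel. exp (c * x) * V (e + tail g x)) < 0"
proof -
  have c0: "0 < c" using threshold(1) c by simp
  have "neg_energy_at V e (l * c)" using threshold(4)[of "l * c"] l c0 c by simp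
  then obtain f where f: "f \<in> wL2 (l * c)" and i: "integrable lborel (\<lambda>x. exp (l * c * x) * V (e + tail f x))"
    and neg: "wnorm2 (l * c) f / 2 + (LINT x|lborel. exp (l * c * x) * V (e + tail f x)) < 0"
    by (auto simp: neg_energy_at_def)
  have li: "0 < 1 / l" using l by simp
  have lc: "1 / l * (l * c) = c" using l by simp
  define h where "h = (\<lambda>x. (1 / l) *\<^sub>R f (0 + 1 / l * x))"
  have th: "tail h x = tail f (0 + 1 / l * x)" for x unfolding h_def by (rule tail_affine[OF li])
  note A = integral_exp_affine[OF li, of "l * c" "\<lambda>y. V (e + tail f y)" 0, unfolded lc th[symmetric]]
  have N: "wnorm2 c h = 1 / l * wnorm2 (l * c) f"
    using wL2_affine(2)[OF li f, of 0] unfolding lc by (simp add: h_def)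
  have P: "(LINT x|lborel. exp (c * x) * V (e + tail h x)) = l * (LINT x|lborel. exp (l * c * x) * V (e + tail f x))"
    using A(1) by simp
  show thesis
  proof (rule that[of h])
    show "h \<in> wL2 c" using wL2_affine(1)[OF li f, of 0] unfolding lc by (simp add: h_def)
    show "integrable lborel (\<lambda>x. exp (c * x) * V (e + tail h x))" using A(2) i by simp
    have "l\<^sup>2 * wnorm2 c h / 2 + (LINT x|lborel. exp (c * x) * V (e + tail h x))
       = l * (wnorm2 (l * c) f / 2 + (LINT x|lborel. exp (l * c * x) * V (e + tail f x)))"
      unfolding N P using l by (simp add: field_simps power2_eq_square)
    also have "\<dots> < 0" using neg l by (simp add: mult_less_0_iff)
    finally show "l\<^sup>2 * wnorm2 c h / 2 + (LINT x|lborel. exp (c * x) * V (e + tail h x)) < 0" .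
  qed
qed

text \<open>The decomposition \<open>RI\<close> splits the energy into the quadratic form, the integral of \<open>R\<close>, and the constant \<open>V m / c\<close>. Here
  \<open>R\<close> is nonnegative along the normalised sequence, by the bound near \<open>e\<close> to the right of \<open>0\<close> and by the minimum of \<open>V\<close> to the left.
  The energies of the sequence are at most \<open>(1 - l\<^sup>2) B / 2\<close>, which tends to \<open>0\<close>, so the limit has energy at most \<open>0\<close>.\<close>

lemma threshold_minimizer:
  assumes \<kappa>: "0 \<le> \<kappa>" "\<kappa> < (c_nl V e)\<^sup>2 / 4" and \<delta>: "0 < \<delta>"
    and near: "\<And>u. norm (u - e) \<le> \<delta> \<Longrightarrow> - \<kappa> * (norm (u - e))\<^sup>2 / 2 \<le> V u"
  shows "has_nontrivial_minimizer V e (c_nl V e)"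
proof -
  define c where "c = c_nl V e"
  have c: "0 < c" using threshold(1) by (simp add: c_def)
  have \<kappa>c: "\<kappa> < c\<^sup>2 / 4" using \<kappa>(2) by (simp add: c_def)
  define s where "s = 4 * \<kappa> / c\<^sup>2"
  have s: "0 \<le> s" "s < 1" using \<kappa> \<kappa>c c by (auto simp: s_def field_simps)
  \<comment> \<open>dilation factors increasing to 1 whose squares stay above (1 + s) / 2, halfway between the ratio s and 1\<close>
  define l where "l n = sqrt (1 - (1 - s) / (2 * real (Suc n)))" for n
  have l2: "(l n)\<^sup>2 = 1 - (1 - s) / (2 * real (Suc n))" and ls: "(1 + s) / 2 \<le> (l n)\<^sup>2"
    and l01: "0 < l n" "l n < 1" for n
  proof -
    have b: "(1 - s) / (2 * real (Suc n)) \<le> (1 - s) / 2"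
      using s by (intro divide_left_mono) auto
    have p: "0 < (1 - s) / (2 * real (Suc n))" using s by simp
    have q: "0 < 1 - (1 - s) / (2 * real (Suc n))" using b s by argo
    then show l2: "(l n)\<^sup>2 = 1 - (1 - s) / (2 * real (Suc n))" by (simp add: l_def)
    show "(1 + s) / 2 \<le> (l n)\<^sup>2" unfolding l2 using b by argo
    show "0 < l n" using q by (simp add: l_def)
    show "l n < 1" using p unfolding l_def by simp
  qed
  have llim: "(\<lambda>n. (l n)\<^sup>2) \<longlonglongrightarrow> 1" unfolding l2 by real_asymp
  have ex: "\<exists>h. h \<in> wL2 c \<and> integrable lborel (\<lambda>x. exp (c * x) * V (e + tail h x)) \<and>
    (l n)\<^sup>2 * wnorm2 c h / 2 + (LINT x|lborel. exp (c * x) * V (e + tail h x)) < 0 \<and>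
    \<delta> \<le> norm (tail h 0) \<and> (\<forall>x>0. norm (tail h x) \<le> \<delta>)" for n
  proof -
    obtain g where g: "g \<in> wL2 c" "integrable lborel (\<lambda>x. exp (c * x) * V (e + tail g x))"
      "(l n)\<^sup>2 * wnorm2 c g / 2 + (LINT x|lborel. exp (c * x) * V (e + tail g x)) < 0"
      using slower_profile[OF c_def l01] by blast
    have le: "4 * \<kappa> / c\<^sup>2 \<le> (l n)\<^sup>2" using ls[of n] s by (simp add: s_def[symmetric])
    show ?thesis
    proof (rule last_exit[OF c g \<kappa>(1) le \<delta>])
      show "- \<kappa> * (norm (u - e))\<^sup>2 / 2 \<le> V u" if "norm (u - e) \<le> \<delta>" for u by (rule near[OF that])
    qed blast
  qed
  from choice[OF allI[OF ex]] obtain h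
    where H: "\<forall>n. h n \<in> wL2 c \<and> integrable lborel (\<lambda>x. exp (c * x) * V (e + tail (h n) x)) \<and>
      (l n)\<^sup>2 * wnorm2 c (h n) / 2 + (LINT x|lborel. exp (c * x) * V (e + tail (h n) x)) < 0 \<and>
      \<delta> \<le> norm (tail (h n) 0) \<and> (\<forall>x>0. norm (tail (h n) x) \<le> \<delta>)" ..
  have h: "h n \<in> wL2 c" for n using spec[OF H, of n] by (elim conjE)
  have hi: "integrable lborel (\<lambda>x. exp (c * x) * V (e + tail (h n) x))" for n
    using spec[OF H, of n] by (elim conjE)
  have hneg: "(l n)\<^sup>2 * wnorm2 c (h n) / 2 + (LINT x|lborel. exp (c * x) * V (e + tail (h n) x)) < 0" for n
    using spec[OF H, of n] by (elim conjE)
  have h0: "\<delta> \<le> norm (tail (h n) 0)" for n using spec[OF H, of n] by (elim conjE)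
  have hpos: "norm (tail (h n) x) \<le> \<delta>" if "0 < x" for n x
    using spec[OF H, of n] that by (elim conjE) blast
  define R where "R f x = exp (c * x) * V (e + tail f x) + \<kappa> / 2 * (exp (c * x) * (norm (tail f x))\<^sup>2)
      - V m * (indicator {..0} x * exp (c * x))" for f :: "real \<Rightarrow> real^'d" and x
  have Ri: "integrable lborel (R f)"
    and RI: "wnorm2 c f / 2 + (LINT x|lborel. exp (c * x) * V (e + tail f x)) = quad_form c \<kappa> f + (LINT x|lborel. R f x) + V m / c"
    if f: "f \<in> wL2 c" and i: "integrable lborel (\<lambda>x. exp (c * x) * V (e + tail f x))" for f
  proof -
    note i' = i wL2_integrable[OF hardy(1)[OF c f]] exp_left_half_line(1)[OF c]
    show "integrable lborel (R f)" unfolding R_def[abs_def]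
      by (intro Bochner_Integration.integrable_diff Bochner_Integration.integrable_add integrable_mult_right i')
    have "(LINT x|lborel. R f x) = (LINT x|lborel. exp (c * x) * V (e + tail f x)) + \<kappa> / 2 * wnorm2 c (tail f) - V m * (1 / c)"
      unfolding R_def wnorm2_def exp_left_half_line(2)[OF c, symmetric]
      by (subst Bochner_Integration.integral_diff Bochner_Integration.integral_add,
          intro Bochner_Integration.integrable_diff Bochner_Integration.integrable_add integrable_mult_right i',
          intro integrable_mult_right i')+ simp
    then show "wnorm2 c f / 2 + (LINT x|lborel. exp (c * x) * V (e + tail f x)) = quad_form c \<kappa> f + (LINT x|lborel. R f x) + V m / c"
      by (simp add: quad_form_def field_simps)
  qed
  have R0: "0 \<le> R f x" if "\<And>x. 0 < x \<Longrightarrow> norm (tail f x) \<le> \<delta>" for f x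
  proof -
    have "0 \<le> V (e + tail f x) + \<kappa> / 2 * (norm (tail f x))\<^sup>2 - V m * indicator {..0} x"
    proof (cases "0 < x")
      case True
      then show ?thesis using near[of "e + tail f x"] that[OF True] by simp
    next
      case False
      moreover have "0 \<le> \<kappa> / 2 * (norm (tail f x))\<^sup>2" using \<kappa> by simp
      ultimately show ?thesis using minimal[of "e + tail f x"] by simp
    qed
    then have "0 \<le> exp (c * x) * (V (e + tail f x) + \<kappa> / 2 * (norm (tail f x))\<^sup>2 - V m * indicator {..0} x)"
      by (intro mult_nonneg_nonneg) auto
    then show ?thesis by (simp add: R_def algebra_simps)
  qed
  have Rint0: "0 \<le> (LINT x|lborel. R (h n) x)" for n
    by (intro integral_nonneg_AE AE_I2 R0 hpos)
  define B where "B = (- V m / c) / ((1 - s) / 4)"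
  have B: "wnorm2 c (h n) \<le> B" for n
  proof -
    have coe: "(1 - s) * wnorm2 c (h n) \<le> 2 * quad_form c \<kappa> (h n)"
      unfolding s_def by (rule quad_form_coercive[OF c \<kappa>(1) h])
    have "(1 + s) / 2 * wnorm2 c (h n) \<le> (l n)\<^sup>2 * wnorm2 c (h n)"
      by (intro mult_right_mono ls wnorm2_nonneg)
    then have "(1 - s) / 4 * wnorm2 c (h n) \<le> - V m / c"
      using hneg[of n] RI[OF h hi, of n] Rint0[of n] coe by (simp add: field_simps)
    then show ?thesis unfolding B_def using s by (subst pos_le_divide_eq) (auto simp: mult.commute)
  qed
  obtain r f q where r: "strict_mono (r :: nat \<Rightarrow> nat)" and f: "f \<in> wL2 c"
    and lim: "\<And>x. (\<lambda>n. tail (h (r n)) x) \<longlonglongrightarrow> tail f x"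
    and ql: "(\<lambda>n. quad_form c \<kappa> (h (r n))) \<longlonglongrightarrow> q" and qf: "quad_form c \<kappa> f \<le> q"
    using weak_compactness[of c \<kappa> h B] c \<kappa>(1) \<kappa>c h B by blast
  \<comment> \<open>the upper bound for the integral of R given by the negativity of the energy with kinetic factor (l n)^2\<close>
  define a where "a n = (1 - (l n)\<^sup>2) * B / 2 - quad_form c \<kappa> (h n) - V m / c" for n
  have Ra: "(LINT x|lborel. R (h n) x) \<le> a n" for n
  proof -
    have "(1 - (l n)\<^sup>2) * wnorm2 c (h n) \<le> (1 - (l n)\<^sup>2) * B"
      using l01[of n] by (intro mult_left_mono B) (simp add: abs_square_le_1)
    moreover have "(1 - (l n)\<^sup>2) * wnorm2 c (h n) = wnorm2 c (h n) - (l n)\<^sup>2 * wnorm2 c (h n)"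
      by (simp add: left_diff_distrib)
    ultimately show ?thesis using hneg[of n] RI[OF h hi, of n] unfolding a_def by linarith
  qed
  have "(\<lambda>n. a (r n)) \<longlonglongrightarrow> (1 - 1) * B / 2 - q - V m / c"
    unfolding a_def by (intro tendsto_intros ql LIMSEQ_subseq_LIMSEQ[OF llim r, unfolded o_def]) simp_all
  then have al: "(\<lambda>n. a (r n)) \<longlonglongrightarrow> - q - V m / c" by simp
  have a0: "0 \<le> - q - V m / c"
    by (rule LIMSEQ_le_const[OF al]) (use Rint0 Ra order_trans in blast)
  note [measurable] = measurable_tail[OF c f] measurable_tail[OF c h]
  have Rm[measurable]: "R f \<in> borel_measurable borel" "R (h n) \<in> borel_measurable borel" for n
    unfolding R_def[abs_def] by measurable
  have Rlim: "(\<lambda>n. R (h (r n)) x) \<longlonglongrightarrow> R f x" for x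
  proof -
    have "(\<lambda>n. V (e + tail (h (r n)) x)) \<longlonglongrightarrow> V (e + tail f x)"
      by (rule continuous_on_tendsto_compose[OF continuous]) (auto intro!: tendsto_intros lim)
    then show ?thesis unfolding R_def by (intro tendsto_intros lim)
  qed
  have Rf0: "0 \<le> R f x" for x
    by (rule LIMSEQ_le_const[OF Rlim]) (use R0 hpos in blast)
  have "(\<integral>\<^sup>+x. ennreal (R f x) \<partial>lborel) = (\<integral>\<^sup>+x. liminf (\<lambda>n. ennreal (R (h (r n)) x)) \<partial>lborel)"
    by (intro nn_integral_cong lim_imp_Liminf[symmetric] tendsto_ennrealI Rlim) simp
  also have "\<dots> \<le> liminf (\<lambda>n. \<integral>\<^sup>+x. ennreal (R (h (r n)) x) \<partial>lborel)"
    by (rule nn_integral_liminf) measurable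
  also have "\<dots> \<le> liminf (\<lambda>n. ennreal (a (r n)))"
  proof (intro Liminf_mono always_eventually allI)
    fix n
    have "(\<integral>\<^sup>+x. ennreal (R (h (r n)) x) \<partial>lborel) = ennreal (LINT x|lborel. R (h (r n)) x)"
      by (intro nn_integral_eq_integral Ri h hi AE_I2 R0 hpos)
    then show "(\<integral>\<^sup>+x. ennreal (R (h (r n)) x) \<partial>lborel) \<le> ennreal (a (r n))" using Ra by (simp add: ennreal_leI)
  qed
  also have "\<dots> = ennreal (- q - V m / c)"
    by (intro lim_imp_Liminf tendsto_ennrealI al) simp
  finally have Rb: "(\<integral>\<^sup>+x. ennreal (R f x) \<partial>lborel) \<le> ennreal (- q - V m / c)" .
  have RfI: "integrable lborel (R f)"
  proof (rule integrableI_nonneg)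
    show "(\<integral>\<^sup>+x. ennreal (R f x) \<partial>lborel) < \<infinity>" using Rb by (simp add: le_less_trans)
  qed (use Rf0 in auto)
  have "ennreal (LINT x|lborel. R f x) \<le> ennreal (- q - V m / c)"
    using Rb nn_integral_eq_integral[OF RfI] Rf0 by simp
  then have RfL: "(LINT x|lborel. R f x) \<le> - q - V m / c" using a0 by simp
  have "integrable lborel (\<lambda>x. R f x - \<kappa> / 2 * (exp (c * x) * (norm (tail f x))\<^sup>2) + V m * (indicator {..0} x * exp (c * x)))"
    by (intro Bochner_Integration.integrable_diff Bochner_Integration.integrable_add integrable_mult_right RfI
        wL2_integrable[OF hardy(1)[OF c f]] exp_left_half_line(1)[OF c])
  then have fi: "integrable lborel (\<lambda>x. exp (c * x) * V (e + tail f x))" by (simp add: R_def)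
  have "wnorm2 c f / 2 + (LINT x|lborel. exp (c * x) * V (e + tail f x)) \<le> 0"
    using RI[OF f fi] RfL qf by simp
  moreover have "tail f 0 \<noteq> 0"
  proof -
    have "\<delta> \<le> norm (tail f 0)"
      by (rule LIMSEQ_le_const[OF tendsto_norm[OF lim]]) (use h0 in blast)
    then show ?thesis using \<delta> by auto
  qed
  moreover have "\<not> neg_energy_at V e c" using threshold(4)[OF c] by (simp add: c_def)
  ultimately show ?thesis
    using f fi nontrivial_minimizer_iff[OF c] unfolding c_def by blast
qed

text \<open>Otherwise \<open>V u + c\<^sup>2 / 8 |u - e|\<^sup>2\<close> is nonnegative everywhere. Integrated along the minimizer it is at most the
  energy, by Hardy's inequality, hence zero; by continuity it vanishes at every point. But the primitive
  tends to zero, so it takes a small nonzero value, where the function is positive because \<open>\<kappa> < c\<^sup>2 / 4\<close>.\<close>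

lemma threshold_less:
  assumes \<kappa>: "\<kappa> < (c_nl V e)\<^sup>2 / 4" and \<delta>: "0 < \<delta>"
    and near: "\<And>u. norm (u - e) \<le> \<delta> \<Longrightarrow> - \<kappa> * (norm (u - e))\<^sup>2 / 2 \<le> V u"
    and \<mu>: "\<And>u. \<mu> * (norm (u - e))\<^sup>2 / 2 \<le> V u"
    and min: "has_nontrivial_minimizer V e (c_nl V e)"
  shows "c_nl V e < 2 * sqrt (- \<mu>)"
proof (rule ccontr)
  assume not_less: "\<not> ?thesis"
  define c where "c = c_nl V e"
  have c: "0 < c" using threshold(1) by (simp add: c_def)
  have "- \<mu> \<le> c\<^sup>2 / 4"
  proof (rule ccontr)
    assume "\<not> ?thesis"
    then have "(c / 2)\<^sup>2 < - \<mu>" by (simp add: power_divide)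
    then have "c / 2 < sqrt (- \<mu>)" by (rule real_less_rsqrt)
    then show False using not_less by (simp add: c_def)
  qed
  then have ge: "0 \<le> V u + c\<^sup>2 / 8 * (norm (u - e))\<^sup>2" for u
  proof -
    have "- (c\<^sup>2 / 4) * (norm (u - e))\<^sup>2 \<le> \<mu> * (norm (u - e))\<^sup>2"
      by (rule mult_right_mono) (use \<open>- \<mu> \<le> c\<^sup>2 / 4\<close> in auto)
    then show ?thesis using \<mu>[of u] by simp
  qed
  obtain g x1 where g: "g \<in> wL2 c" and i: "integrable lborel (\<lambda>x. exp (c * x) * V (e + tail g x))"
    and E: "wnorm2 c g / 2 + (LINT x|lborel. exp (c * x) * V (e + tail g x)) \<le> 0" and x1: "tail g x1 \<noteq> 0"
    using min nontrivial_minimizer_iff[OF c] unfolding c_def by blast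
  define p where "p x = exp (c * x) * V (e + tail g x) + c\<^sup>2 / 8 * (exp (c * x) * (norm (tail g x))\<^sup>2)" for x
  have peq: "p x = exp (c * x) * (V (e + tail g x) + c\<^sup>2 / 8 * (norm (tail g x))\<^sup>2)" for x
    by (simp add: p_def algebra_simps)
  have p0: "0 \<le> p x" for x unfolding peq using ge[of "e + tail g x"] by (intro mult_nonneg_nonneg) auto
  note ti = wL2_integrable[OF hardy(1)[OF c g]]
  have pi: "integrable lborel p" unfolding p_def[abs_def]
    by (intro Bochner_Integration.integrable_add integrable_mult_right i ti)
  have "(LINT x|lborel. p x) = (LINT x|lborel. exp (c * x) * V (e + tail g x)) + c\<^sup>2 / 8 * wnorm2 c (tail g)"
    unfolding p_def wnorm2_def using i ti by simp
  moreover have "c\<^sup>2 / 8 * wnorm2 c (tail g) \<le> wnorm2 c g / 2"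
    using hardy(2)[OF c g] c by (simp add: field_simps)
  ultimately have "(LINT x|lborel. p x) \<le> 0" using E by linarith
  then have "(LINT x|lborel. p x) = 0" using integral_nonneg_AE[where f = p and M = lborel] p0 by (simp add: antisym)
  then have ae: "AE x in lborel. p x = 0" using integral_nonneg_eq_0_iff_AE[OF pi] p0 by simp
  have cont: "continuous_on UNIV p" unfolding p_def[abs_def]
    by (intro continuous_intros continuous_tail[OF c g] continuous_on_compose2[OF continuous]) auto
  have pz: "p x = 0" for x by (rule AE_const_continuous[OF cont ae])
  define y where "y = min \<delta> (norm (tail g x1))"
  have y: "0 < y" "y \<le> \<delta>" using \<delta> x1 by (auto simp: y_def)
  obtain X where X: "\<And>x. x \<ge> X \<Longrightarrow> norm (tail g x) < y"
    using order_tendstoD(2)[OF tail_tendsto_zero[OF c g] y(1)] by (auto simp: eventually_at_top_linorder)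
  have "\<exists>x. x1 \<le> x \<and> x \<le> max x1 X \<and> norm (tail g x) = y"
    by (rule IVT2'[of "\<lambda>x. norm (tail g x)"])
       (use X[of "max x1 X"] in \<open>auto simp: y_def less_imp_le intro!: continuous_intros continuous_on_subset[OF continuous_tail[OF c g]]\<close>)
  then obtain x where x: "norm (tail g x) = y" by blast
  have "- \<kappa> * y\<^sup>2 / 2 \<le> V (e + tail g x)" using near[of "e + tail g x"] x y by simp
  moreover have "\<kappa> * y\<^sup>2 < c\<^sup>2 / 4 * y\<^sup>2" using \<kappa> y by (simp add: c_def)
  ultimately have "0 < V (e + tail g x) + c\<^sup>2 / 8 * (norm (tail g x))\<^sup>2" using x by simp
  then have "0 < p x" unfolding peq by simp
  then show False using pz by simp
qed

end

section \<open>The potential near the critical point\<close>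

lemma grad_has_derivative:
  fixes V :: "real^'d \<Rightarrow> real"
  assumes "V differentiable (at u)"
  shows "(V has_derivative (\<lambda>h. grad V u \<bullet> h)) (at u)"
proof -
  obtain D where D: "(V has_derivative D) (at u)" using assms by (auto simp: differentiable_def)
  interpret D: bounded_linear D using D by (rule has_derivative_bounded_linear)
  define g where "g = (\<Sum>b\<in>Basis. D b *\<^sub>R b)"
  have "D h = g \<bullet> h" for h
  proof -
    have "D h = D (\<Sum>b\<in>Basis. (h \<bullet> b) *\<^sub>R b)" by (simp add: euclidean_representation)
    also have "\<dots> = (\<Sum>b\<in>Basis. (h \<bullet> b) * D b)" by (simp add: D.sum D.scaleR)
    also have "\<dots> = g \<bullet> h" by (simp add: g_def inner_sum_left inner_commute[of h] mult.commute)
    finally show ?thesis .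
  qed
  then have "D = (\<lambda>h. h \<bullet> g)" by (simp add: fun_eq_iff inner_commute)
  then have g: "GDERIV V u :> g" using D by (simp add: gderiv_def)
  have "grad V u = g" unfolding grad_def
  proof (rule the_equality[where P="\<lambda>g. GDERIV V u :> g"])
    fix g' assume "GDERIV V u :> g'"
    then have "(\<lambda>h. h \<bullet> g') = (\<lambda>h. h \<bullet> g)"
      using g unfolding gderiv_def by (rule has_derivative_unique)
    then have "h \<bullet> (g' - g) = 0" for h by (simp add: inner_diff_right fun_eq_iff)
    then show "g' = g" by (metis inner_eq_zero_iff right_minus_eq)
  qed (rule g)
  then show ?thesis using g by (simp add: gderiv_def inner_commute)
qed

lemma line_derivative:
  fixes V :: "real^'d \<Rightarrow> real"
  assumes "\<And>u. V differentiable (at u)"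
  shows "((\<lambda>s. V (p + s *\<^sub>R a)) has_real_derivative grad V (p + s *\<^sub>R a) \<bullet> a) (at s)"
proof -
  have "((\<lambda>s. p + s *\<^sub>R a) has_derivative (\<lambda>h. h *\<^sub>R a)) (at s)"
    by (auto intro!: derivative_eq_intros)
  from has_derivative_compose[OF this grad_has_derivative[OF assms]]
  show ?thesis by (simp add: has_field_derivative_def mult_commute_abs)
qed

lemma grad_expansion:
  fixes V :: "real^'d \<Rightarrow> real"
  assumes "grad V differentiable (at e)" "grad V e = 0" "0 < \<epsilon>"
  obtains \<delta> where "0 < \<delta>" "\<And>h. norm h \<le> \<delta> \<Longrightarrow> norm (grad V (e + h) - hessian V e *v h) \<le> \<epsilon> * norm h"
proof -
  have "(grad V has_derivative (\<lambda>h. hessian V e *v h)) (at e)"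
    using assms(1) unfolding hessian_def by (simp add: jacobian_works)
  then obtain d where d: "0 < d" "\<And>y. norm (y - e) < d \<Longrightarrow> norm (grad V y - grad V e - hessian V e *v (y - e)) \<le> \<epsilon> * norm (y - e)"
    using assms(3) unfolding has_derivative_at_alt by blast
  show thesis
  proof (rule that[of "d / 2"])
    show "norm (grad V (e + h) - hessian V e *v h) \<le> \<epsilon> * norm h" if "norm h \<le> d / 2" for h
      using d(2)[of "e + h"] d(1) that assms(2) by simp
  qed (use d in auto)
qed

text \<open>The mean value theorem in direction \<open>a\<close>, followed by the first-order expansion of the gradient at \<open>e\<close>.\<close>

lemma second_difference:
  fixes V :: "real^'d \<Rightarrow> real"
  assumes V: "\<And>u. V differentiable (at u)" and \<delta>: "\<And>h. norm h \<le> \<delta> \<Longrightarrow> norm (grad V (e + h) - H *v h) \<le> \<epsilon> * norm h"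
    and t: "0 < t" "t * (norm a + norm b) \<le> \<delta>" and \<epsilon>: "0 \<le> \<epsilon>"
  shows "\<bar>(V (e + t *\<^sub>R a + t *\<^sub>R b) - V (e + t *\<^sub>R a) - V (e + t *\<^sub>R b) + V e) - t\<^sup>2 * ((H *v b) \<bullet> a)\<bar>
    \<le> 2 * \<epsilon> * t\<^sup>2 * (norm a + norm b)\<^sup>2"
proof -
  define \<phi> where "\<phi> s = V ((e + t *\<^sub>R b) + s *\<^sub>R a) - V (e + s *\<^sub>R a)" for s
  have "(\<phi> has_real_derivative (grad V ((e + t *\<^sub>R b) + s *\<^sub>R a) \<bullet> a - grad V (e + s *\<^sub>R a) \<bullet> a)) (at s)" for s
    unfolding \<phi>_def[abs_def] by (intro DERIV_diff line_derivative V)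
  from MVT2[OF t(1) this] obtain s where s: "0 < s" "s < t"
    and eq: "\<phi> t - \<phi> 0 = (t - 0) * (grad V ((e + t *\<^sub>R b) + s *\<^sub>R a) \<bullet> a - grad V (e + s *\<^sub>R a) \<bullet> a)"
    by auto
  define h1 where "h1 = t *\<^sub>R b + s *\<^sub>R a"
  define h2 where "h2 = s *\<^sub>R a"
  have sa: "s * norm a \<le> t * norm a" using s by (intro mult_right_mono) auto
  have "norm h1 \<le> t * norm b + s * norm a"
    unfolding h1_def using norm_triangle_ineq[of "t *\<^sub>R b" "s *\<^sub>R a"] s t by simp
  then have h1: "norm h1 \<le> t * (norm a + norm b)" using sa by (simp add: algebra_simps)
  have tb: "0 \<le> t * norm b" using t by simp
  have "norm h2 = s * norm a" using s by (simp add: h2_def)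
  then have h2: "norm h2 \<le> t * (norm a + norm b)" using sa tb unfolding distrib_left by linarith
  define r1 where "r1 = grad V (e + h1) - H *v h1"
  define r2 where "r2 = grad V (e + h2) - H *v h2"
  have r: "norm r1 \<le> \<epsilon> * (t * (norm a + norm b))" "norm r2 \<le> \<epsilon> * (t * (norm a + norm b))"
    using \<delta>[of h1] \<delta>[of h2] h1 h2 t(2) mult_left_mono[OF h1 \<epsilon>] mult_left_mono[OF h2 \<epsilon>]
    by (auto simp: r1_def r2_def)
  have "H *v h1 - H *v h2 = t *\<^sub>R (H *v b)"
    by (simp add: h1_def h2_def matrix_vector_right_distrib matrix_vector_mult_scaleR)
  then have g: "grad V (e + h1) - grad V (e + h2) = t *\<^sub>R (H *v b) + (r1 - r2)"
    by (simp add: r1_def r2_def algebra_simps)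
  have "\<phi> t - \<phi> 0 = t * ((grad V (e + h1) - grad V (e + h2)) \<bullet> a)"
    using eq by (simp add: h1_def h2_def inner_diff_left add.assoc)
  then have "\<phi> t - \<phi> 0 - t\<^sup>2 * ((H *v b) \<bullet> a) = t * ((r1 - r2) \<bullet> a)"
    unfolding g by (simp add: inner_add_left power2_eq_square algebra_simps)
  moreover have "\<bar>t * ((r1 - r2) \<bullet> a)\<bar> \<le> t * ((\<epsilon> * (t * (norm a + norm b)) + \<epsilon> * (t * (norm a + norm b))) * (norm a + norm b))"
  proof -
    have "norm (r1 - r2) \<le> \<epsilon> * (t * (norm a + norm b)) + \<epsilon> * (t * (norm a + norm b))"
      using r norm_triangle_ineq4[of r1 r2] by linarith
    then have "norm (r1 - r2) * norm a \<le> (\<epsilon> * (t * (norm a + norm b)) + \<epsilon> * (t * (norm a + norm b))) * (norm a + norm b)"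
      using t \<epsilon> by (intro mult_mono) auto
    then have "\<bar>(r1 - r2) \<bullet> a\<bar> \<le> (\<epsilon> * (t * (norm a + norm b)) + \<epsilon> * (t * (norm a + norm b))) * (norm a + norm b)"
      using Cauchy_Schwarz_ineq2[of "r1 - r2" a] by linarith
    then show ?thesis using t by (simp add: abs_mult mult_left_mono)
  qed
  moreover have "t * ((\<epsilon> * (t * (norm a + norm b)) + \<epsilon> * (t * (norm a + norm b))) * (norm a + norm b)) = 2 * \<epsilon> * t\<^sup>2 * (norm a + norm b)\<^sup>2"
    by (simp add: power2_eq_square algebra_simps)
  moreover have "\<phi> t - \<phi> 0 = V (e + t *\<^sub>R a + t *\<^sub>R b) - V (e + t *\<^sub>R a) - V (e + t *\<^sub>R b) + V e"
    by (simp add: \<phi>_def algebra_simps)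
  ultimately show ?thesis by metis
qed

text \<open>The second difference is symmetric in \<open>a\<close> and \<open>b\<close>; divided by \<open>t\<^sup>2\<close> it tends to both sides.\<close>

lemma hessian_symmetric:
  fixes V :: "real^'d \<Rightarrow> real"
  assumes V: "\<And>u. V differentiable (at u)" and "grad V differentiable (at e)" "grad V e = 0"
  shows "(hessian V e *v a) \<bullet> b = (hessian V e *v b) \<bullet> a"
proof -
  let ?H = "hessian V e"
  let ?x = "\<bar>(?H *v a) \<bullet> b - (?H *v b) \<bullet> a\<bar>"
  have "?x \<le> \<eta>" if \<eta>: "0 < \<eta>" for \<eta>
  proof -
    define K where "K = (norm a + norm b)\<^sup>2 + 1"
    have K: "0 < K" by (simp add: K_def add_nonneg_pos)
    define \<epsilon> where "\<epsilon> = \<eta> / (4 * K)"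
    have \<epsilon>: "0 < \<epsilon>" using \<eta> K by (simp add: \<epsilon>_def)
    obtain \<delta> where \<delta>: "0 < \<delta>" "\<And>h. norm h \<le> \<delta> \<Longrightarrow> norm (grad V (e + h) - ?H *v h) \<le> \<epsilon> * norm h"
      using grad_expansion[OF assms(2,3) \<epsilon>] by blast
    define t where "t = \<delta> / (norm a + norm b + 1)"
    have p: "0 < norm a + norm b + 1" by (simp add: add_nonneg_pos)
    have t: "0 < t" "t * (norm a + norm b) \<le> \<delta>"
      using \<delta>(1) p by (auto simp: t_def field_simps)
    note S = second_difference[OF V \<delta>(2) t less_imp_le[OF \<epsilon>]]
    have t': "t * (norm b + norm a) \<le> \<delta>" using t(2) by (simp add: add.commute)
    note S' = second_difference[OF V \<delta>(2) t(1) t' less_imp_le[OF \<epsilon>]]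
    have c: "e + t *\<^sub>R b + t *\<^sub>R a = e + t *\<^sub>R a + t *\<^sub>R b" by simp
    have "\<bar>t\<^sup>2 * ((?H *v a) \<bullet> b) - t\<^sup>2 * ((?H *v b) \<bullet> a)\<bar> \<le> 4 * \<epsilon> * t\<^sup>2 * (norm a + norm b)\<^sup>2"
      using S S' unfolding c add.commute[of "norm b" "norm a"] by linarith
    also have "\<dots> \<le> 4 * \<epsilon> * t\<^sup>2 * K" using \<epsilon> by (intro mult_left_mono) (auto simp: K_def)
    also have "\<dots> = t\<^sup>2 * \<eta>" using K by (simp add: \<epsilon>_def)
    finally have "t\<^sup>2 * ?x \<le> t\<^sup>2 * \<eta>"
      by (simp add: right_diff_distrib[symmetric] abs_mult)
    then show ?thesis using t(1) by simp
  qed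
  then have "?x \<le> 0" by (meson dense_ge)
  then show ?thesis by simp
qed

text \<open>The minimum \<open>k\<close> of the quadratic form on the unit sphere is an eigenvalue: with \<open>z = H v0 - k v0\<close>, the
  nonnegative function \<open>q - k |\<cdot>|\<^sup>2\<close> vanishes at \<open>v0\<close> and has slope \<open>2 |z|\<^sup>2\<close> there in direction \<open>z\<close>, so \<open>z = 0\<close>. It is the
  least eigenvalue because the form equals \<open>k' |v|\<^sup>2\<close> at an eigenvector for \<open>k'\<close>.\<close>

lemma mu1_le_quadratic_form:
  fixes V :: "real^'d \<Rightarrow> real"
  assumes sym: "\<And>a b. (hessian V e *v a) \<bullet> b = (hessian V e *v b) \<bullet> a"
  shows "mu1 V e * (norm v)\<^sup>2 \<le> (hessian V e *v v) \<bullet> v"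
proof -
  let ?H = "hessian V e"
  define q where "q v = (?H *v v) \<bullet> v" for v
  have cont: "continuous_on (sphere 0 1) q" unfolding q_def
    by (intro continuous_intros matrix_vector_mult_linear_continuous_on)
  have "sphere (0::real^'d) 1 \<noteq> {}" by simp
  then obtain v0 where v0: "v0 \<in> sphere 0 1" and min: "\<And>v. v \<in> sphere 0 1 \<Longrightarrow> q v0 \<le> q v"
    using continuous_attains_inf[OF compact_sphere _ cont] by blast
  define k where "k = q v0"
  have n0: "norm v0 = 1" using v0 by simp
  have qk: "k * (norm v)\<^sup>2 \<le> q v" for v
  proof (cases "v = 0")
    case False
    have "k \<le> q ((1 / norm v) *\<^sub>R v)" unfolding k_def by (rule min) (use False in simp)
    also have "\<dots> = q v / (norm v)\<^sup>2"
      by (simp add: q_def matrix_vector_mult_scaleR power2_eq_square)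
    finally show ?thesis using False by (simp add: field_simps)
  qed (simp add: q_def)
  have "?H *v v0 = k *\<^sub>R v0"
  proof -
    define z where "z = ?H *v v0 - k *\<^sub>R v0"
    have exp: "q (v0 + s *\<^sub>R z) - k * (norm (v0 + s *\<^sub>R z))\<^sup>2 = 2 * s * (norm z)\<^sup>2 + s\<^sup>2 * (q z - k * (norm z)\<^sup>2)" for s
    proof -
      have 1: "q (v0 + s *\<^sub>R z) = q v0 + 2 * s * ((?H *v v0) \<bullet> z) + s\<^sup>2 * q z"
        using sym[of z v0] by (simp add: q_def matrix_vector_right_distrib matrix_vector_mult_scaleR
            inner_add_left inner_add_right power2_eq_square algebra_simps)
      have 2: "(norm (v0 + s *\<^sub>R z))\<^sup>2 = (norm v0)\<^sup>2 + 2 * s * (v0 \<bullet> z) + s\<^sup>2 * (norm z)\<^sup>2"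
        by (simp only: power2_norm_eq_inner inner_add_left inner_add_right inner_scaleR_left
            inner_scaleR_right inner_commute[of z v0]) (simp add: power2_eq_square algebra_simps)
      have "(norm z)\<^sup>2 = (?H *v v0) \<bullet> z - k * (v0 \<bullet> z)"
        unfolding power2_norm_eq_inner by (subst (1) z_def) (simp add: inner_diff_left)
      then have 3: "(?H *v v0) \<bullet> z = (norm z)\<^sup>2 + k * (v0 \<bullet> z)" by simp
      show ?thesis unfolding 1 2 3 n0 k_def[symmetric] by (simp add: algebra_simps)
    qed
    have pos: "0 \<le> 2 * s * (norm z)\<^sup>2 + s\<^sup>2 * (q z - k * (norm z)\<^sup>2)" for s
      using qk[of "v0 + s *\<^sub>R z"] unfolding exp[symmetric] by simp
    have "(norm z)\<^sup>2 = 0"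
    proof (rule ccontr)
      assume "(norm z)\<^sup>2 \<noteq> 0"
      then have zp: "0 < (norm z)\<^sup>2" by simp
      define w where "w = q z - k * (norm z)\<^sup>2"
      have w: "0 \<le> w" using qk[of z] by (simp add: w_def)
      \<comment> \<open>small enough for the quadratic term in s to be dominated by the linear one\<close>
      define s where "s = (norm z)\<^sup>2 / (w + 1)"
      have s: "0 < s" using zp w by (simp add: s_def)
      have "0 \<le> 2 * (- s) * (norm z)\<^sup>2 + (- s)\<^sup>2 * w" using pos[of "- s"] by (simp add: w_def)
      then have "s * (2 * (norm z)\<^sup>2) \<le> s * (s * w)" by (simp add: power2_eq_square mult_ac)
      then have "2 * (norm z)\<^sup>2 \<le> s * w" using s by simp
      moreover have "s * w \<le> (norm z)\<^sup>2" using w zp by (simp add: s_def field_simps)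
      ultimately show False using zp by simp
    qed
    then show ?thesis by (simp add: z_def)
  qed
  moreover have "v0 \<noteq> 0" using n0 by auto
  ultimately have ev: "is_eigenvalue ?H k" by (auto simp: is_eigenvalue_def)
  have least: "k \<le> k'" if ev': "is_eigenvalue ?H k'" for k'
  proof -
    obtain v where v: "v \<noteq> 0" "?H *v v = k' *\<^sub>R v" using ev' by (auto simp: is_eigenvalue_def)
    then have "k * (norm v)\<^sup>2 \<le> k' * (norm v)\<^sup>2"
      using qk[of v] by (simp add: q_def power2_norm_eq_inner)
    then show ?thesis using v(1) by simp
  qed
  have "mu1 V e = k" unfolding mu1_def by (rule Least_equality) (use ev least in auto)
  then show ?thesis using qk[of v] by (simp add: q_def)
qed

text \<open>Along a ray from \<open>e\<close> the derivative of \<open>V\<close> dominates that of \<open>k s\<^sup>2 |v|\<^sup>2 / 2\<close>, by the expansion of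
  the gradient with error \<open>mu1 V e - k\<close>.\<close>

lemma potential_near_critical_point:
  fixes V :: "real^'d \<Rightarrow> real"
  assumes V: "\<And>u. V differentiable (at u)" and "grad V differentiable (at e)" "grad V e = 0" "V e = 0"
    and k: "k < mu1 V e"
  obtains \<delta> where "0 < \<delta>" "\<And>u. norm (u - e) \<le> \<delta> \<Longrightarrow> k * (norm (u - e))\<^sup>2 / 2 \<le> V u"
proof -
  let ?H = "hessian V e"
  obtain \<delta> where \<delta>: "0 < \<delta>" "\<And>h. norm h \<le> \<delta> \<Longrightarrow> norm (grad V (e + h) - ?H *v h) \<le> (mu1 V e - k) * norm h"
    using grad_expansion[OF assms(2,3), of "mu1 V e - k"] k by auto
  have "k * (norm (u - e))\<^sup>2 / 2 \<le> V u" if u: "norm (u - e) \<le> \<delta>" for u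
  proof -
    define v where "v = u - e"
    define \<phi> where "\<phi> s = V (e + s *\<^sub>R v) - k * (norm v)\<^sup>2 * s\<^sup>2 / 2" for s
    have "\<phi> 0 \<le> \<phi> 1"
    proof (rule DERIV_nonneg_imp_nondecreasing[where f = \<phi> and a = 0 and b = 1])
      fix s :: real assume s: "0 \<le> s" "s \<le> 1"
      have d: "(\<phi> has_real_derivative (grad V (e + s *\<^sub>R v) \<bullet> v - k * (norm v)\<^sup>2 * s)) (at s)"
        unfolding \<phi>_def[abs_def]
        by (rule derivative_eq_intros line_derivative V refl | simp)+
      have "0 \<le> grad V (e + s *\<^sub>R v) \<bullet> v - k * (norm v)\<^sup>2 * s"
      proof -
        define r where "r = grad V (e + s *\<^sub>R v) - ?H *v (s *\<^sub>R v)"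
        have "norm (s *\<^sub>R v) \<le> \<delta>"
          using u s mult_left_le_one_le[of "norm v" s] by (simp add: v_def)
        then have "norm r \<le> (mu1 V e - k) * norm (s *\<^sub>R v)" unfolding r_def by (rule \<delta>(2))
        then have "norm r * norm v \<le> (mu1 V e - k) * norm (s *\<^sub>R v) * norm v" by (rule mult_right_mono) simp
        moreover have "\<bar>r \<bullet> v\<bar> \<le> norm r * norm v" by (rule Cauchy_Schwarz_ineq2)
        moreover have "(mu1 V e - k) * norm (s *\<^sub>R v) * norm v = s * (mu1 V e * (norm v)\<^sup>2) - k * (norm v)\<^sup>2 * s"
          using s by (simp add: power2_eq_square algebra_simps)
        moreover have "grad V (e + s *\<^sub>R v) \<bullet> v = s * ((?H *v v) \<bullet> v) + r \<bullet> v"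
          by (simp add: r_def matrix_vector_mult_scaleR inner_diff_left)
        moreover have "s * (mu1 V e * (norm v)\<^sup>2) \<le> s * ((?H *v v) \<bullet> v)"
          using s by (intro mult_left_mono mu1_le_quadratic_form hessian_symmetric V assms)
        ultimately show ?thesis by argo
      qed
      with d show "\<exists>y. (\<phi> has_real_derivative y) (at s) \<and> 0 \<le> y" by blast
    qed simp
    then show ?thesis using assms(4) by (simp add: \<phi>_def v_def)
  qed
  then show thesis by (intro that[OF \<delta>(1)]) blast
qed

section \<open>The threshold and its minimizer in terms of the linear and quadratic speeds\<close>

theorem mainTheorem3:
  fixes V :: "real^'d \<Rightarrow> real" and e :: "real^'d"
  assumes "C2 V"
    and "coercive V"
    and "grad V e = 0"
    and "V e = 0"
    and "\<exists>m. (\<forall>u. V m \<le> V u) \<and> V m < 0"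
  shows "C_minus_inf V e = {0<..<c_nl V e} \<and> C_zero V e = {c_nl V e..} \<and>
    (c_lin V e = 0 \<longrightarrow> c_lin V e < c_nl V e) \<and>
    (c_lin V e < c_nl V e \<longrightarrow>
       c_nl V e < c_qh V e \<and>
       (\<forall>c>0. has_nontrivial_minimizer V e c \<longleftrightarrow> c = c_nl V e))"
proof -
  have V: "\<And>u. V differentiable (at u)" and dV: "grad V differentiable (at e)"
    using assms(1) by (auto simp: C2_def)
  obtain m where m: "\<And>u. V m \<le> V u" "V m < 0" using assms(5) by blast
  note near = potential_near_critical_point[OF V dV assms(3,4)]
  interpret potential V e m
  proof
    show "continuous_on UNIV V"
      using V by (intro continuous_at_imp_continuous_on ballI differentiable_imp_continuous_within)
    obtain \<delta> where \<delta>: "0 < \<delta>" "\<And>u. norm (u - e) \<le> \<delta> \<Longrightarrow> (mu1 V e - 1) * (norm (u - e))\<^sup>2 / 2 \<le> V u"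
      using near[of "mu1 V e - 1"] by auto
    \<comment> \<open>the second value makes the quadratic bound at most V m outside the ball of radius \<delta>\<close>
    define \<mu> where "\<mu> = min (mu1 V e - 1) (2 * V m / \<delta>\<^sup>2)"
    have "\<mu> * (norm (u - e))\<^sup>2 / 2 \<le> V u" for u
    proof (cases "norm (u - e) \<le> \<delta>")
      case True
      have "\<mu> * (norm (u - e))\<^sup>2 \<le> (mu1 V e - 1) * (norm (u - e))\<^sup>2"
        by (intro mult_right_mono) (auto simp: \<mu>_def)
      then show ?thesis using \<delta>(2)[OF True] by simp
    next
      case False
      then have "\<delta>\<^sup>2 \<le> (norm (u - e))\<^sup>2" using \<delta>(1) by (intro power_mono) auto
      then have "2 * V m / \<delta>\<^sup>2 * (norm (u - e))\<^sup>2 \<le> 2 * V m / \<delta>\<^sup>2 * \<delta>\<^sup>2"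
        using m(2) \<delta>(1) by (intro mult_left_mono_neg) (auto simp: divide_nonpos_pos)
      moreover have "\<mu> * (norm (u - e))\<^sup>2 \<le> 2 * V m / \<delta>\<^sup>2 * (norm (u - e))\<^sup>2"
        by (intro mult_right_mono) (auto simp: \<mu>_def)
      ultimately show ?thesis using m(1)[of u] \<delta>(1) by simp
    qed
    then show "\<exists>\<mu>. \<forall>u. \<mu> * (norm (u - e))\<^sup>2 / 2 \<le> V u" by blast
  qed (use m assms(4) in auto)
  have "c_nl V e < c_qh V e \<and> (\<forall>c>0. has_nontrivial_minimizer V e c \<longleftrightarrow> c = c_nl V e)"
    if lin: "c_lin V e < c_nl V e"
  proof -
    have "max 0 (- mu1 V e) < (c_nl V e)\<^sup>2 / 4"
    proof (cases "mu1 V e < 0")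
      case True
      then have "sqrt (- mu1 V e) < c_nl V e / 2" using lin by (simp add: c_lin_def)
      then have "(sqrt (- mu1 V e))\<^sup>2 < (c_nl V e / 2)\<^sup>2" using True by (intro power_strict_mono) auto
      then show ?thesis using True by (simp add: power_divide)
    qed (use threshold(1) in simp)
    then obtain \<kappa> where "max 0 (- mu1 V e) < \<kappa>" and \<kappa>: "\<kappa> < (c_nl V e)\<^sup>2 / 4" using dense by blast
    then have \<kappa>0: "0 \<le> \<kappa>" "- \<kappa> < mu1 V e" by auto
    obtain \<delta> where \<delta>: "0 < \<delta>" "\<And>u. norm (u - e) \<le> \<delta> \<Longrightarrow> - \<kappa> * (norm (u - e))\<^sup>2 / 2 \<le> V u"
      using near[OF \<kappa>0(2)] by blast
    have min: "has_nontrivial_minimizer V e (c_nl V e)"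
      by (rule threshold_minimizer[OF \<kappa>0(1) \<kappa> \<delta>])
    have qh: "mu_qh V e * (norm (u - e))\<^sup>2 / 2 \<le> V u" for u
    proof (cases "u = e")
      case False
      define S where "S = {\<mu>. \<forall>u. V u \<ge> \<mu> * (norm (u - e))\<^sup>2 / 2}"
      have "\<mu> \<le> 2 * V u / (norm (u - e))\<^sup>2" if "\<mu> \<in> S" for \<mu>
        using that False by (auto simp: S_def field_simps)
      moreover have "S \<noteq> {}" using quadratic_bound by (auto simp: S_def)
      ultimately have "Sup S \<le> 2 * V u / (norm (u - e))\<^sup>2" by (intro cSup_least)
      then show ?thesis using False by (simp add: mu_qh_def S_def field_simps)
    qed (use assms(4) in simp)
    have "c_nl V e < c_qh V e"
      unfolding c_qh_def by (rule threshold_less[OF \<kappa> \<delta> qh min])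
    moreover have "has_nontrivial_minimizer V e c \<longleftrightarrow> c = c_nl V e" if "0 < c" for c
      using nontrivial_minimizer_speed[OF that] min by blast
    ultimately show ?thesis by blast
  qed
  then show ?thesis using threshold(1-3) by simp
qed

end
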